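(* Let $X,U$ be Banach lattices, let $p\in[1,\infty)$, and let $A:D(A)\subset X\to X$ be a densely defined resolvent positive operator such that, for some $\mu_0>s(A)$ and some constant $c>0$, $$\Vert R(\mu_0,A)x\Vert\ \ge\ c\,\Vert x\Vert\qquad\text{for all }x\in X_+ .$$ Let $B\in\mathcal{L}(U,X_{-1})$ be a positive operator. Then $B$ is an $L^p$-admissible (positive) control operator for $A$.
   Context: For a Banach lattice $E$, $E_+$ is its positive cone. $R(\mu,A)=(\mu I-A)^{-1}$, $\rho(A)$ is the resolvent set, and $s(A)=\sup\{\mathrm{Re}\,\mu:\mu\in\sigma(A)\}$ is the spectral bound. A linear operator $A$ on a Banach lattice $X$ is resolvent positive if there is $\omega\in\mathbb{R}$ with $(\omega,\infty)\subset\rho(A)$ and $R(\mu,A)\ge 0$ for all $\mu>\omega$. (Under the assumptions of the claim, a known theorem of Arendt shows that $A$ generates a positive $C_0$-semigroup $\mathbb{T}=(T(t))_{t\ge0}$ on $X$, so the notions below make sense.) The extrapolation space $X_{-1}$ is the completion of $X$ for the norm $\Vert x\Vert_{-1}=\Vert R(\mu,A)x\Vert$, with $\mu\in\rho(A)$ (different $\mu$ give equivalent norms). $\mathbb{T}$ extends uniquely to a $C_0$-semigroup $\mathbb{T}_{-1}=(T_{-1}(t))_{t\ge0}$ on $X_{-1}$, with generator $A_{-1}$. $X_{-1,+}$ denotes the closure of $X_+$ in $X_{-1}$. An operator $B\in\mathcal{L}(U,X_{-1})$ is positive if $BU_+\subset X_{-1,+}$. $B\in\mathcal{L}(U,X_{-1})$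 is an $L^p$-admissible control operator for $A$ if for some $\tau>0$ the integral $\Phi_\tau u:=\int_0^\tau T_{-1}(\tau-s)Bu(s)\,ds$ (computed in $X_{-1}$) belongs to $X$ for every $u\in L^p(\mathbb{R}_+;U)$. *)

theory Defs
  imports "HOL-Analysis.Analysis"
begin

text \<open>Real Banach lattices; \<open>sup x (- x)\<close> is the modulus \<open>|x|\<close>.\<close>

class banach_lattice = banach + ordered_real_vector + lattice +
  assumes norm_le_if_modulus_le: "sup x (- x) \<le> sup y (- y) \<Longrightarrow> norm x \<le> norm y"


section \<open>Unbounded operators, spectrum and resolvent\<close>

text \<open>An operator is given by its domain \<open>D\<close> and a function \<open>A\<close>, whose values outside \<open>D\<close>
  are irrelevant.\<close>

definition linear_operator :: "'x::real_vector set \<Rightarrow> ('x \<Rightarrow> 'x) \<Rightarrow> bool" where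
  "linear_operator D A \<longleftrightarrow> subspace D \<and>
     (\<forall>x\<in>D. \<forall>y\<in>D. A (x + y) = A x + A y) \<and> (\<forall>x\<in>D. \<forall>a. A (a *\<^sub>R x) = a *\<^sub>R A x)"

text \<open>The spectrum consists of complex numbers, so it is taken in the complexification of the space.
  The pair \<open>(x, y)\<close> stands for \<open>x + iy\<close>, and \<open>complex_shift A \<mu>\<close> is \<open>\<mu>I - A\<close> on such pairs. The
  product norm is equivalent to the usual norm of the complexification, hence yields the same
  bounded operators.\<close>

definition complex_shift :: "('x::real_vector \<Rightarrow> 'x) \<Rightarrow> complex \<Rightarrow> 'x \<times> 'x \<Rightarrow> 'x \<times> 'x" where
  "complex_shift A \<mu> = (\<lambda>(x, y).
     (Re \<mu> *\<^sub>R x - Im \<mu> *\<^sub>R y - A x, Im \<mu> *\<^sub>R x + Re \<mu> *\<^sub>R y - A y))"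

definition resolvent_set :: "'x::real_normed_vector set \<Rightarrow> ('x \<Rightarrow> 'x) \<Rightarrow> complex set" where
  "resolvent_set D A = {\<mu>. bij_betw (complex_shift A \<mu>) (D \<times> D) UNIV \<and>
     bounded_linear (inv_into (D \<times> D) (complex_shift A \<mu>))}"

definition spectrum :: "'x::real_normed_vector set \<Rightarrow> ('x \<Rightarrow> 'x) \<Rightarrow> complex set" where
  "spectrum D A = - resolvent_set D A"

text \<open>The spectrum of an unbounded operator may be empty, in which case the spectral bound
  is \<open>-\<infinity>\<close>.\<close>

definition spectral_bound :: "'x::real_normed_vector set \<Rightarrow> ('x \<Rightarrow> 'x) \<Rightarrow> ereal" where
  "spectral_bound D A = (SUP \<mu>\<in>spectrum D A. ereal (Re \<mu>))"

text \<open>For real \<open>\<mu>\<close> in the resolvent set, \<open>R(\<mu>,A)\<close> maps the real space into itself.\<close>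

definition resolvent :: "'x::real_vector set \<Rightarrow> ('x \<Rightarrow> 'x) \<Rightarrow> real \<Rightarrow> 'x \<Rightarrow> 'x" where
  "resolvent D A \<mu> = inv_into D (\<lambda>x. \<mu> *\<^sub>R x - A x)"

definition resolvent_positive :: "'x::banach_lattice set \<Rightarrow> ('x \<Rightarrow> 'x) \<Rightarrow> bool" where
  "resolvent_positive D A \<longleftrightarrow> (\<exists>\<omega>. \<forall>\<mu>>\<omega>. complex_of_real \<mu> \<in> resolvent_set D A \<and>
     (\<forall>x\<ge>0. resolvent D A \<mu> x \<ge> 0))"


section \<open>Semigroups\<close>

definition C0_semigroup :: "(real \<Rightarrow> 'x::real_normed_vector \<Rightarrow>\<^sub>L 'x) \<Rightarrow> bool" where
  "C0_semigroup T \<longleftrightarrow> T 0 = id_blinfun \<and>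
     (\<forall>s\<ge>0. \<forall>t\<ge>0. T (s + t) = T s o\<^sub>L T t) \<and>
     (\<forall>x. ((\<lambda>t. blinfun_apply (T t) x) \<longlongrightarrow> x) (at_right 0))"

definition generates ::
    "'x::real_normed_vector set \<Rightarrow> ('x \<Rightarrow> 'x) \<Rightarrow> (real \<Rightarrow> 'x \<Rightarrow>\<^sub>L 'x) \<Rightarrow> bool" where
  "generates D A T \<longleftrightarrow> C0_semigroup T \<and>
     (\<forall>x y. x \<in> D \<and> A x = y \<longleftrightarrow>
        ((\<lambda>h. (blinfun_apply (T h) x - x) /\<^sub>R h) \<longlongrightarrow> y) (at_right 0))"


section \<open>The extrapolation space\<close>

text \<open>The space \<open>X\<^sub>-\<^sub>1\<close> is a completion of \<open>X\<close>, hence given up to isometric isomorphism as a Banach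
  space \<open>'y\<close> with an embedding \<open>j\<close> of \<open>X\<close> that has dense range and is isometric for the norm
  \<open>\<parallel>R(\<mu>,A)x\<parallel>\<close>. Up to an equivalent norm it does not depend on \<open>\<mu>\<close>.\<close>

definition extrapolation_space ::
    "'x::real_normed_vector set \<Rightarrow> ('x \<Rightarrow> 'x) \<Rightarrow> ('x \<Rightarrow> 'y::banach) \<Rightarrow> bool" where
  "extrapolation_space D A j \<longleftrightarrow> linear j \<and> closure (range j) = UNIV \<and>
     (\<exists>\<mu>. complex_of_real \<mu> \<in> resolvent_set D A \<and> (\<forall>x. norm (j x) = norm (resolvent D A \<mu> x)))"

definition extrapolation_cone :: "('x::banach_lattice \<Rightarrow> 'y::banach) \<Rightarrow> 'y set" where
  "extrapolation_cone j = closure (j ` {x. 0 \<le> x})"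

definition positive_control ::
    "('x::banach_lattice \<Rightarrow> 'y::banach) \<Rightarrow> ('u::banach_lattice \<Rightarrow>\<^sub>L 'y) \<Rightarrow> bool" where
  "positive_control j B \<longleftrightarrow> (\<forall>u\<ge>0. blinfun_apply B u \<in> extrapolation_cone j)"

definition extrapolated_semigroup ::
    "('x::real_normed_vector \<Rightarrow> 'y::banach) \<Rightarrow> (real \<Rightarrow> 'x \<Rightarrow>\<^sub>L 'x) \<Rightarrow> (real \<Rightarrow> 'y \<Rightarrow>\<^sub>L 'y) \<Rightarrow> bool"
where
  "extrapolated_semigroup j T S \<longleftrightarrow> C0_semigroup S \<and>
     (\<forall>t\<ge>0. \<forall>x. blinfun_apply (S t) (j x) = j (blinfun_apply (T t) x))"


section \<open>Integration in arbitrary Banach spaces\<close>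

text \<open>Measurability and integrability in the library are restricted to second countable value spaces.
  The following are the usual notions (strong measurability, Bochner integral) for arbitrary ones.\<close>

definition strongly_measurable :: "'a measure \<Rightarrow> ('a \<Rightarrow> 'b::real_normed_vector) \<Rightarrow> bool" where
  "strongly_measurable M f \<longleftrightarrow> (\<exists>s. (\<forall>i::nat. simple_function M (s i)) \<and>
     (AE x in M. (\<lambda>i. s i x) \<longlonglongrightarrow> f x))"

definition has_strong_bochner_integral ::
    "'a measure \<Rightarrow> ('a \<Rightarrow> 'b::real_normed_vector) \<Rightarrow> 'b \<Rightarrow> bool" where
  "has_strong_bochner_integral M f I \<longleftrightarrow> strongly_measurable M f \<and>
     (\<exists>s. (\<forall>i::nat. Bochner_Integration.simple_bochner_integrable M (s i)) \<and>
        (\<lambda>i. \<integral>\<^sup>+x. ennreal (norm (f x - s i x)) \<partial>M) \<longlonglongrightarrow> 0 \<and>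
        (\<lambda>i. Bochner_Integration.simple_bochner_integral M (s i)) \<longlonglongrightarrow> I)"

definition Lp_function :: "real \<Rightarrow> 'a measure \<Rightarrow> ('a \<Rightarrow> 'b::real_normed_vector) \<Rightarrow> bool" where
  "Lp_function p M u \<longleftrightarrow> strongly_measurable M u \<and> integrable M (\<lambda>s. norm (u s) powr p)"


section \<open>Admissible control operators\<close>

text \<open>Both semigroups are unique if they exist: \<open>T\<close> is determined by its generator, and \<open>S\<close> by
  \<open>T\<close> because \<open>j\<close> has dense range. Their existence is part of the definition.\<close>

definition Lp_admissible ::
    "real \<Rightarrow> 'x::banach_lattice set \<Rightarrow> ('x \<Rightarrow> 'x) \<Rightarrow> ('x \<Rightarrow> 'y::banach) \<Rightarrow>
      ('u::banach_lattice \<Rightarrow>\<^sub>L 'y) \<Rightarrow> bool" where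
  "Lp_admissible p D A j B \<longleftrightarrow> (\<exists>T S. generates D A T \<and> extrapolated_semigroup j T S \<and>
     (\<exists>\<tau>>0. \<forall>u. Lp_function p (lebesgue_on {0..}) u \<longrightarrow>
        (\<exists>x. has_strong_bochner_integral (lebesgue_on {0..\<tau>})
               (\<lambda>s. blinfun_apply (S (\<tau> - s)) (blinfun_apply B (u s))) (j x))))"

end

theory Submission
  imports Defs
begin

text \<open>Let \<open>x \<ge> 0\<close>. After a shift, \<open>0\<close> is in the resolvent set and \<open>c\<parallel>x\<parallel> \<le> \<parallel>R(0)x\<parallel>\<close>, and
  \<open>\<lambda>R(\<lambda>)R(0) = R(0) - R(\<lambda>) \<le> R(0)\<close> bounds all powers of \<open>\<lambda>R(\<lambda>)\<close>. So \<open>A\<close> generates a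
  positive bounded semigroup \<open>T\<close>, obtained here as the limit of the implicit Euler scheme
  \<open>(I - 2\<^sup>-\<^sup>kA)\<^sup>-\<^sup>n\<close> with \<open>n = \<lfloor>2\<^sup>kt\<rfloor>\<close>, and \<open>T\<close> extends to the extrapolation space.

  For a step function \<open>u\<close> the integral \<open>\<Phi>u\<close> lies in the space itself, because an integral of a semigroup
  orbit over an interval lies in the domain of the generator. If moreover \<open>u \<ge> 0\<close> then \<open>\<Phi>u \<ge> 0\<close>, and the
  hypothesis says that on the positive cone the norm is dominated by the extrapolation norm, in which
  \<open>\<Phi>u\<close> is bounded by the \<open>L\<^sup>1\<close> norm of \<open>u\<close>. Splitting \<open>u\<close> into positive and negative parts gives the
  same bound for all step functions, and these are dense in \<open>L\<^sup>1\<close>.\<close>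

section \<open>Banach lattices and limits of uniformly Lipschitz maps\<close>

text \<open>Three points of the resolvent set occur: \<open>\<mu>\<^sub>0\<close> carries the lower
  bound, some \<open>\<mu>\<close> defines the extrapolation norm, and all resolvents at and beyond
  \<open>\<omega>\<close> are positive. The resolvent identity brings the lower bound and the norm
  to \<open>\<omega>\<close>. Once A - \<omega> is invertible, its extended inverse identifies the
  extrapolation space with the space itself, so the semigroup there is a conjugate and needs no
  separate construction. The Euler scheme suits the hypotheses because its approximants are powers
  of positive operators with one common bound. Halving the step changes a single step by order
  4^(-k) on the domain of the square, which leads to a geometric series. The exponent p enters
  through the inclusion of L^p in L^1 on [0,1]. Value spaces may be nonseparable, so integrals are
  handled through Riemann sums on dyadic grids, read as integrals of simple functions. The norm
  estimate rests on one more fact: the closure of the cone in the weaker norm contains no element of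
  the space outside the cone.\<close>

lemma modulus_nonneg: "0 \<le> sup x (- x)" for x :: "'x::banach_lattice"
proof -
  have "x + - x \<le> sup x (- x) + sup x (- x)"
    by (rule add_mono[OF sup_ge1 sup_ge2])
  then have "0 \<le> 2 *\<^sub>R sup x (- x)"
    by (simp only: scaleR_2 add.right_inverse)
  from scaleR_left_mono[OF this, of "1/2"] show ?thesis
    by (simp only: scaleR_scaleR scaleR_zero_right) simp
qed

lemma modulus_of_nonneg: "0 \<le> x \<Longrightarrow> sup x (- x) = x" for x :: "'x::banach_lattice"
  by (rule sup_absorb1) (rule order_trans[of _ 0]; simp)

lemma norm_modulus: "norm (sup x (- x)) = norm x" for x :: "'x::banach_lattice"
  by (intro antisym norm_le_if_modulus_le) (simp_all only: modulus_of_nonneg modulus_nonneg order_refl)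

lemma norm_mono_nonneg: "0 \<le> x \<Longrightarrow> x \<le> y \<Longrightarrow> norm x \<le> norm y" for x y :: "'x::banach_lattice"
  by (rule norm_le_if_modulus_le) (frule (1) order_trans, simp only: modulus_of_nonneg)

text \<open>The negative part of \<open>x\<close> bounds the distance to the cone from below: if
  \<open>f n\<close> is nonnegative, then \<open>- x\<close> is at most \<open>- (x - f n)\<close>,
  so \<open>sup (- x) 0\<close> is dominated by the modulus of \<open>x - f n\<close>. Along a
  convergent sequence it therefore vanishes.\<close>

lemma closed_nonneg: "closed {x::'x::banach_lattice. 0 \<le> x}"
  unfolding closed_sequential_limits
proof (intro allI impI, elim conjE)
  fix f and x :: 'x
  assume f: "\<forall>n. f n \<in> {x. 0 \<le> x}" and lim: "f \<longlonglongrightarrow> x"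
  have le: "norm (sup (- x) 0) \<le> norm (x - f n)" for n
  proof -
    have "- x \<le> - (x - f n)"
      using f by simp
    also have "\<dots> \<le> sup (x - f n) (- (x - f n))"
      by (rule sup_ge2)
    finally have "sup (- x) 0 \<le> sup (x - f n) (- (x - f n))"
      using modulus_nonneg by (rule sup_least)
    then have "norm (sup (- x) 0) \<le> norm (sup (x - f n) (- (x - f n)))"
      by (intro norm_mono_nonneg) auto
    then show ?thesis
      by (simp only: norm_modulus)
  qed
  have "(\<lambda>n. norm (x - f n)) \<longlonglongrightarrow> norm (x - x)"
    by (intro tendsto_intros lim)
  then have "norm (sup (- x) 0) \<le> norm (x - x)"
    by (rule LIMSEQ_le_const) (use le in auto)
  then have "sup (- x) 0 = 0"
    by simp
  then have "- x \<le> 0"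
    by (metis sup_ge1)
  then show "x \<in> {x. 0 \<le> x}"
    by simp
qed

text \<open>Both \<open>sup x 0\<close> and \<open>sup x 0 - x\<close> lie between 0 and the modulus
  of \<open>x\<close>. This serves to pass from nonnegative controls to arbitrary ones.\<close>

lemma pos_neg_parts:
  fixes x :: "'x::banach_lattice"
  obtains y z where "0 \<le> y" "0 \<le> z" "x = y - z" "norm y \<le> norm x" "norm z \<le> norm x"
proof
  let ?y = "sup x 0" and ?z = "sup x 0 - x"
  show "0 \<le> ?y" "0 \<le> ?z" "x = ?y - ?z"
    by auto
  have y: "?y \<le> sup x (- x)"
    by (simp add: modulus_nonneg)
  have "norm ?y \<le> norm (sup x (- x))"
    by (rule norm_mono_nonneg[OF _ y]) auto
  then show "norm ?y \<le> norm x"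
    by (simp only: norm_modulus)
  have "sup x 0 \<le> x + sup x (- x)"
  proof (rule sup_least)
    show "x \<le> x + sup x (- x)"
      by (simp add: modulus_nonneg)
    have "x + - x \<le> x + sup x (- x)"
      by (intro add_left_mono sup_ge2)
    then show "0 \<le> x + sup x (- x)"
      by simp
  qed
  then have z: "?z \<le> sup x (- x)"
    by (simp add: diff_le_eq add.commute)
  have "norm ?z \<le> norm (sup x (- x))"
    by (rule norm_mono_nonneg[OF _ z]) auto
  then show "norm ?z \<le> norm x"
    by (simp only: norm_modulus)
qed


section \<open>Extending convergence and isometries from a dense set\<close>

lemma approx_by_dense:
  fixes x :: "'x::real_normed_vector"
  assumes x: "x \<in> closure S" and e: "0 < e"
  obtains y where "y \<in> S" "M * norm (x - y) < e"
proof -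
  have "0 < e / (\<bar>M\<bar> + 1)"
    using e by simp
  then obtain y where y: "y \<in> S" "dist y x < e / (\<bar>M\<bar> + 1)"
    using x unfolding closure_approachable by blast
  have "M * norm (x - y) \<le> (\<bar>M\<bar> + 1) * norm (x - y)"
    by (intro mult_right_mono) auto
  also have "\<dots> < e"
    using y(2) by (simp add: dist_norm norm_minus_commute field_simps)
  finally show ?thesis
    using y(1) that by blast
qed

text \<open>A three-epsilon argument. The filter is arbitrary because both sequences of approximants
  and times tending to 0 from the right occur.\<close>

lemma tendsto_on_closure:
  fixes F :: "'a \<Rightarrow> 'x::real_normed_vector \<Rightarrow> 'y::real_normed_vector"
  assumes lip: "\<forall>\<^sub>F a in G. \<forall>x y. norm (F a x - F a y) \<le> M * norm (x - y)"
    and lipL: "\<And>x y. norm (L x - L y) \<le> N * norm (x - y)"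
    and S: "\<And>y. y \<in> S \<Longrightarrow> ((\<lambda>a. F a y) \<longlongrightarrow> L y) G"
    and x: "x \<in> closure S"
  shows "((\<lambda>a. F a x) \<longlongrightarrow> L x) G"
proof (rule tendstoI)
  fix e :: real
  assume e: "0 < e"
  then obtain y where y: "y \<in> S" "(\<bar>M\<bar> + \<bar>N\<bar>) * norm (x - y) < e / 2"
    using approx_by_dense[OF x, of "e / 2"] by (metis half_gt_zero)
  have "\<forall>\<^sub>F a in G. dist (F a y) (L y) < e / 2"
    using S[OF y(1)] e by (intro tendstoD) auto
  with lip show "\<forall>\<^sub>F a in G. dist (F a x) (L x) < e"
  proof eventually_elim
    case (elim a)
    have "norm (F a x - L x) = norm ((F a x - F a y) + (F a y - L y) + (L y - L x))"
      by simp
    also have "\<dots> \<le> norm (F a x - F a y) + norm (F a y - L y) + norm (L y - L x)"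
      by (intro norm_triangle_le add_mono) auto
    also have "\<dots> \<le> M * norm (x - y) + norm (F a y - L y) + N * norm (x - y)"
      using elim(1) lipL[of y x] by (intro add_mono) (auto simp: norm_minus_commute)
    also have "\<dots> \<le> (\<bar>M\<bar> + \<bar>N\<bar>) * norm (x - y) + norm (F a y - L y)"
      using mult_right_mono[OF abs_ge_self[of M], of "norm (x - y)"]
        mult_right_mono[OF abs_ge_self[of N], of "norm (x - y)"] by (simp add: algebra_simps)
    also have "\<dots> < e"
      using y(2) elim(2) by (simp add: dist_norm)
    finally show ?case
      by (simp add: dist_norm)
  qed
qed

lemma convergent_on_closure:
  fixes F :: "nat \<Rightarrow> 'x::real_normed_vector \<Rightarrow> 'y::banach"
  assumes lip: "\<And>n x y. norm (F n x - F n y) \<le> M * norm (x - y)"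
    and S: "\<And>y. y \<in> S \<Longrightarrow> convergent (\<lambda>n. F n y)"
    and x: "x \<in> closure S"
  shows "convergent (\<lambda>n. F n x)"
proof (rule Cauchy_convergent, rule metric_CauchyI)
  fix e :: real
  assume e: "0 < e"
  then obtain y where y: "y \<in> S" "M * norm (x - y) < e / 3"
    using approx_by_dense[OF x, of "e / 3"] by (metis divide_pos_pos zero_less_numeral)
  obtain N where N: "dist (F m y) (F n y) < e / 3" if "m \<ge> N" "n \<ge> N" for m n
    using convergent_Cauchy[OF S[OF y(1)]] e by (metis metric_CauchyD divide_pos_pos zero_less_numeral)
  have "dist (F m x) (F n x) < e" if "m \<ge> N" "n \<ge> N" for m n
  proof -
    have "norm (F m x - F n x) = norm ((F m x - F m y) + (F m y - F n y) + (F n y - F n x))"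
      by simp
    also have "\<dots> \<le> norm (F m x - F m y) + norm (F m y - F n y) + norm (F n y - F n x)"
      by (intro norm_triangle_le add_mono) auto
    also have "\<dots> < e / 3 + e / 3 + e / 3"
      using N[OF that] y(2) lip[of m x y] lip[of n y x]
      by (intro add_strict_mono) (auto simp: dist_norm norm_minus_commute)
    finally show ?thesis
      by (simp add: dist_norm)
  qed
  then show "\<exists>N. \<forall>m\<ge>N. \<forall>n\<ge>N. dist (F m x) (F n x) < e"
    by blast
qed

text \<open>Both maps induce the same seminorm, so the two targets are completions of the same
  seminormed space, hence canonically isomorphic. Applied to \<open>j\<close> and a resolvent, this
  identifies the extrapolation space with the space itself.\<close>

lemma isometric_extension:
  fixes f :: "'x::real_vector \<Rightarrow> 'y::banach" and g :: "'x \<Rightarrow> 'z::banach"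
  assumes f: "linear f" "closure (range f) = UNIV" and g: "linear g" "closure (range g) = UNIV"
    and iso: "\<And>x. norm (f x) = norm (g x)"
  obtains K :: "'y \<Rightarrow>\<^sub>L 'z" and L :: "'z \<Rightarrow>\<^sub>L 'y"
  where "\<And>x. K (f x) = g x" "\<And>y. L (K y) = y" "\<And>z. K (L z) = z"
proof -
  have ex: "\<exists>K :: 'u \<Rightarrow>\<^sub>L 'v. \<forall>x. K (f x) = g x"
    if f: "linear f" "closure (range f) = UNIV" and g: "linear g"
      and iso: "\<And>x. norm (f x) = norm (g x)"
    for f :: "'x \<Rightarrow> 'u::banach" and g :: "'x \<Rightarrow> 'v::banach"
  proof -
    have "\<exists>s. (\<lambda>n. f (s n)) \<longlonglongrightarrow> y" for y
    proof -
      have "y \<in> closure (range f)"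
        using f by simp
      then obtain t where t: "\<And>n. t n \<in> range f" "t \<longlonglongrightarrow> y"
        unfolding closure_sequential by blast
      then have "\<exists>s. \<forall>n. t n = f (s n)"
        by (intro choice) (use t(1) in blast)
      then obtain s where "t = (\<lambda>n. f (s n))"
        by blast
      with t show ?thesis
        by blast
    qed
    then have "\<exists>s. \<forall>y. (\<lambda>n. f (s y n)) \<longlonglongrightarrow> y"
      by (intro choice) blast
    then obtain s where s: "(\<lambda>n. f (s y n)) \<longlonglongrightarrow> y" for y
      by blast
    have conv: "convergent (\<lambda>n. g (r n))" if "(\<lambda>n. f (r n)) \<longlonglongrightarrow> y" for r y
    proof (rule Cauchy_convergent)
      have "dist (g (r m)) (g (r n)) = dist (f (r m)) (f (r n))" for m n
        by (simp add: dist_norm linear_diff[OF f(1), symmetric] linear_diff[OF g(1), symmetric] iso)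
      then show "Cauchy (\<lambda>n. g (r n))"
        using LIMSEQ_imp_Cauchy[OF that] by (simp add: Cauchy_def)
    qed
    define K where "K y = lim (\<lambda>n. g (s y n))" for y
    \<comment> \<open>The limit does not depend on the approximating sequence; linearity follows by
      evaluating \<open>K\<close> along sums and multiples of sequences.\<close>
    have K: "(\<lambda>n. g (r n)) \<longlonglongrightarrow> K y" if r: "(\<lambda>n. f (r n)) \<longlonglongrightarrow> y" for r y
    proof -
      have "(\<lambda>n. f (r n) - f (s y n)) \<longlonglongrightarrow> y - y"
        by (intro tendsto_diff s r)
      then have "(\<lambda>n. norm (g (r n) - g (s y n))) \<longlonglongrightarrow> norm (y - y)"
        by (simp add: linear_diff[OF f(1), symmetric] linear_diff[OF g(1), symmetric]
            iso[symmetric] tendsto_norm_zero_iff)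
      then have "(\<lambda>n. g (r n) - g (s y n)) \<longlonglongrightarrow> 0"
        by (simp add: tendsto_norm_zero_iff)
      moreover have "(\<lambda>n. g (s y n)) \<longlonglongrightarrow> K y"
        using conv[OF s] unfolding K_def by (simp add: convergent_LIMSEQ_iff)
      ultimately have "(\<lambda>n. (g (r n) - g (s y n)) + g (s y n)) \<longlonglongrightarrow> 0 + K y"
        by (rule tendsto_add)
      then show ?thesis
        by simp
    qed
    have "bounded_linear K"
    proof (rule bounded_linear_intro[where K = 1])
      fix x y and a :: real
      have "(\<lambda>n. f (s x n + s y n)) \<longlonglongrightarrow> x + y"
        using tendsto_add[OF s s] by (simp add: linear_add[OF f(1)])
      from K[OF this] have "(\<lambda>n. g (s x n) + g (s y n)) \<longlonglongrightarrow> K (x + y)"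
        by (simp add: linear_add[OF g])
      then show "K (x + y) = K x + K y"
        by (rule LIMSEQ_unique) (intro tendsto_add K s)
      have "(\<lambda>n. f (a *\<^sub>R s x n)) \<longlonglongrightarrow> a *\<^sub>R x"
        using tendsto_scaleR[OF tendsto_const s, of a x] by (simp add: linear_scale[OF f(1)])
      from K[OF this] have "(\<lambda>n. a *\<^sub>R g (s x n)) \<longlonglongrightarrow> K (a *\<^sub>R x)"
        by (simp add: linear_scale[OF g])
      then show "K (a *\<^sub>R x) = a *\<^sub>R K x"
        by (rule LIMSEQ_unique) (intro tendsto_scaleR tendsto_const K s)
      have "(\<lambda>n. norm (g (s x n))) \<longlonglongrightarrow> norm (K x)"
        by (intro tendsto_norm K s)
      moreover have "(\<lambda>n. norm (g (s x n))) \<longlonglongrightarrow> norm x"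
        unfolding iso[symmetric] by (intro tendsto_norm s)
      ultimately show "norm (K x) \<le> norm x * 1"
        using LIMSEQ_unique by (metis mult.right_neutral order_refl)
    qed
    moreover have "K (f x) = g x" for x
      using K[of "\<lambda>n. x" "f x"] by (simp add: LIMSEQ_const_iff)
    ultimately show ?thesis
      by (intro exI[of _ "Blinfun K"]) (simp add: bounded_linear_Blinfun_apply)
  qed
  obtain K :: "'y \<Rightarrow>\<^sub>L 'z" where K: "\<And>x. K (f x) = g x"
    using ex[OF f g(1) iso] by metis
  obtain L :: "'z \<Rightarrow>\<^sub>L 'y" where L: "\<And>x. L (g x) = f x"
    using ex[OF g f(1) iso[symmetric]] by metis
  have cl: "closed {y. L (K y) = y}" "closed {z. K (L z) = z}"
    by (rule closed_Collect_eq; intro continuous_intros)+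
  have "closure (range f) \<subseteq> {y. L (K y) = y}"
    by (rule closure_minimal[OF _ cl(1)]) (auto simp: K L)
  moreover have "closure (range g) \<subseteq> {z. K (L z) = z}"
    by (rule closure_minimal[OF _ cl(2)]) (auto simp: K L)
  ultimately have "L (K y) = y" "K (L z) = z" for y z
    using f g by auto
  then show ?thesis
    using that[OF K] by blast
qed

section \<open>The implicit Euler scheme\<close>

text \<open>The hypotheses of the generation theorem for bounded semigroups, with an abstract family
  \<open>R l\<close> in the place of (l - A)^-1 so that a shifted resolvent can be inserted. The
  value l = 0 is included because \<open>R 0\<close> gives the extrapolation norm; the bound
  \<open>M\<close> is uniform in l > 0 and in the power.\<close>

locale power_bounded_resolvent =
  fixes D :: "'x::banach set" and A :: "'x \<Rightarrow> 'x" and R :: "real \<Rightarrow> 'x \<Rightarrow> 'x" and M :: real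
  assumes A_linear: "linear_operator D A"
    and D_dense: "closure D = UNIV"
    and R_bounded: "0 \<le> l \<Longrightarrow> bounded_linear (R l)"
    and R_in: "0 \<le> l \<Longrightarrow> R l x \<in> D"
    and R_right: "0 \<le> l \<Longrightarrow> l *\<^sub>R R l x - A (R l x) = x"
    and R_left: "0 \<le> l \<Longrightarrow> x \<in> D \<Longrightarrow> R l (l *\<^sub>R x - A x) = x"
    and M_nonneg: "0 \<le> M"
    and R_power: "0 < l \<Longrightarrow> norm (((\<lambda>y. l *\<^sub>R R l y) ^^ n) x) \<le> M * norm x"
begin

lemma D_subspace: "subspace D"
  and A_scale: "x \<in> D \<Longrightarrow> A (a *\<^sub>R x) = a *\<^sub>R A x"
  using A_linear by (auto simp: linear_operator_def)

lemma R_scale: "0 \<le> l \<Longrightarrow> R l (a *\<^sub>R x) = a *\<^sub>R R l x"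
  using linear_scale[OF bounded_linear.linear[OF R_bounded]] .

lemma R_diff: "0 \<le> l \<Longrightarrow> R l (x - y) = R l x - R l y"
  using linear_diff[OF bounded_linear.linear[OF R_bounded]] .

lemma A_R: "0 \<le> l \<Longrightarrow> A (R l x) = l *\<^sub>R R l x - x"
  using R_right[of l x] by (simp add: algebra_simps)

lemma R_A: "0 \<le> l \<Longrightarrow> x \<in> D \<Longrightarrow> R l (A x) = l *\<^sub>R R l x - x"
  using R_left[of l x] by (simp add: algebra_simps R_diff R_scale)

text \<open>Write R(l)x as R(l)(m - A)R(m)x, move m - A to the left through R(l), and cancel it with
  R(m).\<close>

lemma R_commute: "0 \<le> l \<Longrightarrow> 0 \<le> m \<Longrightarrow> R l (R m x) = R m (R l x)"
proof -
  assume l: "0 \<le> l" and m: "0 \<le> m"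
  let ?z = "R l (R m x)"
  have "R l x = R l (m *\<^sub>R R m x - A (R m x))"
    by (simp add: R_right m)
  also have "\<dots> = m *\<^sub>R ?z - A ?z"
    by (simp add: R_diff R_scale l R_A[OF l R_in[OF m]] A_R[OF l, of "R m x"])
  finally show ?thesis
    using R_left[OF m R_in[OF l, of "R m x"]] by simp
qed

text \<open>One implicit Euler step of size h = 2^(-k): (1/h)R(1/h) is (I - hA)^-1. With dyadic
  sizes, one step of a level is compared with exactly two steps of the next.\<close>

definition J :: "nat \<Rightarrow> 'x \<Rightarrow> 'x" where
  "J k = (\<lambda>x. 2 ^ k *\<^sub>R R (2 ^ k) x)"

lemma J_linear: "linear (J k)"
  unfolding J_def by (intro linear_compose_scale_right bounded_linear.linear R_bounded) simp

lemma Jn_linear: "linear (J k ^^ n)"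
  by (induction n) (auto simp: linear_iff linear_add[OF J_linear] linear_scale[OF J_linear])

lemmas Jn_diff = linear_diff[OF Jn_linear]
  and Jn_add = linear_add[OF Jn_linear]
  and Jn_scale = linear_scale[OF Jn_linear]

lemma Jn_bound: "norm ((J k ^^ n) x) \<le> M * norm x"
  unfolding J_def by (rule R_power) simp

lemma Jn_lipschitz: "norm ((J k ^^ n) x - (J k ^^ n) y) \<le> M * norm (x - y)"
  unfolding Jn_diff[symmetric] by (rule Jn_bound)

lemma J_in: "J k x \<in> D"
  unfolding J_def using D_subspace by (intro subspace_scale R_in) auto

lemma J_minus_id: "x \<in> D \<Longrightarrow> J k x - x = (1 / 2 ^ k) *\<^sub>R J k (A x)"
  by (simp add: J_def R_A)

lemma A_J: "x \<in> D \<Longrightarrow> A (J k x) = J k (A x)"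
  by (simp add: J_def A_scale R_in A_R R_A)

lemma Jn_in: "x \<in> D \<Longrightarrow> (J k ^^ n) x \<in> D"
  by (cases n) (auto simp: J_in)

lemma A_Jn: "x \<in> D \<Longrightarrow> A ((J k ^^ n) x) = (J k ^^ n) (A x)"
  by (induction n) (auto simp: A_J Jn_in)

lemma R_Jn: "0 \<le> l \<Longrightarrow> R l ((J k ^^ n) x) = (J k ^^ n) (R l x)"
proof (induction n)
  case (Suc n)
  then show ?case
    by (simp add: J_def R_scale) (metis R_commute zero_le_power zero_le_numeral)
qed simp

lemma Jn_step:
  assumes "x \<in> D"
  shows "norm ((J k ^^ Suc n) x - (J k ^^ n) x) \<le> M / 2 ^ k * norm (A x)"
proof -
  have "(J k ^^ Suc n) x - (J k ^^ n) x = (J k ^^ n) (J k x - x)"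
    by (simp add: Jn_diff funpow_swap1)
  also have "\<dots> = (1 / 2 ^ k) *\<^sub>R (J k ^^ Suc n) (A x)"
    using assms by (simp add: J_minus_id Jn_scale funpow_swap1)
  finally show ?thesis
    using Jn_bound[where k = k and n = "Suc n" and x = "A x"] by (simp add: divide_simps)
qed

lemma Jn_minus_id:
  assumes "x \<in> D"
  shows "norm ((J k ^^ n) x - x) \<le> real n / 2 ^ k * M * norm (A x)"
proof (induction n)
  case (Suc n)
  have "norm ((J k ^^ Suc n) x - x) \<le> norm ((J k ^^ Suc n) x - (J k ^^ n) x) + norm ((J k ^^ n) x - x)"
    using norm_triangle_ineq[of "(J k ^^ Suc n) x - (J k ^^ n) x" "(J k ^^ n) x - x"] by simp
  also have "\<dots> \<le> M / 2 ^ k * norm (A x) + real n / 2 ^ k * M * norm (A x)"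
    by (rule add_mono[OF Jn_step[OF assms] Suc])
  finally show ?case
    by (simp add: field_simps)
qed simp

text \<open>First-order Taylor expansion of the scheme. Each step adds h J^(n+1)Ax, and replacing
  this by hAx costs what \<open>Jn_minus_id\<close> gives for \<open>A x\<close>.\<close>

lemma Jn_minus_derivative:
  assumes "x \<in> D" "A x \<in> D"
  shows "norm ((J k ^^ n) x - x - (real n / 2 ^ k) *\<^sub>R A x) \<le> (real n / 2 ^ k)\<^sup>2 * M * norm (A (A x))"
proof (induction n)
  case (Suc n)
  let ?h = "1 / 2 ^ k :: real"
  have "(J k ^^ Suc n) x - (J k ^^ n) x = ?h *\<^sub>R (J k ^^ Suc n) (A x)"
    using assms(1) by (simp add: funpow_swap1 Jn_diff[symmetric] J_minus_id Jn_scale)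
  then have "(J k ^^ Suc n) x = (J k ^^ n) x + ?h *\<^sub>R (J k ^^ Suc n) (A x)"
    by (simp only: diff_eq_eq add.commute)
  moreover have "real (Suc n) / 2 ^ k = real n / 2 ^ k + ?h"
    by (simp add: add_divide_distrib)
  ultimately have eq: "(J k ^^ Suc n) x - x - (real (Suc n) / 2 ^ k) *\<^sub>R A x =
      ((J k ^^ n) x - x - (real n / 2 ^ k) *\<^sub>R A x) + ?h *\<^sub>R ((J k ^^ Suc n) (A x) - A x)"
    by (simp only: scaleR_add_left scaleR_diff_right) (simp only: diff_diff_eq2 diff_conv_add_uminus minus_add_distrib ac_simps)
  have "norm ((J k ^^ Suc n) x - x - (real (Suc n) / 2 ^ k) *\<^sub>R A x) \<le>
      norm ((J k ^^ n) x - x - (real n / 2 ^ k) *\<^sub>R A x) + ?h * norm ((J k ^^ Suc n) (A x) - A x)"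
    unfolding eq by (rule order_trans[OF norm_triangle_ineq]) (simp del: funpow.simps)
  also have "\<dots> \<le> (real n / 2 ^ k)\<^sup>2 * M * norm (A (A x)) +
      ?h * (real (Suc n) / 2 ^ k * M * norm (A (A x)))"
    by (rule add_mono[OF Suc mult_left_mono[OF Jn_minus_id[OF assms(2)]]]) simp
  also have "\<dots> = ((real n)\<^sup>2 + real (Suc n)) * (M * norm (A (A x)) / (2 ^ k)\<^sup>2)"
    by (simp add: field_simps power2_eq_square)
  \<comment> \<open>The induction closes because n^2 + (n + 1) is at most (n + 1)^2.\<close>
  also have "\<dots> \<le> (real (Suc n))\<^sup>2 * (M * norm (A (A x)) / (2 ^ k)\<^sup>2)"
    using M_nonneg by (intro mult_right_mono) (auto simp: power2_eq_square algebra_simps)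
  finally show ?case
    by (simp add: field_simps power2_eq_square)
qed simp

text \<open>The local error of the scheme. With h = 2^(-k-1), P = (I - hA)^-1 and Q = (I - 2hA)^-1
  it is P^2 - Q = P^2((I - 2hA) - (I - hA)^2)Q = -h^2 P^2 A^2 Q.\<close>

lemma J_halved:
  assumes "x \<in> D" "A x \<in> D"
  shows "J (Suc k) (J (Suc k) x) - J k x =
    - (1 / 4 ^ Suc k) *\<^sub>R J (Suc k) (J (Suc k) (J k (A (A x))))"
proof -
  let ?P = "J (Suc k)" and ?Q = "J k" and ?h = "1 / 2 ^ Suc k :: real"
  note P = linear_add[OF J_linear] linear_diff[OF J_linear] linear_scale[OF J_linear]
  define g a h where "g = ?Q x" and "a = ?Q (A x)" and "h = ?h"
  have g: "g \<in> D" "A g = a" and a: "a \<in> D" "A a = ?Q (A (A x))"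
    using assms by (simp_all add: g_def a_def J_in A_J)
  have "x = g - (h + h) *\<^sub>R a"
    using J_minus_id[OF assms(1), of k] by (simp add: g_def a_def h_def algebra_simps)
  then have "?P (?P x) = ?P (?P g) - (h + h) *\<^sub>R ?P (?P a)"
    by (simp only: P)
  moreover have Pg: "?P g = g + h *\<^sub>R ?P a" and Pa: "?P a = a + h *\<^sub>R ?P (A a)"
    using J_minus_id[OF g(1), of "Suc k"] J_minus_id[OF a(1), of "Suc k"]
    unfolding g(2) h_def[symmetric] by (metis add.commute diff_add_cancel)+
  moreover have "?P (?P g) = ?P g + h *\<^sub>R ?P (?P a)"
    by (subst Pg) (simp only: P)
  moreover have "?P (?P a) = ?P a + h *\<^sub>R ?P (?P (A a))"
    by (subst Pa) (simp only: P)
  ultimately have "?P (?P x) = g - (h * h) *\<^sub>R ?P (?P (A a))"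
    by (simp only: Pg scaleR_add_left scaleR_add_right scaleR_scaleR) simp
  moreover have "(4::real) ^ Suc k = 2 ^ Suc k * 2 ^ Suc k"
    by (subst power_mult_distrib[symmetric]) simp
  then have "h * h = 1 / 4 ^ Suc k"
    unfolding h_def by simp
  ultimately show ?thesis
    by (simp add: a(2) g_def)
qed

text \<open>Local errors are transported by P^(2n+2) - Q^(n+1) = P^2(P^(2n) - Q^n) + (P^2 - Q)Q^n.
  The prefix of m further steps keeps each transport a single power of P, so power boundedness gives
  the factor M^2 and not a power of \<open>M\<close> growing with n.\<close>

lemma Jn_halved:
  assumes x: "x \<in> D" "A x \<in> D"
  shows "norm ((J (Suc k) ^^ m) ((J (Suc k) ^^ (2 * n)) x - (J k ^^ n) x))
    \<le> real n / 4 ^ Suc k * M\<^sup>2 * norm (A (A x))"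
proof (induction n arbitrary: m)
  case (Suc n)
  let ?P = "J (Suc k)" and ?Q = "J k" and ?y = "(J k ^^ n) x"
  have y: "?y \<in> D" "A ?y \<in> D" "A (A ?y) = (?Q ^^ n) (A (A x))"
    using x by (simp_all add: Jn_in A_Jn)
  have "(?P ^^ m) ((?P ^^ (2 * Suc n)) x - (?Q ^^ Suc n) x) =
      (?P ^^ (m + 2)) ((?P ^^ (2 * n)) x - ?y) + (?P ^^ m) (?P (?P ?y) - ?Q ?y)"
    by (simp add: Jn_diff funpow_add funpow_swap1 linear_diff[OF J_linear] numeral_2_eq_2)
  also have "(?P ^^ m) (?P (?P ?y) - ?Q ?y) =
      - (1 / 4 ^ Suc k) *\<^sub>R (?P ^^ (m + 2)) ((?Q ^^ Suc n) (A (A x)))"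
    unfolding J_halved[OF y(1,2)] y(3) Jn_scale
    by (simp add: funpow_add numeral_2_eq_2 Jn_scale funpow_swap1 linear_neg[OF Jn_linear])
  finally have "norm ((?P ^^ m) ((?P ^^ (2 * Suc n)) x - (?Q ^^ Suc n) x)) \<le>
      norm ((?P ^^ (m + 2)) ((?P ^^ (2 * n)) x - ?y)) +
      1 / 4 ^ Suc k * norm ((?P ^^ (m + 2)) ((?Q ^^ Suc n) (A (A x))))"
    by (metis (no_types, lifting) norm_triangle_ineq norm_scaleR abs_minus_cancel abs_of_nonneg
        zero_le_divide_1_iff zero_le_numeral zero_le_power)
  also have "\<dots> \<le> real n / 4 ^ Suc k * M\<^sup>2 * norm (A (A x)) +
      1 / 4 ^ Suc k * (M * (M * norm (A (A x))))"
    by (rule add_mono[OF Suc mult_left_mono[OF order_trans[OF Jn_bound mult_left_mono[OF Jn_bound M_nonneg]]]]) simp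
  finally show ?case
    by (simp add: field_simps power2_eq_square)
qed (simp add: linear_0[OF Jn_linear])

lemma J_tendsto: "(\<lambda>k. J k x) \<longlonglongrightarrow> x"
proof -
  have "(\<lambda>k. J k y) \<longlonglongrightarrow> y" if "y \<in> D" for y
  proof -
    have "norm (J k y - y) \<le> M * norm (A y) * (1 / 2) ^ k" for k
      using Jn_minus_id[OF that, where k = k and n = 1] by (simp add: power_divide)
    then have "\<forall>\<^sub>F k in sequentially. norm (J k y - y) \<le> M * norm (A y) * (1 / 2) ^ k"
      by (intro always_eventually) blast
    moreover have "(\<lambda>k. M * norm (A y) * (1 / 2) ^ k) \<longlonglongrightarrow> 0"
      by (rule tendsto_mult_right_zero[OF LIMSEQ_power_zero]) simp
    ultimately have "(\<lambda>k. J k y - y) \<longlonglongrightarrow> 0"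
      by (rule Lim_null_comparison)
    then show ?thesis
      by (simp add: LIM_zero_iff)
  qed
  moreover have "\<forall>\<^sub>F k in sequentially. \<forall>x y. norm (J k x - J k y) \<le> M * norm (x - y)"
    using Jn_lipschitz[where n = 1] by simp
  ultimately show ?thesis
    using D_dense tendsto_on_closure[where S = D and M = M and N = 1 and F = J and L = "\<lambda>x. x"] by simp
qed

text \<open>\<open>J k\<close> maps \<open>D\<close> into the domain of the square of
  \<open>A\<close>, since \<open>A\<close> commutes with it there, and it tends strongly to the
  identity.\<close>

lemma D2_dense: "closure {x \<in> D. A x \<in> D} = UNIV"
proof -
  have "x \<in> closure {x \<in> D. A x \<in> D}" if "x \<in> D" for x
    unfolding closure_sequential using J_tendsto[of x] that
    by (intro exI[of _ "\<lambda>k. J k x"]) (auto simp: J_in A_J)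
  then have "closure D \<subseteq> closure {x \<in> D. A x \<in> D}"
    by (intro closure_minimal) auto
  then show ?thesis
    using D_dense by auto
qed

end

section \<open>The semigroup\<close>

lemma real_nat_floor_dyadic_le: "real (nat \<lfloor>t * 2 ^ k\<rfloor>) / 2 ^ k \<le> \<bar>t\<bar>" for t :: real
proof (cases "0 \<le> t")
  case True
  then have "real (nat \<lfloor>t * 2 ^ k\<rfloor>) \<le> t * 2 ^ k"
    by (simp add: of_nat_nat)
  with True show ?thesis
    by (simp add: divide_le_eq)
next
  case False
  then have "t * 2 ^ k \<le> 0"
    by (simp add: mult_le_0_iff)
  then have "nat \<lfloor>t * 2 ^ k\<rfloor> = 0"
    by linarith
  then show ?thesis
    by simp
qed

text \<open>Halving the Euler step doubles the number of steps up to time t, except for possibly one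
  more. This extra step produces the first term of the bound in \<open>E_step\<close>.\<close>

lemma nat_floor_dyadic_Suc:
  "nat \<lfloor>t * 2 ^ Suc k\<rfloor> \<in> {2 * nat \<lfloor>t * 2 ^ k\<rfloor>, Suc (2 * nat \<lfloor>t * 2 ^ k\<rfloor>)}" for t :: real
proof -
  have "nat \<lfloor>2 * y\<rfloor> \<in> {2 * nat \<lfloor>y\<rfloor>, Suc (2 * nat \<lfloor>y\<rfloor>)}" for y :: real
  proof -
    have "\<lfloor>2 * y\<rfloor> = 2 * \<lfloor>y\<rfloor> \<or> \<lfloor>2 * y\<rfloor> = 2 * \<lfloor>y\<rfloor> + 1"
      by linarith
    then show ?thesis
      by (cases "0 \<le> \<lfloor>y\<rfloor>") (auto simp: nat_mult_distrib nat_add_distrib)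
  qed
  from this[of "t * 2 ^ k"] show ?thesis
    by (simp only: power_Suc mult.left_commute)
qed

lemma nat_floor_dyadic_tendsto:
  assumes "0 \<le> t"
  shows "(\<lambda>k. real (nat \<lfloor>t * 2 ^ k\<rfloor>) / 2 ^ k) \<longlonglongrightarrow> t"
proof -
  have "norm (real (nat \<lfloor>t * 2 ^ k\<rfloor>) / 2 ^ k - t) \<le> (1 / 2) ^ k" for k
  proof -
    have "\<bar>real (nat \<lfloor>t * 2 ^ k\<rfloor>) - t * 2 ^ k\<bar> \<le> 1"
      using assms by (simp add: of_nat_nat) linarith
    then have "\<bar>real (nat \<lfloor>t * 2 ^ k\<rfloor>) - t * 2 ^ k\<bar> / 2 ^ k \<le> 1 / 2 ^ k"
      by (rule divide_right_mono) simp
    moreover have "real (nat \<lfloor>t * 2 ^ k\<rfloor>) / 2 ^ k - t = (real (nat \<lfloor>t * 2 ^ k\<rfloor>) - t * 2 ^ k) / 2 ^ k"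
      by (simp add: diff_divide_distrib)
    ultimately show ?thesis
      by (simp add: abs_divide power_divide)
  qed
  then have "\<forall>\<^sub>F k in sequentially. norm (real (nat \<lfloor>t * 2 ^ k\<rfloor>) / 2 ^ k - t) \<le> (1 / 2) ^ k"
    by (rule always_eventually[OF allI])
  moreover have "(\<lambda>k. (1 / 2) ^ k :: real) \<longlonglongrightarrow> 0"
    by (rule LIMSEQ_power_zero) simp
  ultimately have "(\<lambda>k. real (nat \<lfloor>t * 2 ^ k\<rfloor>) / 2 ^ k - t) \<longlonglongrightarrow> 0"
    by (rule Lim_null_comparison)
  then show ?thesis
    by (simp only: LIM_zero_iff)
qed

context power_bounded_resolvent
begin

text \<open>The scheme run up to the last grid point not after t. For negative t the exponent is 0
  and \<open>E k t\<close> is the identity, so the norm bounds hold for all real t with the modulus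
  of t; the semigroup law and the expansion at 0 are claimed for t \<ge> 0 only.\<close>

definition E :: "nat \<Rightarrow> real \<Rightarrow> 'x \<Rightarrow> 'x" where
  "E k t = J k ^^ nat \<lfloor>t * 2 ^ k\<rfloor>"

lemma E_lipschitz: "norm (E k t x - E k t y) \<le> M * norm (x - y)"
  unfolding E_def by (rule Jn_lipschitz)

text \<open>Two errors of order 2^(-k): at most one step too many, and at most |t| 2^k local errors
  of order 4^(-k-1). The bound is summable in k, which makes the scheme converge.\<close>

lemma E_step:
  assumes x: "x \<in> D" "A x \<in> D"
  shows "norm (E (Suc k) t x - E k t x) \<le> (M * norm (A x) + \<bar>t\<bar> * M\<^sup>2 * norm (A (A x))) * (1 / 2) ^ k"
proof -
  let ?n = "nat \<lfloor>t * 2 ^ k\<rfloor>" and ?n' = "nat \<lfloor>t * 2 ^ Suc k\<rfloor>" and ?P = "J (Suc k)"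
  have "norm ((?P ^^ ?n') x - (?P ^^ (2 * ?n)) x) \<le> M / 2 ^ Suc k * norm (A x)"
    using nat_floor_dyadic_Suc[of t k] Jn_step[OF x(1), of "2 * ?n" "Suc k"] M_nonneg
    by (auto simp del: funpow.simps)
  also have "\<dots> = M * norm (A x) * (1 / 2) ^ k / 2"
    by (simp add: power_divide)
  also have "\<dots> \<le> M * norm (A x) * (1 / 2) ^ k"
    using M_nonneg by simp
  finally have 1: "norm ((?P ^^ ?n') x - (?P ^^ (2 * ?n)) x) \<le> M * norm (A x) * (1 / 2) ^ k" .
  have "norm ((?P ^^ (2 * ?n)) x - (J k ^^ ?n) x) \<le> real ?n / 4 ^ Suc k * M\<^sup>2 * norm (A (A x))"
    using Jn_halved[OF x, where m = 0] by simp
  also have "\<dots> \<le> \<bar>t\<bar> * (1 / 2) ^ k * M\<^sup>2 * norm (A (A x))"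
  proof (intro mult_right_mono)
    have "(4::real) ^ k = 2 ^ k * 2 ^ k"
      by (subst power_mult_distrib[symmetric]) simp
    then have "real ?n / 4 ^ Suc k = (real ?n / 2 ^ k) * ((1 / 2) ^ k / 4)"
      by (simp add: power_divide)
    also have "\<dots> \<le> \<bar>t\<bar> * (1 / 2) ^ k"
      by (rule mult_mono[OF real_nat_floor_dyadic_le]) auto
    finally show "real ?n / 4 ^ Suc k \<le> \<bar>t\<bar> * (1 / 2) ^ k" .
  qed auto
  finally have 2: "norm ((?P ^^ (2 * ?n)) x - (J k ^^ ?n) x) \<le> \<bar>t\<bar> * (1 / 2) ^ k * M\<^sup>2 * norm (A (A x))" .
  have "norm (E (Suc k) t x - E k t x) \<le>
      norm ((?P ^^ ?n') x - (?P ^^ (2 * ?n)) x) + norm ((?P ^^ (2 * ?n)) x - (J k ^^ ?n) x)"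
    unfolding E_def using dist_triangle[of "(?P ^^ ?n') x" "(J k ^^ ?n) x" "(?P ^^ (2 * ?n)) x"]
    by (simp only: dist_norm)
  with 1 2 show ?thesis
    by (simp add: algebra_simps)
qed

lemma E_convergent: "convergent (\<lambda>k. E k t x)"
proof (rule convergent_on_closure[where S = "{x \<in> D. A x \<in> D}" and M = M])
  fix y
  assume "y \<in> {x \<in> D. A x \<in> D}"
  then have y: "y \<in> D" "A y \<in> D"
    by auto
  have "summable (\<lambda>k. E (Suc k) t y - E k t y)"
  proof (rule summable_comparison_test'[OF summable_mult[OF summable_geometric]])
    show "norm (E (Suc k) t y - E k t y) \<le> (M * norm (A y) + \<bar>t\<bar> * M\<^sup>2 * norm (A (A y))) * (1 / 2) ^ k"
      if "0 \<le> k" for k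
      by (rule E_step[OF y])
  qed auto
  then have "convergent (\<lambda>n. \<Sum>k<n. E (Suc k) t y - E k t y)"
    by (simp only: summable_iff_convergent)
  then have "convergent (\<lambda>n. E n t y - E 0 t y)"
    by (simp only: sum_lessThan_telescope[of "\<lambda>n. E n t y"])
  then have "convergent (\<lambda>n. (E n t y - E 0 t y) + E 0 t y)"
    by (rule convergent_add[OF _ convergent_const])
  then show "convergent (\<lambda>k. E k t y)"
    by simp
qed (simp_all add: E_lipschitz D2_dense)

definition T :: "real \<Rightarrow> 'x \<Rightarrow> 'x" where
  "T t x = lim (\<lambda>k. E k t x)"

lemma T_lim: "(\<lambda>k. E k t x) \<longlonglongrightarrow> T t x"
  using E_convergent unfolding T_def by (simp only: convergent_LIMSEQ_iff)

lemma T_bounded_linear: "bounded_linear (T t)"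
  and T_bound: "norm (T t x) \<le> M * norm x"
proof -
  show bound: "norm (T t x) \<le> M * norm x" for x
    by (rule LIMSEQ_le_const2[OF tendsto_norm[OF T_lim]]) (use Jn_bound in \<open>auto simp: E_def\<close>)
  show "bounded_linear (T t)"
  proof (rule bounded_linear_intro[where K = M])
    fix x y and a :: real
    show "T t (x + y) = T t x + T t y"
      using tendsto_add[OF T_lim[of t x] T_lim[of t y]]
      by (intro LIMSEQ_unique[OF T_lim]) (simp add: E_def Jn_add)
    show "T t (a *\<^sub>R x) = a *\<^sub>R T t x"
      using tendsto_scaleR[OF tendsto_const T_lim[of t x], of a]
      by (intro LIMSEQ_unique[OF T_lim]) (simp add: E_def Jn_scale)
    show "norm (T t x) \<le> norm x * M"
      using bound[of x] by (simp add: mult.commute)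
  qed
qed

lemmas T_diff = linear_diff[OF bounded_linear.linear[OF T_bounded_linear]]

lemma T_lipschitz: "norm (T t x - T t y) \<le> M * norm (x - y)"
  unfolding T_diff[symmetric] by (rule T_bound)

lemma T_0: "T 0 x = x"
  using T_lim[of 0 x] by (simp add: E_def LIMSEQ_const_iff)

text \<open>Carries positivity from the resolvents to the semigroup, with the positive cone as
  \<open>C\<close>.\<close>

lemma T_invariant:
  assumes "closed C" "\<And>k x. x \<in> C \<Longrightarrow> J k x \<in> C" "x \<in> C"
  shows "T t x \<in> C"
proof -
  have "(J k ^^ n) x \<in> C" for k n
    using assms by (induction n) auto
  then show ?thesis
    by (intro closed_sequentially[OF assms(1) _ T_lim[of t x]]) (simp add: E_def)
qed

lemma R_T:
  assumes "0 \<le> l"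
  shows "R l (T t x) = T t (R l x)"
proof (rule LIMSEQ_unique)
  show "(\<lambda>k. R l (E k t x)) \<longlonglongrightarrow> R l (T t x)"
    by (rule bounded_linear.tendsto[OF R_bounded[OF assms] T_lim])
  show "(\<lambda>k. R l (E k t x)) \<longlonglongrightarrow> T t (R l x)"
    using T_lim[of t "R l x"] by (simp add: E_def R_Jn assms)
qed

lemma T_minus_id:
  assumes "x \<in> D"
  shows "norm (T t x - x) \<le> \<bar>t\<bar> * M * norm (A x)"
proof (rule LIMSEQ_le_const2[OF tendsto_norm[OF tendsto_diff[OF T_lim tendsto_const]]])
  have "norm (E k t x - x) \<le> \<bar>t\<bar> * M * norm (A x)" for k
    unfolding E_def using M_nonneg
    by (intro order_trans[OF Jn_minus_id[OF assms]] mult_right_mono real_nat_floor_dyadic_le) auto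
  then show "\<exists>N. \<forall>n\<ge>N. norm (E n t x - x) \<le> \<bar>t\<bar> * M * norm (A x)"
    by blast
qed

lemma T_tendsto_id: "((\<lambda>t. T t x) \<longlongrightarrow> x) (at_right 0)"
proof (rule tendsto_on_closure[where S = D and M = M and N = 1])
  fix y
  assume y: "y \<in> D"
  have "((\<lambda>t. T t y - y) \<longlongrightarrow> 0) (at_right 0)"
  proof (rule Lim_null_comparison)
    show "\<forall>\<^sub>F t in at_right 0. norm (T t y - y) \<le> \<bar>t\<bar> * M * norm (A y)"
      by (rule always_eventually) (simp add: T_minus_id[OF y])
    have "((\<lambda>t. \<bar>t\<bar> * M * norm (A y)) \<longlongrightarrow> \<bar>0\<bar> * M * norm (A y)) (at_right 0)"
      by (rule tendsto_intros)+
    then show "((\<lambda>t. \<bar>t\<bar> * M * norm (A y)) \<longlongrightarrow> 0) (at_right 0)"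
      by simp
  qed
  then show "((\<lambda>t. T t y) \<longlongrightarrow> y) (at_right 0)"
    by (simp only: LIM_zero_iff)
qed (auto simp: T_lipschitz D_dense)

text \<open>Rounding s, t and s + t to the grid leaves a discrepancy of at most one Euler step,
  which tends to 0 on \<open>D\<close>. Both sides are continuous in x, so the identity extends to
  the closure of \<open>D\<close>.\<close>

lemma T_add:
  assumes s: "0 \<le> s" and t: "0 \<le> t"
  shows "T (s + t) x = T s (T t x)"
proof -
  have "T (s + t) x = T s (T t x)" if x: "x \<in> D" for x
  proof -
    have "(\<lambda>k. E k s (E k t x) - E k s (T t x)) \<longlonglongrightarrow> 0"
    proof (rule Lim_null_comparison)
      show "\<forall>\<^sub>F k in sequentially. norm (E k s (E k t x) - E k s (T t x)) \<le> M * norm (E k t x - T t x)"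
        by (rule always_eventually) (simp add: E_lipschitz)
      have "(\<lambda>k. E k t x - T t x) \<longlonglongrightarrow> 0"
        using T_lim[of t x] by (simp only: LIM_zero_iff)
      then show "(\<lambda>k. M * norm (E k t x - T t x)) \<longlonglongrightarrow> 0"
        by (rule tendsto_mult_right_zero[OF tendsto_norm_zero])
    qed
    from tendsto_add[OF this T_lim[of s "T t x"]]
    have 1: "(\<lambda>k. E k s (E k t x)) \<longlonglongrightarrow> T s (T t x)"
      by simp
    have "(\<lambda>k. E k (s + t) x - E k s (E k t x)) \<longlonglongrightarrow> 0"
    proof (rule Lim_null_comparison)
      show "\<forall>\<^sub>F k in sequentially. norm (E k (s + t) x - E k s (E k t x)) \<le> M * norm (A x) * (1 / 2) ^ k"
      proof (rule always_eventually[OF allI])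
        fix k
        define a b c where "a = nat \<lfloor>s * 2 ^ k\<rfloor>" and "b = nat \<lfloor>t * 2 ^ k\<rfloor>"
          and "c = nat \<lfloor>(s + t) * 2 ^ k\<rfloor>"
        have "0 \<le> s * 2 ^ k" "0 \<le> t * 2 ^ k" "(s + t) * 2 ^ k = s * 2 ^ k + t * 2 ^ k"
          using s t by (auto simp: algebra_simps)
        then have "c = a + b \<or> c = Suc (a + b)"
          unfolding a_def b_def c_def by linarith
        moreover have "M / 2 ^ k * norm (A x) = M * norm (A x) * (1 / 2) ^ k"
          by (simp add: power_divide)
        moreover have "0 \<le> M * norm (A x) * (1 / 2) ^ k"
          using M_nonneg by simp
        ultimately have "norm ((J k ^^ c) x - (J k ^^ (a + b)) x) \<le> M * norm (A x) * (1 / 2) ^ k"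
          using Jn_step[OF x, of "a + b" k] by (auto simp del: funpow.simps)
        then show "norm (E k (s + t) x - E k s (E k t x)) \<le> M * norm (A x) * (1 / 2) ^ k"
          by (simp add: E_def a_def b_def c_def funpow_add)
      qed
      show "(\<lambda>k. M * norm (A x) * (1 / 2) ^ k) \<longlonglongrightarrow> 0"
        by (rule tendsto_mult_right_zero[OF LIMSEQ_power_zero]) simp
    qed
    from tendsto_add[OF this 1] have "(\<lambda>k. E k (s + t) x) \<longlonglongrightarrow> T s (T t x)"
      by simp
    then show ?thesis
      by (rule LIMSEQ_unique[OF T_lim])
  qed
  moreover have "closed {x. T (s + t) x = T s (T t x)}"
    by (intro closed_Collect_eq bounded_linear.continuous_on[OF T_bounded_linear] continuous_on_id)
  ultimately have "closure D \<subseteq> {x. T (s + t) x = T s (T t x)}"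
    by (intro closure_minimal) auto
  then show ?thesis
    using D_dense by auto
qed

lemma T_minus_derivative:
  assumes x: "x \<in> D" "A x \<in> D" and t: "0 \<le> t"
  shows "norm (T t x - x - t *\<^sub>R A x) \<le> t\<^sup>2 * M * norm (A (A x))"
proof (rule LIMSEQ_le)
  let ?n = "\<lambda>k. real (nat \<lfloor>t * 2 ^ k\<rfloor>) / 2 ^ k"
  show "(\<lambda>k. norm (E k t x - x - ?n k *\<^sub>R A x)) \<longlonglongrightarrow> norm (T t x - x - t *\<^sub>R A x)"
    by (intro tendsto_intros T_lim nat_floor_dyadic_tendsto t)
  show "(\<lambda>k. (?n k)\<^sup>2 * M * norm (A (A x))) \<longlonglongrightarrow> t\<^sup>2 * M * norm (A (A x))"
    by (intro tendsto_intros nat_floor_dyadic_tendsto t)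
  show "\<exists>N. \<forall>k\<ge>N. norm (E k t x - x - ?n k *\<^sub>R A x) \<le> (?n k)\<^sup>2 * M * norm (A (A x))"
    unfolding E_def using Jn_minus_derivative[OF x] by blast
qed

text \<open>The difference quotients at \<open>0\<close> of \<open>T(\<cdot>)R(0)\<close> are bounded uniformly in the time variable,
  so it suffices to compute their limit on a dense set.\<close>

lemma T_derivative:
  assumes "x \<in> D"
  shows "((\<lambda>h. (T h x - x) /\<^sub>R h) \<longlongrightarrow> A x) (at_right 0)"
proof -
  \<comment> \<open>Taking y = - A x gives the claim, since \<open>R 0 (- A x) = x\<close> for x in
    \<open>D\<close>. Written in terms of y, the limit is claimed on the whole space.\<close>
  have "((\<lambda>h. (T h (R 0 y) - R 0 y) /\<^sub>R h) \<longlongrightarrow> - y) (at_right 0)" for y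
  proof (rule tendsto_on_closure[where S = D and M = M and N = 1 and L = uminus
        and F = "\<lambda>h y. (T h (R 0 y) - R 0 y) /\<^sub>R h"])
    have "norm ((T h (R 0 x) - R 0 x) /\<^sub>R h - (T h (R 0 y) - R 0 y) /\<^sub>R h) \<le> M * norm (x - y)"
      if "0 < h" for h x y
    proof -
      have "(T h (R 0 x) - R 0 x) /\<^sub>R h - (T h (R 0 y) - R 0 y) /\<^sub>R h =
          (T h (R 0 (x - y)) - R 0 (x - y)) /\<^sub>R h"
        by (simp add: R_diff T_diff algebra_simps)
      moreover have "norm (T h (R 0 (x - y)) - R 0 (x - y)) \<le> \<bar>h\<bar> * M * norm (- (x - y))"
        using T_minus_id[OF R_in, of 0 h "x - y"] A_R[of 0 "x - y"] by simp
      ultimately show ?thesis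
        using that by (simp add: divide_simps mult.commute mult.left_commute norm_minus_commute)
    qed
    then show "\<forall>\<^sub>F h in at_right 0. \<forall>x y.
        norm ((T h (R 0 x) - R 0 x) /\<^sub>R h - (T h (R 0 y) - R 0 y) /\<^sub>R h) \<le> M * norm (x - y)"
      by (intro eventually_at_rightI[of 0 1]) auto
  next
    fix y
    assume y: "y \<in> D"
    let ?z = "R 0 y"
    have z: "?z \<in> D" "A ?z = - y"
      using R_in[of 0 y] A_R[of 0 y] by auto
    have "- y \<in> D"
      using D_subspace y by (rule subspace_neg)
    with z have Az: "A ?z \<in> D"
      by simp
    have "((\<lambda>h. (T h ?z - ?z) /\<^sub>R h - - y) \<longlongrightarrow> 0) (at_right 0)"
    proof (rule Lim_null_comparison)
      have "norm ((T h ?z - ?z) /\<^sub>R h - - y) \<le> h * (M * norm (A (A ?z)))" if "0 < h" for h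
      proof -
        have "(T h ?z - ?z) /\<^sub>R h - - y = (T h ?z - ?z - h *\<^sub>R A ?z) /\<^sub>R h"
          using that by (simp add: z(2) scaleR_diff_right scaleR_add_right)
        then show ?thesis
          using T_minus_derivative[OF z(1) Az, of h] that
          by (simp add: divide_simps power2_eq_square mult.commute mult.left_commute)
      qed
      then show "\<forall>\<^sub>F h in at_right 0. norm ((T h ?z - ?z) /\<^sub>R h - - y) \<le> h * (M * norm (A (A ?z)))"
        by (intro eventually_at_rightI[of 0 1]) auto
      show "((\<lambda>h. h * (M * norm (A (A ?z)))) \<longlongrightarrow> 0) (at_right 0)"
        by (rule tendsto_mult_left_zero[OF tendsto_ident_at])
    qed
    then show "((\<lambda>h. (T h ?z - ?z) /\<^sub>R h) \<longlongrightarrow> - y) (at_right 0)"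
      by (simp only: LIM_zero_iff)
  qed (auto simp: D_dense norm_minus_commute)
  from this[of "- A x"] show ?thesis
    using R_A[of 0 x] assms linear_neg[OF bounded_linear.linear[OF R_bounded[of 0]], of "A x"] by simp
qed

text \<open>For the implication from the limit to the domain, apply \<open>R 0\<close>: it commutes
  with the semigroup and maps into \<open>D\<close>, so \<open>R 0 y = A (R 0 x) = - x\<close>.
  Hence x is in the range of \<open>R 0\<close>.\<close>

lemma T_generator:
  "((\<lambda>h. (T h x - x) /\<^sub>R h) \<longlongrightarrow> y) (at_right 0) \<longleftrightarrow> x \<in> D \<and> A x = y"
proof
  assume lim: "((\<lambda>h. (T h x - x) /\<^sub>R h) \<longlongrightarrow> y) (at_right 0)"
  have "((\<lambda>h. R 0 ((T h x - x) /\<^sub>R h)) \<longlongrightarrow> R 0 y) (at_right 0)"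
    by (rule bounded_linear.tendsto[OF R_bounded lim]) simp
  then have "((\<lambda>h. (T h (R 0 x) - R 0 x) /\<^sub>R h) \<longlongrightarrow> R 0 y) (at_right 0)"
    by (simp add: R_scale R_diff R_T)
  then have "R 0 y = A (R 0 x)"
    using T_derivative[OF R_in, of 0 x] by (auto intro: tendsto_unique[OF trivial_limit_at_right_real])
  then have x: "x = R 0 (- y)"
    using A_R[of 0 x] linear_neg[OF bounded_linear.linear[OF R_bounded[of 0]], of y]
    by (simp add: neg_eq_iff_add_eq_0 add_eq_0_iff)
  then show "x \<in> D \<and> A x = y"
    using R_in[of 0 "- y"] A_R[of 0 "- y"] by simp
qed (use T_derivative in blast)

end

section \<open>Resolvents and rescaling\<close>

lemma linear_operator_shift:
  "linear_operator D A \<Longrightarrow> linear_operator D (\<lambda>x. A x + a *\<^sub>R x)"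
  by (auto simp: linear_operator_def scaleR_add_right scaleR_left_commute[of a])

text \<open>For real \<open>\<mu>\<close> the complex shift acts on both components separately. The
  real resolvent is therefore the first component of the complex one on pairs \<open>(x, 0)\<close>,
  and inherits its boundedness from this formula.\<close>

lemma
  fixes A :: "'x::real_normed_vector \<Rightarrow> 'x"
  assumes \<mu>: "complex_of_real \<mu> \<in> resolvent_set D A"
  shows resolvent_in: "resolvent D A \<mu> x \<in> D"
    and resolvent_right: "\<mu> *\<^sub>R resolvent D A \<mu> x - A (resolvent D A \<mu> x) = x"
    and resolvent_left: "x \<in> D \<Longrightarrow> resolvent D A \<mu> (\<mu> *\<^sub>R x - A x) = x"
    and resolvent_bounded_linear: "bounded_linear (resolvent D A \<mu>)"
proof -
  let ?f = "\<lambda>x. \<mu> *\<^sub>R x - A x" and ?g = "complex_shift A (complex_of_real \<mu>)"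
  have g: "?g (x, y) = (?f x, ?f y)" for x y
    by (simp add: complex_shift_def)
  have bij: "bij_betw ?g (D \<times> D) UNIV" and bl: "bounded_linear (inv_into (D \<times> D) ?g)"
    using \<mu> by (auto simp: resolvent_set_def)
  have inj: "inj_on ?f D"
  proof (rule inj_onI)
    fix x y
    assume *: "x \<in> D" "y \<in> D" "?f x = ?f y"
    then have "?g (x, x) = ?g (y, y)"
      by (simp add: g)
    then have "(x, x) = (y, y)"
      using bij * by (auto simp: bij_betw_def dest: inj_onD)
    then show "x = y"
      by simp
  qed
  have inv: "\<exists>a\<in>D. fst (inv_into (D \<times> D) ?g (x, 0)) = a \<and> ?f a = x" for x
  proof -
    have *: "(x, 0) \<in> ?g ` (D \<times> D)"
      using bij by (simp add: bij_betw_def)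
    obtain a b where ab: "inv_into (D \<times> D) ?g (x, 0) = (a, b)"
      by fastforce
    have "a \<in> D" "?f a = x"
      using inv_into_into[OF *] f_inv_into_f[OF *] unfolding ab g by auto
    with ab show ?thesis
      by simp
  qed
  have res: "resolvent D A \<mu> x = fst (inv_into (D \<times> D) ?g (x, 0))" for x
    using inv[of x] inv_into_f_f[OF inj] unfolding resolvent_def by metis
  show "resolvent D A \<mu> x \<in> D" "\<mu> *\<^sub>R resolvent D A \<mu> x - A (resolvent D A \<mu> x) = x"
    using inv[of x] unfolding res by auto
  show "x \<in> D \<Longrightarrow> resolvent D A \<mu> (\<mu> *\<^sub>R x - A x) = x"
    unfolding resolvent_def by (rule inv_into_f_f[OF inj])
  have "bounded_linear (\<lambda>x. fst (inv_into (D \<times> D) ?g (x, 0)))"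
    proof (rule bounded_linear_compose[OF bounded_linear_fst])
    have "bounded_linear (\<lambda>x::'x. (x, 0::'x))"
      by (rule bounded_linear_Pair[OF bounded_linear_ident bounded_linear_zero])
    from bounded_linear_compose[OF bl this]
    show "bounded_linear (\<lambda>x. inv_into (D \<times> D) ?g (x, 0))" .
  qed
  then show "bounded_linear (resolvent D A \<mu>)"
    unfolding res[abs_def] .
qed

lemma resolvent_identity:
  fixes A :: "'x::real_normed_vector \<Rightarrow> 'x"
  assumes l: "complex_of_real l \<in> resolvent_set D A" and m: "complex_of_real m \<in> resolvent_set D A"
  shows "resolvent D A l x = resolvent D A m x + (m - l) *\<^sub>R resolvent D A l (resolvent D A m x)"
proof -
  note lin = bounded_linear.linear[OF resolvent_bounded_linear[OF l]]
  let ?y = "resolvent D A m x"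
  have "l *\<^sub>R ?y - A ?y = x - (m - l) *\<^sub>R ?y"
    using resolvent_right[OF m, of x] by (simp add: scaleR_diff_left algebra_simps)
  then have "resolvent D A l (x - (m - l) *\<^sub>R ?y) = ?y"
    using resolvent_left[OF l resolvent_in[OF m], of x] by simp
  then show ?thesis
    by (simp only: linear_diff[OF lin] linear_scale[OF lin] diff_eq_eq)
qed

lemma resolvent_set_above_spectral_bound:
  assumes "spectral_bound D A < ereal \<mu>"
  shows "complex_of_real \<mu> \<in> resolvent_set D A"
proof (rule ccontr)
  assume "\<not> ?thesis"
  then have "ereal (Re (complex_of_real \<mu>)) \<le> spectral_bound D A"
    unfolding spectral_bound_def by (intro SUP_upper) (simp add: spectrum_def)
  with assms show False
    by simp
qed

text \<open>\<open>x \<mapsto> \<parallel>Q|x|\<parallel>\<close> is an equivalent norm for which \<open>P\<close> is a contraction.\<close>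

lemma positive_power_bounded:
  fixes P Q :: "'x::banach_lattice \<Rightarrow> 'x"
  assumes P: "linear P" "\<And>x. 0 \<le> x \<Longrightarrow> 0 \<le> P x"
    and Q: "\<And>x. 0 \<le> x \<Longrightarrow> 0 \<le> Q x" "\<And>x. norm (Q x) \<le> K * norm x"
    and QP: "\<And>x. 0 \<le> x \<Longrightarrow> Q (P x) \<le> Q x"
    and c: "0 < c" "\<And>x. 0 \<le> x \<Longrightarrow> c * norm x \<le> norm (Q x)"
  shows "norm ((P ^^ n) x) \<le> K / c * norm x"
proof -
  have pos: "0 \<le> (P ^^ n) x" if "0 \<le> x" for x n
    by (induction n) (auto intro: P(2) that)
  have mono: "P x \<le> P y" if "x \<le> y" for x y
    using P(2)[of "y - x"] that by (simp add: linear_diff[OF P(1)])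
  have dom: "(P ^^ n) y \<le> (P ^^ n) z" if "y \<le> z" for y z n
    by (induction n) (auto intro: mono that)
  have neg: "- (P ^^ n) y = (P ^^ n) (- y)" for y
    by (induction n) (auto simp: linear_neg[OF P(1), symmetric])
  let ?m = "sup x (- x)"
  have "sup ((P ^^ n) x) (- (P ^^ n) x) \<le> (P ^^ n) ?m"
    unfolding neg by (rule sup_least[OF dom[OF sup_ge1] dom[OF sup_ge2]])
  also have "\<dots> = sup ((P ^^ n) ?m) (- (P ^^ n) ?m)"
    by (rule modulus_of_nonneg[symmetric, OF pos[OF modulus_nonneg]])
  finally have 1: "norm ((P ^^ n) x) \<le> norm ((P ^^ n) ?m)"
    by (rule norm_le_if_modulus_le)
  have "Q ((P ^^ n) ?m) \<le> Q ?m"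
  proof (induction n)
    case (Suc n)
    have "Q ((P ^^ Suc n) ?m) \<le> Q ((P ^^ n) ?m)"
      using QP[OF pos[OF modulus_nonneg, of n x]] by simp
    from order_trans[OF this Suc] show ?case .
  qed simp
  from norm_mono_nonneg[OF Q(1)[OF pos[OF modulus_nonneg]] this]
  have "norm (Q ((P ^^ n) ?m)) \<le> norm (Q ?m)" .
  also have "\<dots> \<le> K * norm x"
    using Q(2)[of ?m] by (simp only: norm_modulus)
  finally have "c * norm ((P ^^ n) ?m) \<le> K * norm x"
    by (rule order_trans[OF c(2)[OF pos[OF modulus_nonneg]]])
  with c(1) have "norm ((P ^^ n) ?m) \<le> K / c * norm x"
    by (simp add: field_simps)
  with 1 show ?thesis
    by (rule order_trans)
qed

text \<open>Positivity is known only to the right of some w, the lower bound only at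
  \<open>\<mu>\<close>. The identity R(\<mu>) = R(\<omega>) + (\<omega> - \<mu>)R(\<mu>)R(\<omega>)
  moves the lower bound to \<omega>; its constant is divided by 1 + |\<omega> - \<mu>| N, where N is
  a norm bound for R(\<mu>). Then R(\<omega>) can serve as \<open>Q\<close> in
  \<open>positive_power_bounded\<close>.\<close>

lemma resolvent_positive_shift:
  fixes A :: "'x::banach_lattice \<Rightarrow> 'x"
  assumes A: "linear_operator D A" and D: "closure D = UNIV" and pos: "resolvent_positive D A"
    and \<mu>: "complex_of_real \<mu> \<in> resolvent_set D A"
    and c: "0 < c" "\<And>x. 0 \<le> x \<Longrightarrow> c * norm x \<le> norm (resolvent D A \<mu> x)"
  obtains \<omega> M c' where
    "power_bounded_resolvent D (\<lambda>x. A x + (- \<omega>) *\<^sub>R x) (\<lambda>l. resolvent D A (l + \<omega>)) M"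
    "complex_of_real \<omega> \<in> resolvent_set D A"
    "\<And>l x. 0 \<le> l \<Longrightarrow> 0 \<le> x \<Longrightarrow> 0 \<le> resolvent D A (l + \<omega>) x"
    "0 < c'" "\<And>x. 0 \<le> x \<Longrightarrow> c' * norm x \<le> norm (resolvent D A \<omega> x)"
proof -
  obtain w where w0: "\<forall>\<mu>>w. complex_of_real \<mu> \<in> resolvent_set D A \<and> (\<forall>x\<ge>0. 0 \<le> resolvent D A \<mu> x)"
    using pos unfolding resolvent_positive_def by (elim exE)
  have w: "complex_of_real l \<in> resolvent_set D A" "0 \<le> x \<Longrightarrow> 0 \<le> resolvent D A l x" if "l > w" for l x
    using w0 that by simp_all
  \<comment> \<open>Strictly beyond w, so that positivity holds at l + \<omega> for all l \<ge> 0,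
    including l = 0.\<close>
  define \<omega> where "\<omega> = w + 1"
  have in_res: "complex_of_real (l + \<omega>) \<in> resolvent_set D A" if "0 \<le> l" for l
    using that by (intro w(1)) (simp add: \<omega>_def)
  have \<omega>: "complex_of_real \<omega> \<in> resolvent_set D A"
    using in_res[of 0] by simp
  have Rpos: "0 \<le> resolvent D A (l + \<omega>) x" if "0 \<le> l" "0 \<le> x" for l x
    using that by (intro w(2)) (simp_all add: \<omega>_def)
  obtain N where N: "\<And>x. norm (resolvent D A \<mu> x) \<le> N * norm x" "0 \<le> N"
    using bounded_linear.nonneg_bounded[OF resolvent_bounded_linear[OF \<mu>]] by (metis mult.commute)
  define c' where "c' = c / (1 + \<bar>\<omega> - \<mu>\<bar> * N)"
  have N': "0 < 1 + \<bar>\<omega> - \<mu>\<bar> * N"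
    using N(2) by (intro add_pos_nonneg) auto
  have c': "0 < c'"
    unfolding c'_def using c(1) N' by simp
  have lower: "c' * norm x \<le> norm (resolvent D A \<omega> x)" if "0 \<le> x" for x
  proof -
    let ?y = "resolvent D A \<omega> x"
    have "c * norm x \<le> norm (?y + (\<omega> - \<mu>) *\<^sub>R resolvent D A \<mu> ?y)"
      using c(2)[OF that] resolvent_identity[OF \<mu> \<omega>, of x] by simp
    also have "\<dots> \<le> norm ?y + \<bar>\<omega> - \<mu>\<bar> * (N * norm ?y)"
      using mult_left_mono[OF N(1)[of ?y], of "\<bar>\<omega> - \<mu>\<bar>"] by (intro norm_triangle_le) simp
    finally show ?thesis
      unfolding c'_def using N' by (simp add: field_simps)
  qed
  obtain K where K: "\<And>x. norm (resolvent D A \<omega> x) \<le> K * norm x" "0 \<le> K"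
    using bounded_linear.nonneg_bounded[OF resolvent_bounded_linear[OF \<omega>]] by (metis mult.commute)
  have power: "norm (((\<lambda>y. l *\<^sub>R resolvent D A (l + \<omega>) y) ^^ n) x) \<le> K / c' * norm x"
    if l: "0 < l" for l n x
  proof (rule positive_power_bounded[where Q = "resolvent D A \<omega>"])
    note bl = resolvent_bounded_linear[OF in_res[of l]]
    show "linear (\<lambda>y. l *\<^sub>R resolvent D A (l + \<omega>) y)"
      using l by (intro linear_compose_scale_right bounded_linear.linear bl) simp
    show "0 \<le> l *\<^sub>R resolvent D A (l + \<omega>) y" if "0 \<le> y" for y
      using l that Rpos[of l y] by (simp add: scaleR_nonneg_nonneg)
    show "0 \<le> resolvent D A \<omega> y" if "0 \<le> y" for y
      using Rpos[of 0 y] that by simp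
    show "resolvent D A \<omega> (l *\<^sub>R resolvent D A (l + \<omega>) y) \<le> resolvent D A \<omega> y" if "0 \<le> y" for y
    proof -
      have "resolvent D A \<omega> y = resolvent D A (l + \<omega>) y + resolvent D A \<omega> (l *\<^sub>R resolvent D A (l + \<omega>) y)"
        using resolvent_identity[OF \<omega> in_res, of l y] l
        by (simp add: linear_scale[OF bounded_linear.linear[OF resolvent_bounded_linear[OF \<omega>]]])
      then show ?thesis
        using Rpos[of l y] l that by simp
    qed
  qed (use K lower c' in auto)
  have "power_bounded_resolvent D (\<lambda>x. A x + (- \<omega>) *\<^sub>R x) (\<lambda>l. resolvent D A (l + \<omega>)) (K / c')"
  proof (rule power_bounded_resolvent.intro)
    show "linear_operator D (\<lambda>x. A x + (- \<omega>) *\<^sub>R x)"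
      by (rule linear_operator_shift[OF A])
    show "bounded_linear (resolvent D A (l + \<omega>))" if "0 \<le> l" for l
      by (rule resolvent_bounded_linear[OF in_res[OF that]])
    show "resolvent D A (l + \<omega>) x \<in> D" if "0 \<le> l" for l x
      by (rule resolvent_in[OF in_res[OF that]])
    show "l *\<^sub>R resolvent D A (l + \<omega>) x
        - (A (resolvent D A (l + \<omega>) x) + - \<omega> *\<^sub>R resolvent D A (l + \<omega>) x) = x" if "0 \<le> l" for l x
      using resolvent_right[OF in_res[OF that], of x] by (simp add: scaleR_add_left algebra_simps)
    show "resolvent D A (l + \<omega>) (l *\<^sub>R x - (A x + - \<omega> *\<^sub>R x)) = x" if "0 \<le> l" "x \<in> D" for l x
      using resolvent_left[OF in_res[OF that(1)] that(2)] by (simp add: scaleR_add_left algebra_simps)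
    show "closure D = UNIV" "0 \<le> K / c'"
      using D K(2) c' by auto
    show "norm (((\<lambda>y. l *\<^sub>R resolvent D A (l + \<omega>) y) ^^ n) x) \<le> K / c' * norm x" if "0 < l" for l n x
      by (rule power[OF that])
  qed
  from that[OF this \<omega> Rpos c' lower] show thesis .
qed

section \<open>Undoing the shift of the generator\<close>

context power_bounded_resolvent
begin

definition rescaled_T :: "real \<Rightarrow> real \<Rightarrow> 'x \<Rightarrow>\<^sub>L 'x" where
  "rescaled_T \<omega> t = Blinfun (\<lambda>x. exp (\<omega> * t) *\<^sub>R T t x)"

lemma rescaled_T_apply: "rescaled_T \<omega> t x = exp (\<omega> * t) *\<^sub>R T t x"
  unfolding rescaled_T_def
  by (simp add: bounded_linear_Blinfun_apply bounded_linear_compose[OF bounded_linear_scaleR_right T_bounded_linear])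

lemma C0_semigroup_rescaled_T: "C0_semigroup (rescaled_T \<omega>)"
  unfolding C0_semigroup_def
proof (intro conjI allI impI)
  show "rescaled_T \<omega> 0 = id_blinfun"
    by (rule blinfun_eqI) (simp add: rescaled_T_apply T_0)
  show "rescaled_T \<omega> (s + t) = rescaled_T \<omega> s o\<^sub>L rescaled_T \<omega> t" if "0 \<le> s" "0 \<le> t" for s t
    by (rule blinfun_eqI)
      (simp add: rescaled_T_apply T_add that distrib_left exp_add
        linear_scale[OF bounded_linear.linear[OF T_bounded_linear]])
  have "((\<lambda>t. exp (\<omega> * t)) \<longlongrightarrow> exp (\<omega> * 0)) (at_right 0)"
    by (intro tendsto_intros)
  then show "((\<lambda>t. rescaled_T \<omega> t x) \<longlongrightarrow> x) (at_right 0)" for x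
    unfolding rescaled_T_apply using tendsto_scaleR[OF _ T_tendsto_id, of "\<lambda>t. exp (\<omega> * t)" 1 x] by simp
qed

text \<open>The product rule for exp(\<omega> h)T(h). As \<open>generates\<close> asks for an
  equivalence, the two difference quotients are expressed through each other, so that a limit of
  either yields a limit of the other.\<close>

lemma rescaled_T_generator: "generates D (\<lambda>x. A x + \<omega> *\<^sub>R x) (rescaled_T \<omega>)"
  unfolding generates_def
proof (intro conjI allI C0_semigroup_rescaled_T)
  fix x y
  let ?q = "\<lambda>h. (T h x - x) /\<^sub>R h" and ?p = "\<lambda>h. (rescaled_T \<omega> h x - x) /\<^sub>R h"
    and ?e = "\<lambda>h. (exp (\<omega> * h) - 1) / h"
  have "((\<lambda>h. exp (\<omega> * h)) has_real_derivative \<omega>) (at 0)"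
    by (auto intro!: derivative_eq_intros)
  then have "(?e \<longlongrightarrow> \<omega>) (at 0)"
    by (simp add: DERIV_def)
  then have e: "(?e \<longlongrightarrow> \<omega>) (at_right 0)"
    by (rule tendsto_within_subset) simp
  have exp: "((\<lambda>h. exp (\<omega> * h)) \<longlongrightarrow> 1) (at_right 0)" "((\<lambda>h. exp (- (\<omega> * h))) \<longlongrightarrow> 1) (at_right 0)"
    by (rule tendsto_eq_intros | simp)+
  have p: "?p = (\<lambda>h. exp (\<omega> * h) *\<^sub>R ?q h + ?e h *\<^sub>R x)"
    by (simp add: fun_eq_iff rescaled_T_apply algebra_simps diff_divide_distrib inverse_eq_divide)
  have q: "?q = (\<lambda>h. exp (- (\<omega> * h)) *\<^sub>R (?p h - ?e h *\<^sub>R x))"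
  proof
    fix h
    show "?q h = exp (- (\<omega> * h)) *\<^sub>R (?p h - ?e h *\<^sub>R x)"
      unfolding fun_cong[OF p, of h] by (simp add: exp_minus_inverse flip: exp_add)
  qed
  have "(?p \<longlongrightarrow> y) (at_right 0) \<longleftrightarrow> (?q \<longlongrightarrow> y - \<omega> *\<^sub>R x) (at_right 0)"
  proof
    assume lim: "(?p \<longlongrightarrow> y) (at_right 0)"
    have "(?q \<longlongrightarrow> 1 *\<^sub>R (y - \<omega> *\<^sub>R x)) (at_right 0)"
      by (subst q) (intro tendsto_scaleR tendsto_diff exp e lim tendsto_const)
    then show "(?q \<longlongrightarrow> y - \<omega> *\<^sub>R x) (at_right 0)"
      by simp
  next
    assume lim: "(?q \<longlongrightarrow> y - \<omega> *\<^sub>R x) (at_right 0)"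
    have "(?p \<longlongrightarrow> 1 *\<^sub>R (y - \<omega> *\<^sub>R x) + \<omega> *\<^sub>R x) (at_right 0)"
      by (subst p) (intro tendsto_scaleR tendsto_add exp e lim tendsto_const)
    then show "(?p \<longlongrightarrow> y) (at_right 0)"
      by simp
  qed
  then show "x \<in> D \<and> A x + \<omega> *\<^sub>R x = y \<longleftrightarrow> (?p \<longlongrightarrow> y) (at_right 0)"
    by (simp add: T_generator eq_diff_eq)
qed

end

section \<open>The extrapolated semigroup and its Riemann sums\<close>

lemma nat_floor_dyadic_grid:
  assumes "n \<le> m"
  shows "nat \<lfloor>real k / 2 ^ m * 2 ^ n\<rfloor> = k div 2 ^ (m - n)"
proof -
  have "(2::real) ^ m = 2 ^ (m - n) * 2 ^ n"
    using assms by (simp add: power_add[symmetric])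
  then have "real k / 2 ^ m * 2 ^ n = real k / real (2 ^ (m - n))"
    by simp
  then show ?thesis
    by (simp only: floor_divide_of_nat_eq nat_int)
qed

section \<open>The positive cone of the extrapolation space\<close>

lemma extrapolation_cone_add:
  assumes j: "linear j" and x: "x \<in> extrapolation_cone j" and y: "y \<in> extrapolation_cone j"
  shows "x + y \<in> extrapolation_cone j"
proof -
  obtain f where f: "\<And>n. f n \<in> j ` {x. 0 \<le> x}" "f \<longlonglongrightarrow> x"
    using x unfolding extrapolation_cone_def closure_sequential by blast
  obtain g where g: "\<And>n. g n \<in> j ` {x. 0 \<le> x}" "g \<longlonglongrightarrow> y"
    using y unfolding extrapolation_cone_def closure_sequential by blast
  have "f n + g n \<in> j ` {x. 0 \<le> x}" for n
  proof -
    obtain a b where "f n = j a" "0 \<le> a" "g n = j b" "0 \<le> b"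
      using f(1)[of n] g(1)[of n] by auto
    then show ?thesis
      by (intro image_eqI[of _ _ "a + b"]) (simp_all add: linear_add[OF j] add_nonneg_nonneg)
  qed
  then show ?thesis
    unfolding extrapolation_cone_def closure_sequential
    by (intro exI[of _ "\<lambda>n. f n + g n"] conjI allI tendsto_add[OF f(2) g(2)])
qed

lemma extrapolation_cone_image:
  assumes h: "continuous_on UNIV h" and hj: "\<And>x. 0 \<le> x \<Longrightarrow> h (j x) \<in> j ` {x. 0 \<le> x}"
    and x: "x \<in> extrapolation_cone j"
  shows "h x \<in> extrapolation_cone j"
proof -
  have "h ` closure (j ` {x. 0 \<le> x}) \<subseteq> closure (j ` {x. 0 \<le> x})"
    by (rule image_closure_subset[OF continuous_on_subset[OF h subset_UNIV] closed_closure])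
      (use hj closure_subset in blast)
  then show ?thesis
    using x unfolding extrapolation_cone_def by blast
qed

lemma extrapolation_cone_scale:
  fixes j :: "'x::banach_lattice \<Rightarrow> 'y::banach"
  assumes j: "linear j" and a: "0 \<le> a" and x: "x \<in> extrapolation_cone j"
  shows "a *\<^sub>R x \<in> extrapolation_cone j"
proof (rule extrapolation_cone_image[OF _ _ x])
  show "continuous_on UNIV (\<lambda>x::'y. a *\<^sub>R x)"
    by (intro continuous_intros)
  show "a *\<^sub>R j y \<in> j ` {x. 0 \<le> x}" if "0 \<le> y" for y
    using that a by (intro image_eqI[of _ _ "a *\<^sub>R y"]) (simp_all add: linear_scale[OF j] scaleR_nonneg_nonneg)
qed

lemma extrapolation_cone_0: "linear j \<Longrightarrow> 0 \<in> extrapolation_cone j"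
  unfolding extrapolation_cone_def by (rule subsetD[OF closure_subset]) (use linear_0 in force)

lemma extrapolation_cone_sum:
  assumes "linear j" "\<And>i. i \<in> I \<Longrightarrow> f i \<in> extrapolation_cone j"
  shows "sum f I \<in> extrapolation_cone j"
  using assms(2)
  by (induction I rule: infinite_finite_induct)
    (simp_all add: extrapolation_cone_0 extrapolation_cone_add assms(1))

text \<open>\<open>K\<close> is the extension of \<open>R 0\<close>, that is, the inverse of minus
  the extrapolated generator, and \<open>L\<close> is the inverse of \<open>K\<close>. They are only
  assumed bounded, not isometric, because the extrapolation norm may be formed at another point of
  the resolvent set.\<close>

locale positive_extrapolation = power_bounded_resolvent D A R M
  for D :: "'x::banach_lattice set" and A R M +
  fixes j :: "'x \<Rightarrow> 'y::banach" and K :: "'y \<Rightarrow>\<^sub>L 'x" and L :: "'x \<Rightarrow>\<^sub>L 'y" and c :: real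
  assumes R_pos: "0 \<le> l \<Longrightarrow> 0 \<le> x \<Longrightarrow> 0 \<le> R l x"
    and c_pos: "0 < c" and lower_bound: "0 \<le> x \<Longrightarrow> c * norm x \<le> norm (R 0 x)"
    and j_linear: "linear j"
    and K_j: "K (j x) = R 0 x" and L_K: "L (K y) = y" and K_L: "K (L x) = x"
begin

lemma j_eq: "j x = L (R 0 x)"
  by (metis K_j L_K)

lemma j_bounded_linear: "bounded_linear j"
  unfolding j_eq[abs_def] by (rule bounded_linear_compose[OF blinfun.bounded_linear_right R_bounded]) simp

lemmas j_tendsto = bounded_linear.tendsto[OF j_bounded_linear]

lemma j_inject: "j x = j y \<Longrightarrow> x = y"
proof -
  assume "j x = j y"
  then have "R 0 x = R 0 y"
    by (metis K_j)
  then have "A (R 0 x) = A (R 0 y)"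
    by (simp only:)
  then have "- x = - y"
    by (simp only: A_R order_refl scaleR_zero_left diff_0)
  then show ?thesis
    by simp
qed

text \<open>Conjugation by the isomorphism \<open>K\<close>: the semigroup law, the bound and strong
  continuity are those of \<open>T\<close>. It extends \<open>T\<close> because \<open>T\<close>
  commutes with \<open>R 0\<close>, see \<open>S_j\<close>.\<close>

definition S :: "real \<Rightarrow> 'y \<Rightarrow> 'y" where
  "S t y = L (T t (K y))"

definition N :: real where
  "N = norm L * M * norm K"

lemma N_nonneg: "0 \<le> N"
  unfolding N_def using M_nonneg by simp

lemma S_linear: "linear (S t)"
  unfolding S_def
  by (rule linearI)
    (simp_all add: blinfun.add_right blinfun.scaleR_right linear_add[OF bounded_linear.linear[OF T_bounded_linear]]
      linear_scale[OF bounded_linear.linear[OF T_bounded_linear]])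

lemmas S_add_right = linear_add[OF S_linear]
  and S_diff_right = linear_diff[OF S_linear]
  and S_scale_right = linear_scale[OF S_linear]

lemma S_bound: "norm (S t y) \<le> N * norm y"
proof -
  have "norm (S t y) \<le> norm L * (M * (norm K * norm y))"
    unfolding S_def
    using norm_blinfun[of L "T t (K y)"] T_bound[of t "K y"] norm_blinfun[of K y]
      mult_left_mono[OF order_trans[OF T_bound[of t "K y"] mult_left_mono[OF norm_blinfun[of K y] M_nonneg]]
        norm_ge_zero[of L]]
    by linarith
  then show ?thesis
    by (simp add: N_def mult.assoc)
qed

lemma S_bounded_linear: "bounded_linear (S t)"
  by (rule bounded_linear_intro[where K = N])
    (simp_all add: S_add_right S_scale_right S_bound mult.commute[of _ N])

lemma S_j: "S t (j x) = j (T t x)"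
  by (simp add: S_def K_j K_L j_eq R_T)

lemma S_0: "S 0 y = y"
  by (simp add: S_def T_0 L_K)

lemma S_add: "0 \<le> s \<Longrightarrow> 0 \<le> t \<Longrightarrow> S (s + t) y = S s (S t y)"
  by (simp add: S_def T_add K_L)

lemma S_tendsto_id: "((\<lambda>t. S t y) \<longlongrightarrow> y) (at_right 0)"
  unfolding S_def using blinfun.tendsto[OF tendsto_const T_tendsto_id[of "K y"], of L] by (simp add: L_K)

text \<open>For s \<le> t the difference is S(s) applied to S(t - s)y - y, and S(s) is bounded
  uniformly in s. Continuity at 0 thus gives one modulus of continuity for all times.\<close>

lemma S_uniformly_continuous:
  assumes "0 < e"
  obtains d where "0 < d" "\<And>s t. 0 \<le> s \<Longrightarrow> 0 \<le> t \<Longrightarrow> \<bar>s - t\<bar> < d \<Longrightarrow> norm (S s y - S t y) < e"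
proof -
  have e: "0 < e / (N + 1)"
    using assms N_nonneg by simp
  have "\<forall>\<^sub>F t in at_right 0. dist (S t y) y < e / (N + 1)"
    by (rule tendstoD[OF S_tendsto_id e])
  then obtain d where d: "0 < d" "\<And>t. 0 < t \<Longrightarrow> t < d \<Longrightarrow> dist (S t y) y < e / (N + 1)"
    unfolding eventually_at_right_field by auto
  have less: "norm (S t y - S s y) < e" if "0 \<le> s" "s \<le> t" "t - s < d" for s t
  proof (cases "s = t")
    case False
    have "S t y = S s (S (t - s) y)"
      using S_add[of s "t - s" y] that by simp
    then have "norm (S t y - S s y) \<le> N * norm (S (t - s) y - y)"
      by (simp add: S_diff_right[symmetric] S_bound)
    also have "\<dots> \<le> (N + 1) * norm (S (t - s) y - y)"
      by (rule mult_right_mono) simp_all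
    also have "\<dots> < e"
      using d(2)[of "t - s"] False that N_nonneg by (simp add: dist_norm field_simps)
    finally show ?thesis .
  qed (use assms in simp)
  have "norm (S s y - S t y) < e" if "0 \<le> s" "0 \<le> t" "\<bar>s - t\<bar> < d" for s t
    using less[of s t] less[of t s] that by (cases "s \<le> t") (auto simp: norm_minus_commute abs_if split: if_splits)
  with d(1) show thesis
    by (rule that)
qed

text \<open>\<open>j (K y)\<close> is the preimage of y under minus the extrapolated generator. Its
  orbit is the image under \<open>L\<close> of the orbit of \<open>R 0 (K y)\<close>, which starts
  in \<open>D\<close>.\<close>

lemma S_j_K_derivative: "((\<lambda>h. (S h (j (K y)) - j (K y)) /\<^sub>R h) \<longlongrightarrow> - y) (at_right 0)"
proof -
  have "((\<lambda>h. (T h (R 0 (K y)) - R 0 (K y)) /\<^sub>R h) \<longlongrightarrow> A (R 0 (K y))) (at_right 0)"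
    by (rule T_derivative[OF R_in]) simp
  then have "((\<lambda>h. L ((T h (R 0 (K y)) - R 0 (K y)) /\<^sub>R h)) \<longlongrightarrow> L (A (R 0 (K y)))) (at_right 0)"
    by (rule bounded_linear.tendsto[OF blinfun.bounded_linear_right])
  moreover have "S h (j (K y)) = L (T h (R 0 (K y)))" "j (K y) = L (R 0 (K y))" for h
    by (simp_all add: S_def K_j j_eq[symmetric])
  moreover have "L (A (R 0 (K y))) = - y"
    by (simp add: A_R L_K blinfun.minus_right)
  ultimately show ?thesis
    by (simp only: blinfun.scaleR_right blinfun.diff_right)
qed

text \<open>The error per unit time when h S(h)y is replaced by z - S(h)z, with z =
  \<open>j (K y)\<close> and h = 2^(-m). The comparison is with S(h)y and not with y because the
  Riemann sums sample at the left end of a cell, where the time left until 1 is longer by h than at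
  the right end.\<close>

definition riemann_error :: "nat \<Rightarrow> 'y \<Rightarrow> real" where
  "riemann_error m y = norm ((j (K y) - S (1 / 2 ^ m) (j (K y))) /\<^sub>R (1 / 2 ^ m) - S (1 / 2 ^ m) y)"

lemma riemann_error_tendsto: "(\<lambda>m. riemann_error m y) \<longlonglongrightarrow> 0"
proof -
  have "(\<lambda>m. (1 / 2) ^ m :: real) \<longlonglongrightarrow> 0"
    by (rule LIMSEQ_power_zero) simp
  then have h: "filterlim (\<lambda>m. 1 / 2 ^ m :: real) (at_right 0) sequentially"
    by (auto simp: filterlim_at power_divide intro: always_eventually)
  have "((\<lambda>h. - ((S h (j (K y)) - j (K y)) /\<^sub>R h) - S h y) \<longlongrightarrow> - (- y) - y) (at_right 0)"
    by (rule tendsto_diff[OF tendsto_minus[OF S_j_K_derivative] S_tendsto_id])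
  then have "((\<lambda>h. - ((S h (j (K y)) - j (K y)) /\<^sub>R h) - S h y) \<longlongrightarrow> 0) (at_right 0)"
    by (simp only: minus_minus diff_self)
  then have "((\<lambda>h. norm (- ((S h (j (K y)) - j (K y)) /\<^sub>R h) - S h y)) \<longlongrightarrow> 0) (at_right 0)"
    by (rule tendsto_norm_zero)
  from filterlim_compose[OF this h] show ?thesis
    unfolding riemann_error_def by (simp only: scaleR_minus_right[symmetric] minus_diff_eq)
qed

text \<open>The Riemann sums telescope because \<open>y\<close> is minus the generator applied to \<open>j (K y)\<close>; this is
  why the integral lies in the range of \<open>j\<close>.\<close>

lemma riemann_sum_telescope:
  assumes ab: "a \<le> b" "b \<le> 2 ^ m"
  shows "norm ((1 / 2 ^ m) *\<^sub>R (\<Sum>k = a..<b. S (1 - real k / 2 ^ m) y)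
    - j (T (1 - real b / 2 ^ m) (K y) - T (1 - real a / 2 ^ m) (K y))) \<le> N * riemann_error m y"
proof -
  let ?h = "1 / 2 ^ m :: real" and ?z = "j (K y)"
  let ?g = "\<lambda>k. S (1 - real k / 2 ^ m) ?z"
  have step: "norm (?h *\<^sub>R S (1 - real k / 2 ^ m) y - (?g (Suc k) - ?g k)) \<le> ?h * (N * riemann_error m y)"
    if "k < b" for k
  proof -
    \<comment> \<open>The time left at the right end of the cell; \<open>S ?t\<close> is a common
      factor of all terms and costs the constant \<open>N\<close>.\<close>
    let ?t = "1 - real (Suc k) / 2 ^ m"
    have "Suc k \<le> 2 ^ m"
      using that ab by linarith
    then have "real (Suc k) \<le> 2 ^ m"
      by (metis of_nat_le_iff of_nat_numeral of_nat_power)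
    then have t: "0 \<le> ?t"
      by (simp add: divide_le_eq)
    have eq: "1 - real k / 2 ^ m = ?t + ?h"
      by (simp add: field_simps)
    let ?e = "(?z - S ?h ?z) /\<^sub>R ?h - S ?h y"
    have "?h *\<^sub>R ?e = ?z - S ?h ?z - ?h *\<^sub>R S ?h y"
      by (simp add: scaleR_diff_right)
    then have "S ?t (?h *\<^sub>R ?e) = S ?t ?z - S ?t (S ?h ?z) - ?h *\<^sub>R S ?t (S ?h y)"
      by (simp only: S_diff_right S_scale_right)
    moreover have "S (1 - real k / 2 ^ m) w = S ?t (S ?h w)" for w
      unfolding eq by (rule S_add[OF t]) simp
    ultimately have "?g (Suc k) - ?g k - ?h *\<^sub>R S (1 - real k / 2 ^ m) y = ?h *\<^sub>R S ?t ?e"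
      by (simp only: S_scale_right)
    then have "norm (?h *\<^sub>R S (1 - real k / 2 ^ m) y - (?g (Suc k) - ?g k)) = ?h * norm (S ?t ?e)"
      by (subst norm_minus_commute) simp
    then show ?thesis
      using S_bound[of ?t ?e] unfolding riemann_error_def by (simp add: divide_right_mono)
  qed
  have eq: "?h *\<^sub>R (\<Sum>k = a..<b. S (1 - real k / 2 ^ m) y)
      - j (T (1 - real b / 2 ^ m) (K y) - T (1 - real a / 2 ^ m) (K y))
      = (\<Sum>k = a..<b. ?h *\<^sub>R S (1 - real k / 2 ^ m) y - (?g (Suc k) - ?g k))"
    using sum_Suc_diff'[OF ab(1), of ?g]
    by (simp only: sum_subtractf scaleR_sum_right S_j linear_diff[OF j_linear])
  have "norm (\<Sum>k = a..<b. ?h *\<^sub>R S (1 - real k / 2 ^ m) y - (?g (Suc k) - ?g k))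
      \<le> (\<Sum>k = a..<b. ?h * (N * riemann_error m y))"
    by (rule sum_norm_le) (rule step, simp)
  also have "\<dots> = (real (b - a) / 2 ^ m) * (N * riemann_error m y)"
    by simp
  also have "\<dots> \<le> 1 * (N * riemann_error m y)"
  proof (rule mult_right_mono)
    have "b - a \<le> 2 ^ m"
      using ab by linarith
    then have "real (b - a) \<le> 2 ^ m"
      by (metis of_nat_le_iff of_nat_numeral of_nat_power)
    then show "real (b - a) / 2 ^ m \<le> 1"
      by simp
    show "0 \<le> N * riemann_error m y"
      unfolding riemann_error_def by (intro mult_nonneg_nonneg N_nonneg norm_ge_zero)
  qed
  finally show ?thesis
    unfolding eq by simp
qed

end

section \<open>Dyadic step functions as controls\<close>

text \<open>A step function on the cells [k/2^n, (k+1)/2^n), with values indexed by all naturals so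
  that no range has to be tracked. On [0,1] the value \<open>v (2 ^ n)\<close> is taken at s = 1
  only, a null set; hence integrals sum over k < 2^n.\<close>

definition dyadic :: "nat \<Rightarrow> (nat \<Rightarrow> 'a) \<Rightarrow> real \<Rightarrow> 'a" where
  "dyadic n v s = v (nat \<lfloor>s * 2 ^ n\<rfloor>)"

lemma nat_floor_dyadic_refine:
  fixes s :: real
  assumes "n \<le> m"
  shows "nat \<lfloor>s * 2 ^ n\<rfloor> = nat \<lfloor>s * 2 ^ m\<rfloor> div 2 ^ (m - n)"
proof -
  have "(2::real) ^ m = 2 ^ (m - n) * 2 ^ n"
    using assms by (simp add: power_add[symmetric])
  then have "s * 2 ^ n = s * 2 ^ m / real_of_int (2 ^ (m - n))"
    by simp
  then have "\<lfloor>s * 2 ^ n\<rfloor> = \<lfloor>s * 2 ^ m\<rfloor> div 2 ^ (m - n)"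
    by (simp only: floor_divide_real_eq_div[OF zero_le_power[OF zero_le_numeral]])
  moreover have "nat (a div 2 ^ d) = nat a div 2 ^ d" for a :: int and d
    by (cases "0 \<le> a") (simp_all add: nat_div_distrib nat_power_eq div_nonpos_pos_le0)
  ultimately show ?thesis
    by simp
qed

lemma dyadic_refine: "n \<le> m \<Longrightarrow> dyadic n v = dyadic m (\<lambda>k. v (k div 2 ^ (m - n)))"
  by (simp add: dyadic_def fun_eq_iff nat_floor_dyadic_refine)

lemma dyadic_grid: "n \<le> m \<Longrightarrow> dyadic n v (real k / 2 ^ m) = v (k div 2 ^ (m - n))"
  by (simp only: dyadic_def nat_floor_dyadic_grid)

lemma sum_dyadic_cells:
  fixes f :: "nat \<Rightarrow> nat \<Rightarrow> 'b::comm_monoid_add"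
  assumes "n \<le> m"
  shows "(\<Sum>k<2 ^ m. f k (k div 2 ^ (m - n))) =
    (\<Sum>l<2 ^ n. \<Sum>k = l * 2 ^ (m - n)..<Suc l * 2 ^ (m - n). f k l)"
proof -
  let ?d = "2 ^ (m - n) :: nat"
  have "(2::nat) ^ m = 2 ^ n * ?d"
    using assms by (simp add: power_add[symmetric])
  then have "(\<Sum>k<2 ^ m. f k (k div ?d)) = (\<Sum>l<2 ^ n. \<Sum>k = l * ?d..<l * ?d + ?d. f k (k div ?d))"
    by (simp only: sum.nat_group)
  also have "\<dots> = (\<Sum>l<2 ^ n. \<Sum>k = l * ?d..<Suc l * ?d. f k l)"
  proof (intro sum.cong refl)
    show "{l * ?d..<l * ?d + ?d} = {l * ?d..<Suc l * ?d}" for l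
      by (simp add: add.commute)
    show "f k (k div ?d) = f k l" if "k \<in> {l * ?d..<Suc l * ?d}" for k l
    proof -
      have "k div ?d = l"
        using that by (intro div_nat_eqI) (simp_all add: mult.commute)
      then show ?thesis
        by simp
    qed
  qed
  finally show ?thesis .
qed

context positive_extrapolation
begin

text \<open>The left-endpoint sum for the control integral over [0,1] with final time 1.\<close>

definition riemann :: "nat \<Rightarrow> (real \<Rightarrow> 'y) \<Rightarrow> 'y" where
  "riemann m f = (1 / 2 ^ m) *\<^sub>R (\<Sum>k<2 ^ m. S (1 - real k / 2 ^ m) (f (real k / 2 ^ m)))"

lemma riemann_diff: "riemann m (\<lambda>s. f s - g s) = riemann m f - riemann m g"
  by (simp add: riemann_def S_diff_right sum_subtractf scaleR_diff_right)

text \<open>On each coarse cell the control is constant, so \<open>riemann_sum_telescope\<close>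
  applies between the ends of the cell, counted on the fine grid. The point is that the limit is in
  the range of \<open>j\<close>.\<close>

lemma riemann_dyadic_tendsto:
  "(\<lambda>m. riemann m (dyadic n v)) \<longlonglongrightarrow>
    j (\<Sum>l<2 ^ n. T (1 - real (Suc l) / 2 ^ n) (K (v l)) - T (1 - real l / 2 ^ n) (K (v l)))"
proof -
  let ?s = "\<lambda>m l. (1 / 2 ^ m) *\<^sub>R (\<Sum>k = l * 2 ^ (m - n)..<Suc l * 2 ^ (m - n). S (1 - real k / 2 ^ m) (v l))"
    and ?I = "\<lambda>l. j (T (1 - real (Suc l) / 2 ^ n) (K (v l)) - T (1 - real l / 2 ^ n) (K (v l)))"
  have lim: "(\<lambda>m. ?s m l) \<longlonglongrightarrow> ?I l" if l: "l < 2 ^ n" for l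
  proof -
    have bound: "norm (?s m l - ?I l) \<le> N * riemann_error m (v l)" if m: "n \<le> m" for m
    proof -
      have pow: "(2::nat) ^ m = 2 ^ n * 2 ^ (m - n)" "(2::real) ^ m = 2 ^ n * 2 ^ (m - n)"
        using m by (simp_all add: power_add[symmetric])
      have "real (a * 2 ^ (m - n)) / 2 ^ m = real a / 2 ^ n" for a
        unfolding pow by simp
      moreover have "Suc l * 2 ^ (m - n) \<le> 2 ^ m"
        unfolding pow by (rule mult_le_mono1) (use l in simp)
      moreover have "l * 2 ^ (m - n) \<le> Suc l * 2 ^ (m - n)"
        by simp
      ultimately show ?thesis
        using riemann_sum_telescope[of "l * 2 ^ (m - n)" "Suc l * 2 ^ (m - n)" m "v l"] by metis
    qed
    have "(\<lambda>m. ?s m l - ?I l) \<longlonglongrightarrow> 0"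
    proof (rule Lim_null_comparison)
      show "\<forall>\<^sub>F m in sequentially. norm (?s m l - ?I l) \<le> N * riemann_error m (v l)"
        using eventually_ge_at_top[of n] by (rule eventually_mono) (rule bound)
      show "(\<lambda>m. N * riemann_error m (v l)) \<longlonglongrightarrow> 0"
        by (rule tendsto_mult_right_zero[OF riemann_error_tendsto])
    qed
    then show ?thesis
      by (simp only: LIM_zero_iff)
  qed
  have "(\<lambda>m. \<Sum>l<2 ^ n. ?s m l) \<longlonglongrightarrow> (\<Sum>l<2 ^ n. ?I l)"
    by (rule tendsto_sum) (rule lim, simp)
  moreover have "\<forall>\<^sub>F m in sequentially. (\<Sum>l<2 ^ n. ?s m l) = riemann m (dyadic n v)"
    using eventually_ge_at_top[of n]
  proof (rule eventually_mono)
    fix m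
    assume m: "n \<le> m"
    show "(\<Sum>l<2 ^ n. ?s m l) = riemann m (dyadic n v)"
      unfolding riemann_def dyadic_grid[OF m]
        sum_dyadic_cells[OF m, of "\<lambda>k l. S (1 - real k / 2 ^ m) (v l)"] scaleR_sum_right ..
  qed
  ultimately have "(\<lambda>m. riemann m (dyadic n v)) \<longlonglongrightarrow> (\<Sum>l<2 ^ n. ?I l)"
    by (rule Lim_transform_eventually)
  then show ?thesis
    by (simp only: linear_sum[OF j_linear])
qed

text \<open>Every coarse cell contains 2^(m-n) points of the fine grid, so the norms add up to the
  L^1 norm of the step function. This holds in the extrapolation norm only.\<close>

lemma riemann_dyadic_bound:
  assumes m: "n \<le> m"
  shows "norm (riemann m (dyadic n v)) \<le> N * ((\<Sum>l<2 ^ n. norm (v l)) / 2 ^ n)"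
proof -
  have "norm (\<Sum>k<2 ^ m. S (1 - real k / 2 ^ m) (v (k div 2 ^ (m - n))))
      \<le> (\<Sum>k<2 ^ m. N * norm (v (k div 2 ^ (m - n))))"
    by (rule sum_norm_le) (rule S_bound)
  also have "\<dots> = (\<Sum>l<2 ^ n. real (2 ^ (m - n)) * (N * norm (v l)))"
    unfolding sum_dyadic_cells[OF m, of "\<lambda>k l. N * norm (v l)"] by simp
  also have "\<dots> = 2 ^ (m - n) * (N * (\<Sum>l<2 ^ n. norm (v l)))"
    by (simp add: sum_distrib_left)
  finally have "norm (riemann m (dyadic n v)) \<le> (1 / 2 ^ m) * (2 ^ (m - n) * (N * (\<Sum>l<2 ^ n. norm (v l))))"
    unfolding riemann_def dyadic_grid[OF m] by (simp add: divide_right_mono)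
  moreover have "(2::real) ^ m = 2 ^ n * 2 ^ (m - n)"
    using m by (simp add: power_add[symmetric])
  ultimately show ?thesis
    by simp
qed

text \<open>Convergence of \<open>j a\<close> for nonnegative a controls only R(0)a. But R(l) = R(0)
  - l R(l)R(0) depends continuously on R(0)a, so R(l)x is a limit of nonnegative elements for every
  l \<ge> 0, and x is the limit of l R(l)x along l = 2^k.\<close>

lemma j_in_cone_imp_nonneg:
  assumes "j x \<in> extrapolation_cone j"
  shows "0 \<le> x"
proof -
  obtain f where f: "\<And>n. f n \<in> j ` {x. 0 \<le> x}" "f \<longlonglongrightarrow> j x"
    using assms unfolding extrapolation_cone_def closure_sequential by blast
  have R_eq: "R l y = R 0 y - l *\<^sub>R R l (R 0 y)" if "0 \<le> l" for l y
    using R_left[OF that R_in[of 0 y]] A_R[of 0 y] that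
    by (simp add: R_scale linear_add[OF bounded_linear.linear[OF R_bounded]] eq_diff_eq add.commute)
  have "0 \<le> R l x" if l: "0 \<le> l" for l
  proof -
    have "(\<lambda>n. K (f n)) \<longlonglongrightarrow> K (j x)"
      by (rule bounded_linear.tendsto[OF blinfun.bounded_linear_right f(2)])
    then have lim: "(\<lambda>n. K (f n)) \<longlonglongrightarrow> R 0 x"
      by (simp only: K_j)
    have "(\<lambda>n. K (f n) - l *\<^sub>R R l (K (f n))) \<longlonglongrightarrow> R 0 x - l *\<^sub>R R l (R 0 x)"
      by (rule tendsto_diff[OF lim tendsto_scaleR[OF tendsto_const bounded_linear.tendsto[OF R_bounded[OF l] lim]]])
    then have lim: "(\<lambda>n. K (f n) - l *\<^sub>R R l (K (f n))) \<longlonglongrightarrow> R l x"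
      by (simp only: R_eq[OF l, symmetric])
    have "K (f n) - l *\<^sub>R R l (K (f n)) \<in> {x. 0 \<le> x}" for n
    proof -
      obtain a where a: "f n = j a" "0 \<le> a"
        using f(1)[of n] by auto
      have "K (f n) - l *\<^sub>R R l (K (f n)) = R l a"
        by (simp only: a(1) K_j R_eq[OF l, symmetric])
      then show ?thesis
        using R_pos[OF l a(2)] by simp
    qed
    from closed_sequentially[OF closed_nonneg this lim] show ?thesis
      by simp
  qed
  then have "J k x \<in> {x. 0 \<le> x}" for k
    unfolding J_def by (simp add: scaleR_nonneg_nonneg)
  from closed_sequentially[OF closed_nonneg this J_tendsto] show ?thesis
    by simp
qed

lemma S_cone:
  assumes "y \<in> extrapolation_cone j"
  shows "S t y \<in> extrapolation_cone j"
proof (rule extrapolation_cone_image[of "S t", OF _ _ assms])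
  show "continuous_on UNIV (S t)"
    by (rule linear_continuous_on[OF S_bounded_linear])
  show "S t (j x) \<in> j ` {x. 0 \<le> x}" if "0 \<le> x" for x
  proof -
    have "T t x \<in> {x. 0 \<le> x}"
      by (rule T_invariant[OF closed_nonneg]) (simp_all add: that J_def R_pos scaleR_nonneg_nonneg)
    then show ?thesis
      by (simp add: S_j)
  qed
qed

lemma riemann_cone:
  assumes "\<And>s. f s \<in> extrapolation_cone j"
  shows "riemann m f \<in> extrapolation_cone j"
  unfolding riemann_def
  by (intro extrapolation_cone_scale[OF j_linear] extrapolation_cone_sum[OF j_linear] S_cone assms) simp

text \<open>Positivity of \<open>x\<close> makes \<open>lower_bound\<close> available: c|x| \<le>
  |R(0)x| = |K(jx)| \<le> |K| |jx|. This turns the estimate in the extrapolation norm into one in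
  the original norm.\<close>

lemma riemann_dyadic_limit_norm:
  assumes lim: "(\<lambda>m. riemann m (dyadic n v)) \<longlonglongrightarrow> j x" and pos: "\<And>k. v k \<in> extrapolation_cone j"
  shows "norm x \<le> norm K * N / c * ((\<Sum>l<2 ^ n. norm (v l)) / 2 ^ n)"
proof -
  let ?I = "(\<Sum>l<2 ^ n. norm (v l)) / 2 ^ n"
  have "riemann m (dyadic n v) \<in> extrapolation_cone j" for m
    by (rule riemann_cone) (simp add: dyadic_def pos)
  then have "j x \<in> extrapolation_cone j"
    by (rule closed_sequentially[OF _ _ lim, rotated]) (simp add: extrapolation_cone_def)
  then have "c * norm x \<le> norm (K (j x))"
    unfolding K_j by (intro lower_bound j_in_cone_imp_nonneg)
  also have "\<dots> \<le> norm K * norm (j x)"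
    by (rule norm_blinfun)
  also have "\<dots> \<le> norm K * (N * ?I)"
  proof (rule mult_left_mono)
    show "norm (j x) \<le> N * ?I"
      by (rule LIMSEQ_le_const2[OF tendsto_norm[OF lim]]) (use riemann_dyadic_bound in blast)
  qed simp
  finally show ?thesis
    using c_pos by (simp add: field_simps)
qed

text \<open>The estimate of the limit needs values in the cone, so \<open>v\<close> is split cell by
  cell into positive and negative parts with norms at most those of \<open>v\<close>; this is the
  factor 2.\<close>

lemma riemann_positive_control:
  fixes B :: "'u::banach_lattice \<Rightarrow>\<^sub>L 'y"
  assumes B: "positive_control j B"
  obtains x where "(\<lambda>m. riemann m (\<lambda>s. B (dyadic n v s))) \<longlonglongrightarrow> j x"
    "norm x \<le> 2 * (norm K * N / c * norm B) * ((\<Sum>l<2 ^ n. norm (v l)) / 2 ^ n)"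
proof -
  have "\<exists>y z. 0 \<le> y \<and> 0 \<le> z \<and> v l = y - z \<and> norm y \<le> norm (v l) \<and> norm z \<le> norm (v l)" for l
    by (rule pos_neg_parts[of "v l"]) blast
  then have "\<exists>p. \<forall>l. \<exists>z. 0 \<le> p l \<and> 0 \<le> z \<and> v l = p l - z \<and> norm (p l) \<le> norm (v l) \<and> norm z \<le> norm (v l)"
    by (intro choice allI)
  then obtain p where "\<forall>l. \<exists>z. 0 \<le> p l \<and> 0 \<le> z \<and> v l = p l - z \<and> norm (p l) \<le> norm (v l) \<and> norm z \<le> norm (v l)"
    by (elim exE)
  then have "\<exists>q. \<forall>l. 0 \<le> p l \<and> 0 \<le> q l \<and> v l = p l - q l \<and> norm (p l) \<le> norm (v l) \<and> norm (q l) \<le> norm (v l)"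
    by (rule choice)
  then obtain q where pq: "\<forall>l. 0 \<le> p l \<and> 0 \<le> q l \<and> v l = p l - q l \<and> norm (p l) \<le> norm (v l) \<and> norm (q l) \<le> norm (v l)"
    by (elim exE)
  have dy: "(\<lambda>s. B (dyadic n w s)) = dyadic n (\<lambda>l. B (w l))" for w
    by (simp add: dyadic_def fun_eq_iff)
  have part: "\<exists>x. (\<lambda>m. riemann m (dyadic n (\<lambda>l. B (w l)))) \<longlonglongrightarrow> j x \<and>
      norm x \<le> norm K * N / c * norm B * ((\<Sum>l<2 ^ n. norm (v l)) / 2 ^ n)"
    if w: "\<And>l. 0 \<le> w l" "\<And>l. norm (w l) \<le> norm (v l)" for w
  proof -
    obtain x where lim: "(\<lambda>m. riemann m (dyadic n (\<lambda>l. B (w l)))) \<longlonglongrightarrow> j x"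
      using riemann_dyadic_tendsto by blast
    have "norm x \<le> norm K * N / c * ((\<Sum>l<2 ^ n. norm (B (w l))) / 2 ^ n)"
      by (rule riemann_dyadic_limit_norm[OF lim]) (use B w(1) in \<open>simp add: positive_control_def\<close>)
    also have "\<dots> \<le> norm K * N / c * ((\<Sum>l<2 ^ n. norm B * norm (v l)) / 2 ^ n)"
    proof (intro mult_left_mono divide_right_mono sum_mono)
      show "norm (B (w l)) \<le> norm B * norm (v l)" for l
        by (rule order_trans[OF norm_blinfun mult_left_mono[OF w(2) norm_ge_zero]])
    qed (use c_pos N_nonneg in simp_all)
    also have "\<dots> = norm K * N / c * norm B * ((\<Sum>l<2 ^ n. norm (v l)) / 2 ^ n)"
      by (simp add: sum_distrib_left[symmetric])
    finally show ?thesis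
      using lim by blast
  qed
  obtain x where x: "(\<lambda>m. riemann m (dyadic n (\<lambda>l. B (p l)))) \<longlonglongrightarrow> j x"
    "norm x \<le> norm K * N / c * norm B * ((\<Sum>l<2 ^ n. norm (v l)) / 2 ^ n)"
    using part[of p] pq by blast
  obtain y where y: "(\<lambda>m. riemann m (dyadic n (\<lambda>l. B (q l)))) \<longlonglongrightarrow> j y"
    "norm y \<le> norm K * N / c * norm B * ((\<Sum>l<2 ^ n. norm (v l)) / 2 ^ n)"
    using part[of q] pq by blast
  have "dyadic n (\<lambda>l. B (v l)) = (\<lambda>s. dyadic n (\<lambda>l. B (p l)) s - dyadic n (\<lambda>l. B (q l)) s)"
    using pq by (simp add: dyadic_def fun_eq_iff blinfun.diff_right[symmetric])
  then have "(\<lambda>m. riemann m (\<lambda>s. B (dyadic n v s))) \<longlonglongrightarrow> j (x - y)"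
    unfolding dy using tendsto_diff[OF x(1) y(1)] by (simp only: riemann_diff linear_diff[OF j_linear])
  moreover have "norm (x - y) \<le> 2 * (norm K * N / c * norm B) * ((\<Sum>l<2 ^ n. norm (v l)) / 2 ^ n)"
    using norm_triangle_ineq4[of x y] x(2) y(2) by linarith
  ultimately show thesis
    by (rule that)
qed

end

section \<open>Strong measurability and approximation in \<open>L\<^sup>1\<close>\<close>

text \<open>The distance in \<open>L\<^sup>1\<close> is bounded through a measurable majorant: for values in a nonseparable
  space the norm of the difference is only almost everywhere equal to a measurable function, and
  the integral \<open>\<integral>\<^sup>+\<close> is not subadditive on nonmeasurable functions.\<close>

definition L1_close :: "'a measure \<Rightarrow> real \<Rightarrow> ('a \<Rightarrow> 'b::real_normed_vector) \<Rightarrow> ('a \<Rightarrow> 'b) \<Rightarrow> bool" where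
  "L1_close M e f g \<longleftrightarrow> (\<exists>h. h \<in> borel_measurable M \<and> (AE x in M. ennreal (norm (f x - g x)) \<le> h x) \<and>
     (\<integral>\<^sup>+x. h x \<partial>M) \<le> ennreal e)"

lemma L1_closeI:
  "h \<in> borel_measurable M \<Longrightarrow> (AE x in M. ennreal (norm (f x - g x)) \<le> h x) \<Longrightarrow>
    (\<integral>\<^sup>+x. h x \<partial>M) \<le> ennreal e \<Longrightarrow> L1_close M e f g"
  unfolding L1_close_def by (intro exI[of _ h] conjI)

lemma L1_closeE:
  assumes "L1_close M e f g"
  obtains h where "h \<in> borel_measurable M" "AE x in M. ennreal (norm (f x - g x)) \<le> h x"
    "(\<integral>\<^sup>+x. h x \<partial>M) \<le> ennreal e"
  using assms unfolding L1_close_def by (elim exE conjE)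

lemma L1_close_nn_integral:
  assumes "L1_close M e f g"
  shows "(\<integral>\<^sup>+x. norm (f x - g x) \<partial>M) \<le> ennreal e"
proof -
  obtain h where h: "h \<in> borel_measurable M" "AE x in M. ennreal (norm (f x - g x)) \<le> h x"
    "(\<integral>\<^sup>+x. h x \<partial>M) \<le> ennreal e"
    by (rule L1_closeE[OF assms])
  from nn_integral_mono_AE[OF h(2)] h(3) show ?thesis
    by (rule order_trans)
qed

text \<open>The common source of transitivity and additivity: the pointwise triangle inequality
  stays a hypothesis, and the majorants are added.\<close>

lemma L1_close_combine:
  assumes 1: "L1_close M d f1 g1" and 2: "L1_close M e f2 g2" and d: "0 \<le> d" and e: "0 \<le> e"
    and le: "\<And>x. x \<in> space M \<Longrightarrow> norm (f x - g x) \<le> norm (f1 x - g1 x) + norm (f2 x - g2 x)"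
  shows "L1_close M (d + e) f g"
proof -
  obtain h1 where h1: "h1 \<in> borel_measurable M" "AE x in M. ennreal (norm (f1 x - g1 x)) \<le> h1 x"
    "(\<integral>\<^sup>+x. h1 x \<partial>M) \<le> ennreal d"
    by (rule L1_closeE[OF 1])
  obtain h2 where h2: "h2 \<in> borel_measurable M" "AE x in M. ennreal (norm (f2 x - g2 x)) \<le> h2 x"
    "(\<integral>\<^sup>+x. h2 x \<partial>M) \<le> ennreal e"
    by (rule L1_closeE[OF 2])
  show ?thesis
  proof (rule L1_closeI[where h = "\<lambda>x. h1 x + h2 x"])
    show "(\<lambda>x. h1 x + h2 x) \<in> borel_measurable M"
      by (rule borel_measurable_add[OF h1(1) h2(1)])
    show "AE x in M. ennreal (norm (f x - g x)) \<le> h1 x + h2 x"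
      using h1(2) h2(2) AE_space
    proof eventually_elim
      case (elim x)
      have "ennreal (norm (f x - g x)) \<le> ennreal (norm (f1 x - g1 x)) + ennreal (norm (f2 x - g2 x))"
        using ennreal_leI[OF le[OF elim(3)]] by simp
      also have "\<dots> \<le> h1 x + h2 x"
        by (rule add_mono[OF elim(1,2)])
      finally show ?case .
    qed
    have "(\<integral>\<^sup>+x. h1 x + h2 x \<partial>M) = (\<integral>\<^sup>+x. h1 x \<partial>M) + (\<integral>\<^sup>+x. h2 x \<partial>M)"
      by (rule nn_integral_add[OF h1(1) h2(1)])
    also have "\<dots> \<le> ennreal d + ennreal e"
      by (rule add_mono[OF h1(3) h2(3)])
    also have "\<dots> = ennreal (d + e)"
      using d e by simp
    finally show "(\<integral>\<^sup>+x. h1 x + h2 x \<partial>M) \<le> ennreal (d + e)" .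
  qed
qed

lemma L1_close_trans:
  assumes "L1_close M d f g" "L1_close M e g k" "0 \<le> d" "0 \<le> e"
  shows "L1_close M (d + e) f k"
  by (rule L1_close_combine[OF assms]) (metis norm_triangle_ineq diff_add_cancel add_diff_eq)

lemma L1_close_add:
  assumes "L1_close M d f1 g1" "L1_close M e f2 g2" "0 \<le> d" "0 \<le> e"
  shows "L1_close M (d + e) (\<lambda>x. f1 x + f2 x) (\<lambda>x. g1 x + g2 x)"
  by (rule L1_close_combine[OF assms]) (simp add: add_diff_add norm_triangle_ineq)

lemma L1_close_lipschitz:
  assumes 1: "L1_close M e f g" and C: "0 \<le> C"
    and le: "\<And>x. x \<in> space M \<Longrightarrow> norm (f' x - g' x) \<le> C * norm (f x - g x)"
  shows "L1_close M (C * e) f' g'"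
proof -
  obtain h where h: "h \<in> borel_measurable M" "AE x in M. ennreal (norm (f x - g x)) \<le> h x"
    "(\<integral>\<^sup>+x. h x \<partial>M) \<le> ennreal e"
    by (rule L1_closeE[OF 1])
  show ?thesis
  proof (rule L1_closeI[where h = "\<lambda>x. ennreal C * h x"])
    show "(\<lambda>x. ennreal C * h x) \<in> borel_measurable M"
      using h(1) by measurable
    show "AE x in M. ennreal (norm (f' x - g' x)) \<le> ennreal C * h x"
      using h(2) AE_space
    proof eventually_elim
      case (elim x)
      have "ennreal (norm (f' x - g' x)) \<le> ennreal C * ennreal (norm (f x - g x))"
        using ennreal_leI[OF le[OF elim(2)]] C by (simp add: ennreal_mult)
      also have "\<dots> \<le> ennreal C * h x"
        by (rule mult_left_mono[OF elim(1)]) simp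
      finally show ?case .
    qed
    have "(\<integral>\<^sup>+x. ennreal C * h x \<partial>M) = ennreal C * (\<integral>\<^sup>+x. h x \<partial>M)"
      by (rule nn_integral_cmult[OF h(1)])
    also have "\<dots> \<le> ennreal C * ennreal e"
      by (rule mult_left_mono[OF h(3)]) simp
    also have "\<dots> = ennreal (C * e)"
      using C by (simp add: ennreal_mult')
    finally show "(\<integral>\<^sup>+x. ennreal C * h x \<partial>M) \<le> ennreal (C * e)" .
  qed
qed

lemma L1_close_uniform:
  assumes M: "emeasure M (space M) \<le> 1"
    and le: "\<And>x. x \<in> space M \<Longrightarrow> norm (f x - g x) \<le> e"
  shows "L1_close M e f g"
proof (rule L1_closeI[where h = "\<lambda>x. ennreal e"])
  show "AE x in M. ennreal (norm (f x - g x)) \<le> ennreal e"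
    using AE_space by eventually_elim (rule ennreal_leI[OF le])
  have "(\<integral>\<^sup>+x. ennreal e \<partial>M) = ennreal e * emeasure M (space M)"
    by (rule nn_integral_const)
  also have "\<dots> \<le> ennreal e * 1"
    by (rule mult_left_mono[OF M]) simp
  finally show "(\<integral>\<^sup>+x. ennreal e \<partial>M) \<le> ennreal e"
    by simp
qed simp

text \<open>Dominated convergence for truncated approximants. Where \<open>u\<close> vanishes the
  truncations vanish too; elsewhere the truncation is eventually inactive.\<close>

lemma L1_close_simple_function:
  fixes u :: "'a \<Rightarrow> 'b::real_normed_vector"
  assumes u: "strongly_measurable M u" and norm_u[measurable]: "(\<lambda>x. norm (u x)) \<in> borel_measurable M"
    and fin: "(\<integral>\<^sup>+x. norm (u x) \<partial>M) < \<infinity>" and e: "0 < e"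
  obtains s where "simple_function M s" "L1_close M e u s"
proof -
  obtain s where s: "\<And>i. simple_function M (s i)" and lim: "AE x in M. (\<lambda>i. s i x) \<longlonglongrightarrow> u x"
    using u unfolding strongly_measurable_def by blast
  \<comment> \<open>The cut at 2|u| yields the integrable majorant 3|u| for |u - t|, and the factor
    2 leaves room for \<open>s i x\<close> to pass the test eventually where \<open>u x\<close> is
    nonzero.\<close>
  define t where "t i x = (if norm (s i x) \<le> 2 * norm (u x) then s i x else 0)" for i x
  have norm_s[measurable]: "(\<lambda>x. norm (s i x)) \<in> borel_measurable M" for i
    by (rule borel_measurable_simple_function[OF simple_function_compose1[OF s]])
  have t: "simple_function M (t i)" for i
  proof -
    have P: "{x \<in> space M. norm (s i x) \<le> 2 * norm (u x)} \<in> sets M"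
      by measurable
    show ?thesis
      unfolding t_def by (rule simple_function_If[OF s simple_function_const P])
  qed
  \<comment> \<open>A measurable substitute for |u - t|: a liminf of norms of simple functions,
    almost everywhere equal to it.\<close>
  define g where "g k x = liminf (\<lambda>i. ennreal (norm (s i x - t k x)))" for k x
  have g_meas: "g k \<in> borel_measurable M" for k
  proof -
    have "(\<lambda>x. ennreal (norm (s i x - t k x))) \<in> borel_measurable M" for i
      by (rule borel_measurable_simple_function[OF simple_function_compose2[OF s t]])
    then show ?thesis
      unfolding g_def by (rule borel_measurable_liminf)
  qed
  have g_eq: "AE x in M. \<forall>k. g k x = ennreal (norm (u x - t k x))"
    using lim
  proof eventually_elim
    case (elim x)
    have "(\<lambda>i. ennreal (norm (s i x - t k x))) \<longlonglongrightarrow> ennreal (norm (u x - t k x))" for k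
      by (rule tendsto_ennrealI[OF tendsto_norm[OF tendsto_diff[OF elim tendsto_const]]])
    then show ?case
      unfolding g_def by (intro allI lim_imp_Liminf) simp_all
  qed
  have "(\<lambda>k. \<integral>\<^sup>+x. g k x \<partial>M) \<longlonglongrightarrow> (\<integral>\<^sup>+x. 0 \<partial>M)"
  proof (rule nn_integral_dominated_convergence[where w = "\<lambda>x. ennreal (3 * norm (u x))"])
    show "AE x in M. g k x \<le> ennreal (3 * norm (u x))" for k
      using g_eq
    proof eventually_elim
      case (elim x)
      have "norm (t k x) \<le> 2 * norm (u x)"
        by (simp add: t_def)
      then have "norm (u x - t k x) \<le> 3 * norm (u x)"
        using norm_triangle_ineq4[of "u x" "t k x"] by linarith
      then show ?case
        using elim by (simp add: ennreal_leI)
    qed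
    show "AE x in M. (\<lambda>k. g k x) \<longlonglongrightarrow> 0"
      using g_eq lim
    proof eventually_elim
      case (elim x)
      have "(\<lambda>k. t k x) \<longlonglongrightarrow> u x"
      proof (cases "u x = 0")
        case True
        then have "t k x = 0" for k
          by (simp add: t_def)
        with True show ?thesis
          by simp
      next
        case False
        then have "\<forall>\<^sub>F k in sequentially. norm (s k x) < 2 * norm (u x)"
          by (intro order_tendstoD(2)[OF tendsto_norm[OF elim(2)]]) simp
        then have "\<forall>\<^sub>F k in sequentially. s k x = t k x"
          by eventually_elim (simp add: t_def)
        with elim(2) show ?thesis
          by (rule Lim_transform_eventually)
      qed
      then have "(\<lambda>k. norm (u x - t k x)) \<longlonglongrightarrow> norm (u x - u x)"
        by (rule tendsto_norm[OF tendsto_diff[OF tendsto_const]])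
      then have "(\<lambda>k. ennreal (norm (u x - t k x))) \<longlonglongrightarrow> ennreal (norm (u x - u x))"
        by (rule tendsto_ennrealI)
      then show ?case
        using elim(1) by simp
    qed
    have "(\<integral>\<^sup>+x. ennreal (3 * norm (u x)) \<partial>M) = 3 * (\<integral>\<^sup>+x. norm (u x) \<partial>M)"
      by (simp add: ennreal_mult' nn_integral_cmult)
    then show "(\<integral>\<^sup>+x. ennreal (3 * norm (u x)) \<partial>M) < \<infinity>"
      using fin by (simp add: ennreal_mult_less_top)
    show "(\<lambda>x. ennreal (3 * norm (u x))) \<in> borel_measurable M"
      by measurable
  qed (use g_meas in simp_all)
  then have "(\<lambda>k. \<integral>\<^sup>+x. g k x \<partial>M) \<longlonglongrightarrow> 0"
    by simp
  then have "\<forall>\<^sub>F k in sequentially. (\<integral>\<^sup>+x. g k x \<partial>M) < ennreal e"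
    by (rule order_tendstoD(2)) (simp add: e)
  then obtain k where k: "(\<integral>\<^sup>+x. g k x \<partial>M) < ennreal e"
    by (auto simp: eventually_sequentially)
  have "L1_close M e u (t k)"
  proof (rule L1_closeI[OF g_meas])
    show "AE x in M. ennreal (norm (u x - t k x)) \<le> g k x"
      using g_eq by eventually_elim simp
    show "(\<integral>\<^sup>+x. g k x \<partial>M) \<le> ennreal e"
      using k by (rule less_imp_le)
  qed
  with t show thesis
    by (rule that)
qed

section \<open>Dyadic step functions on the unit interval\<close>

abbreviation unit_interval :: "real measure" where
  "unit_interval \<equiv> lebesgue_on {0..1}"

lemma emeasure_unit_interval: "emeasure unit_interval (space unit_interval) = 1"
  by (simp add: emeasure_restrict_space)

lemma nat_floor_unit_interval:
  fixes s :: real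
  assumes "0 \<le> s" "s \<le> 1"
  shows "nat \<lfloor>s * 2 ^ n\<rfloor> \<le> 2 ^ n"
proof -
  have "s * 2 ^ n \<le> real (2 ^ n)"
    using assms by (simp add: mult_left_le_one_le)
  then have "\<lfloor>s * 2 ^ n\<rfloor> \<le> \<lfloor>real (2 ^ n)\<rfloor>"
    by (rule floor_mono)
  then show ?thesis
    by (simp only: floor_of_nat nat_le_iff)
qed

lemma simple_function_nat_floor: "simple_function unit_interval (\<lambda>s. nat \<lfloor>s * 2 ^ n\<rfloor>)"
  unfolding simple_function_eq_measurable
proof
  have "(\<lambda>s::real. nat \<lfloor>s * 2 ^ n\<rfloor>) ` {0..1} \<subseteq> {..2 ^ n}"
    by (intro image_subsetI) (simp only: atMost_iff atLeastAtMost_iff nat_floor_unit_interval)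
  then show "finite ((\<lambda>s. nat \<lfloor>s * 2 ^ n\<rfloor>) ` space unit_interval)"
    by (simp add: finite_subset)
  have "(\<lambda>s::real. nat \<lfloor>s * 2 ^ n\<rfloor>) \<in> lborel \<rightarrow>\<^sub>M count_space UNIV"
    by measurable
  then show "(\<lambda>s. nat \<lfloor>s * 2 ^ n\<rfloor>) \<in> unit_interval \<rightarrow>\<^sub>M count_space UNIV"
    by (intro measurable_restrict_space1 measurable_completion)
qed

lemma simple_function_dyadic: "simple_function unit_interval (dyadic n v)"
  unfolding dyadic_def[abs_def] by (rule simple_function_compose1[OF simple_function_nat_floor])

lemma simple_bochner_integrable_dyadic:
  "Bochner_Integration.simple_bochner_integrable unit_interval (dyadic n v)"
proof (rule simple_bochner_integrable.intros[OF simple_function_dyadic])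
  have "emeasure unit_interval {y \<in> space unit_interval. dyadic n v y \<noteq> 0} \<le> 1"
    using emeasure_space[of unit_interval] emeasure_unit_interval by metis
  then show "emeasure unit_interval {y \<in> space unit_interval. dyadic n v y \<noteq> 0} \<noteq> \<infinity>"
    by (auto simp: top_unique)
qed

lemma simple_bochner_integral_dyadic:
  fixes v :: "nat \<Rightarrow> 'b::real_vector"
  shows "Bochner_Integration.simple_bochner_integral unit_interval (dyadic n v) = (1 / 2 ^ n) *\<^sub>R (\<Sum>k<2 ^ n. v k)"
proof -
  let ?g = "\<lambda>s::real. nat \<lfloor>s * 2 ^ n\<rfloor>" and ?X = "space unit_interval"
  have "Bochner_Integration.simple_bochner_integral unit_interval (dyadic n v) =
      (\<Sum>k\<in>?g ` ?X. measure unit_interval {s \<in> ?X. ?g s = k} *\<^sub>R v k)"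
    by (rule simple_bochner_integral_partition[OF simple_bochner_integrable_dyadic simple_function_nat_floor])
      (simp_all add: dyadic_def)
  also have "?g ` ?X = {..2 ^ n}"
  proof (intro equalityI subsetI)
    fix k
    assume "k \<in> ?g ` ?X"
    then obtain s where "0 \<le> s" "s \<le> 1" "k = ?g s"
      by auto
    then show "k \<in> {..2 ^ n}"
      by (simp only: atMost_iff nat_floor_unit_interval)
  next
    fix k :: nat
    assume "k \<in> {..2 ^ n}"
    then have "real k \<le> 2 ^ n"
      by (metis atMost_iff of_nat_le_iff of_nat_numeral of_nat_power)
    then show "k \<in> ?g ` ?X"
      by (intro image_eqI[of _ _ "real k / 2 ^ n"]) simp_all
  qed
  \<comment> \<open>The last index 2^n belongs to the cell {1} of measure 0 and drops out of the
    sum.\<close>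
  also have "(\<Sum>k\<in>{..2 ^ n}. measure unit_interval {s \<in> ?X. ?g s = k} *\<^sub>R v k) =
      (\<Sum>k\<in>{..2 ^ n}. (if k < 2 ^ n then 1 / 2 ^ n else 0) *\<^sub>R v k)"
  proof (rule sum.cong[OF refl], rule arg_cong[where f = "\<lambda>a. a *\<^sub>R _"])
    fix k :: nat
    assume k: "k \<in> {..2 ^ n}"
    have cell: "?g s = k \<longleftrightarrow> real k / 2 ^ n \<le> s \<and> s < (real k + 1) / 2 ^ n" if "0 \<le> s" for s
    proof -
      have "0 \<le> s * 2 ^ n"
        using that by simp
      then have "?g s = k \<longleftrightarrow> \<lfloor>s * 2 ^ n\<rfloor> = int k"
        by (metis nat_eq_iff zero_le_floor of_nat_0_le_iff nat_int)
      then show ?thesis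
        by (simp add: floor_eq_iff divide_le_eq less_divide_eq)
    qed
    show "measure unit_interval {s \<in> ?X. ?g s = k} = (if k < 2 ^ n then 1 / 2 ^ n else 0)"
    proof (cases "k < 2 ^ n")
      case True
      then have "Suc k \<le> 2 ^ n"
        by simp
      then have "real k + 1 \<le> 2 ^ n"
        by (metis of_nat_Suc of_nat_le_iff of_nat_numeral of_nat_power add.commute)
      then have "(real k + 1) / 2 ^ n \<le> 1"
        by simp
      then have "s \<le> 1" if "s < (real k + 1) / 2 ^ n" for s
        using that by linarith
      moreover have "0 \<le> s" if "real k / 2 ^ n \<le> s" for s
        using that by (rule order_trans[rotated]) simp
      ultimately have "{s \<in> ?X. ?g s = k} = {real k / 2 ^ n..<(real k + 1) / 2 ^ n}"
        by (intro set_eqI) (use cell in \<open>simp only: mem_Collect_eq atLeastLessThan_iff space_lebesgue_on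
            atLeastAtMost_iff, blast\<close>)
      moreover from \<open>(real k + 1) / 2 ^ n \<le> 1\<close>
      have "{real k / 2 ^ n..<(real k + 1) / 2 ^ n} \<subseteq> {0..1}"
        by (intro order_trans[OF atLeastLessThan_subseteq_atLeastAtMost_iff[THEN iffD2]]) auto
      moreover have "real k / 2 ^ n \<le> (real k + 1) / 2 ^ n"
        by (simp add: divide_right_mono)
      moreover have "(real k + 1) / 2 ^ n - real k / 2 ^ n = 1 / 2 ^ n"
        by (simp add: add_divide_distrib)
      ultimately show ?thesis
        using True by (simp add: measure_restrict_space)
    next
      case False
      then have k: "k = 2 ^ n"
        using k by simp
      have "{s \<in> ?X. ?g s = k} = {1}"
        using cell by (auto simp: k divide_le_eq)
      then show ?thesis
        using False by (simp add: measure_restrict_space)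
    qed
  qed
  also have "\<dots> = (\<Sum>k<2 ^ n. (1 / 2 ^ n) *\<^sub>R v k)"
    by (simp add: lessThan_Suc_atMost[symmetric])
  finally show ?thesis
    by (simp only: scaleR_sum_right)
qed

lemma nn_integral_dyadic:
  fixes v :: "nat \<Rightarrow> 'b::real_normed_vector"
  shows "(\<integral>\<^sup>+s. norm (dyadic n v s) \<partial>unit_interval) = ennreal ((\<Sum>k<2 ^ n. norm (v k)) / 2 ^ n)"
proof -
  have eq: "(\<lambda>s. norm (dyadic n v s)) = dyadic n (\<lambda>k. norm (v k))"
    by (simp add: dyadic_def fun_eq_iff)
  have "ennreal (Bochner_Integration.simple_bochner_integral unit_interval (dyadic n (\<lambda>k. norm (v k)))) =
      (\<integral>\<^sup>+s. dyadic n (\<lambda>k. norm (v k)) s \<partial>unit_interval)"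
    by (rule simple_bochner_integral_eq_nn_integral[OF simple_bochner_integrable_dyadic]) (simp add: dyadic_def)
  then show ?thesis
    unfolding eq[THEN fun_cong] simple_bochner_integral_dyadic by simp
qed

text \<open>Take C closed and U open with C \<subseteq> E \<subseteq> U and U - C small. The compact
  set C has positive distance from the complement of U, so cells shorter than this distance that
  meet C stay inside U. The step function equal to y on these cells is wrong at most on U -
  C.\<close>

lemma L1_close_dyadic_indicator:
  fixes y :: "'b::real_normed_vector"
  assumes E: "E \<in> sets lebesgue" "E \<subseteq> {0..1}" and e: "0 < e"
  obtains n v where "L1_close unit_interval e (\<lambda>s. if s \<in> E then y else 0) (dyadic n v)"
proof -
  \<comment> \<open>\<open>b\<close> replaces \<open>norm y\<close> to avoid division by 0; the 2 in
    \<open>d\<close> accounts for the two pieces U - E and E - C.\<close>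
  define b where "b = norm y + 1"
  have b: "0 < b" "norm y \<le> b"
    unfolding b_def by (simp_all add: add_nonneg_pos)
  define d where "d = e / (2 * b)"
  have d: "0 < d"
    unfolding d_def using e b by simp
  obtain C where C: "closed C" "C \<subseteq> E" "E - C \<in> lmeasurable" "emeasure lebesgue (E - C) < ennreal d"
    by (rule sets_lebesgue_inner_closed[OF E(1) d])
  obtain U where U: "open U" "E \<subseteq> U" "U - E \<in> lmeasurable" "emeasure lebesgue (U - E) < ennreal d"
    by (rule sets_lebesgue_outer_open[OF E(1) d])
  have "C \<subseteq> {0..1}"
    using C(2) E(2) by blast
  then have "compact C"
    using C(1) by (metis compact_Icc closed_Int_compact inf.absorb1)
  moreover have "closed (- U)" "C \<inter> - U = {}"
    using U(1,2) C(2) by auto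
  ultimately obtain r where r: "0 < r" "\<forall>x\<in>C. \<forall>z\<in>- U. r \<le> dist x z"
    using separate_compact_closed[of C "- U"] by blast
  obtain n where n: "(1 / 2) ^ n < r"
    using real_arch_pow_inv[OF r(1), of "1 / 2"] by auto
  define v where "v k = (if \<exists>x\<in>C. nat \<lfloor>x * 2 ^ n\<rfloor> = k then y else 0)" for k
  have eq: "(if s \<in> E then y else 0) = dyadic n v s" if s: "s \<in> {0..1}" "s \<notin> U - C" for s
  proof (cases "s \<in> C")
    case True
    then have "dyadic n v s = y"
      unfolding dyadic_def v_def by auto
    then show ?thesis
      using True C(2) by auto
  next
    case False
    then have sU: "s \<notin> U"
      using s(2) by auto
    have "nat \<lfloor>x * 2 ^ n\<rfloor> \<noteq> nat \<lfloor>s * 2 ^ n\<rfloor>" if x: "x \<in> C" for x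
    proof
      assume "nat \<lfloor>x * 2 ^ n\<rfloor> = nat \<lfloor>s * 2 ^ n\<rfloor>"
      moreover have "0 \<le> x * 2 ^ n" "0 \<le> s * 2 ^ n"
        using x \<open>C \<subseteq> {0..1}\<close> s(1) by auto
      ultimately have "\<bar>x * 2 ^ n - s * 2 ^ n\<bar> < 1"
        by linarith
      then have "\<bar>x - s\<bar> * 2 ^ n < 1"
        by (simp add: left_diff_distrib[symmetric] abs_mult)
      then have "\<bar>x - s\<bar> < (1 / 2) ^ n"
        by (simp add: power_divide less_divide_eq)
      moreover have "r \<le> \<bar>x - s\<bar>"
        using r(2) x sU by (auto simp: dist_real_def)
      ultimately show False
        using n by linarith
    qed
    then have "dyadic n v s = 0"
      unfolding dyadic_def v_def by auto
    then show ?thesis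
      using sU U(2) by auto
  qed
  have meas: "(U - C) \<inter> {0..1} \<in> sets lebesgue"
    using U(1) C(1) by (intro sets.Int sets.Diff) auto
  have small: "emeasure lebesgue ((U - C) \<inter> {0..1}) \<le> ennreal (2 * d)"
  proof -
    have "emeasure lebesgue ((U - C) \<inter> {0..1}) \<le> emeasure lebesgue ((U - E) \<union> (E - C))"
      using C(3) U(3) by (intro emeasure_mono) (auto dest: fmeasurableD)
    also have "\<dots> \<le> emeasure lebesgue (U - E) + emeasure lebesgue (E - C)"
      by (rule emeasure_subadditive[OF fmeasurableD[OF U(3)] fmeasurableD[OF C(3)]])
    also have "\<dots> \<le> ennreal d + ennreal d"
      using C(4) U(4) by (intro add_mono) auto
    also have "\<dots> = ennreal (2 * d)"
      using d by (simp flip: ennreal_plus)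
    finally show ?thesis .
  qed
  have "L1_close unit_interval e (\<lambda>s. if s \<in> E then y else 0) (dyadic n v)"
  proof (rule L1_closeI[where h = "\<lambda>s. ennreal (norm y) * indicator ((U - C) \<inter> {0..1}) s"])
    have sets: "(U - C) \<inter> {0..1} \<in> sets unit_interval"
      using meas by (simp add: sets_restrict_space_iff)
    then show "(\<lambda>s. ennreal (norm y) * indicator ((U - C) \<inter> {0..1}) s) \<in> borel_measurable unit_interval"
      by measurable
    show "AE s in unit_interval. ennreal (norm ((if s \<in> E then y else 0) - dyadic n v s))
        \<le> ennreal (norm y) * indicator ((U - C) \<inter> {0..1}) s"
      using AE_space
    proof eventually_elim
      case (elim s)
      have "norm ((if s \<in> E then y else 0) - dyadic n v s) \<le> norm y"
        by (simp add: dyadic_def v_def)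
      then show ?case
        using eq[of s] elim by (cases "s \<in> U - C") (simp_all add: ennreal_leI)
    qed
    have "(\<integral>\<^sup>+s. ennreal (norm y) * indicator ((U - C) \<inter> {0..1}) s \<partial>unit_interval) =
        ennreal (norm y) * emeasure unit_interval ((U - C) \<inter> {0..1})"
      by (rule nn_integral_cmult_indicator[OF sets])
    also have "emeasure unit_interval ((U - C) \<inter> {0..1}) = emeasure lebesgue ((U - C) \<inter> {0..1})"
      by (rule emeasure_restrict_space) auto
    also have "ennreal (norm y) * emeasure lebesgue ((U - C) \<inter> {0..1}) \<le> ennreal (norm y) * ennreal (2 * d)"
      by (rule mult_left_mono[OF small]) simp
    also have "\<dots> = ennreal (norm y * (2 * d))"
      by (simp add: ennreal_mult')
    also have "\<dots> \<le> ennreal e"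
    proof (rule ennreal_leI)
      have "norm y / b \<le> 1"
        using b by simp
      moreover have "norm y * (2 * d) = e * (norm y / b)"
        by (simp add: d_def)
      ultimately have "norm y * (2 * d) \<le> e * 1"
        using e by (simp only: mult_left_mono less_imp_le)
      then show "norm y * (2 * d) \<le> e"
        by simp
    qed
    finally show "(\<integral>\<^sup>+s. ennreal (norm y) * indicator ((U - C) \<inter> {0..1}) s \<partial>unit_interval) \<le> ennreal e" .
  qed
  then show thesis
    by (rule that)
qed

lemma L1_close_dyadic_simple_function:
  fixes s :: "real \<Rightarrow> 'b::real_normed_vector"
  assumes s: "simple_function unit_interval s" and e: "0 < e"
  obtains n v where "L1_close unit_interval e s (dyadic n v)"
proof -
  have partial: "\<exists>n v. L1_close unit_interval e (\<lambda>t. \<Sum>y\<in>F. if t \<in> s -` {y} \<inter> {0..1} then y else 0) (dyadic n v)"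
    if "finite F" "F \<subseteq> s ` {0..1}" "0 < e" for F e
    using that
  proof (induction F arbitrary: e rule: finite_induct)
    case empty
    have "L1_close unit_interval e (\<lambda>t. 0) (dyadic 0 (\<lambda>k. 0 :: 'b))"
      using empty.prems(2) by (intro L1_close_uniform) (simp_all add: dyadic_def emeasure_restrict_space)
    then show ?case
      by auto
  next
    case (insert y F)
    have "s -` {y} \<inter> {0..1} \<in> sets unit_interval"
      using s insert.prems(1) unfolding simple_function_def by auto
    then have E: "s -` {y} \<inter> {0..1} \<in> sets lebesgue"
      by (simp add: sets_restrict_space_iff)
    have half: "0 < e / 2"
      using insert.prems(2) by simp
    obtain n v where 1: "L1_close unit_interval (e / 2) (\<lambda>t. if t \<in> s -` {y} \<inter> {0..1} then y else 0) (dyadic n v)"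
      by (rule L1_close_dyadic_indicator[OF E Int_lower2 half])
    obtain m w where 2: "L1_close unit_interval (e / 2)
        (\<lambda>t. \<Sum>y\<in>F. if t \<in> s -` {y} \<inter> {0..1} then y else 0) (dyadic m w)"
      using insert.IH[OF _ half] insert.prems(1) by auto
    \<comment> \<open>On a common refinement the sum of the two step functions is again a step
      function.\<close>
    define k where "k = max n m"
    obtain v' w' where "dyadic n v = dyadic k v'" "dyadic m w = dyadic k w'"
      using dyadic_refine[of n k v] dyadic_refine[of m k w] unfolding k_def by auto
    then have "(\<lambda>t. dyadic n v t + dyadic m w t) = dyadic k (\<lambda>l. v' l + w' l)"
      by (simp add: dyadic_def fun_eq_iff)
    moreover have "L1_close unit_interval (e / 2 + e / 2)
        (\<lambda>t. (if t \<in> s -` {y} \<inter> {0..1} then y else 0) + (\<Sum>y\<in>F. if t \<in> s -` {y} \<inter> {0..1} then y else 0))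
        (\<lambda>t. dyadic n v t + dyadic m w t)"
      using half by (intro L1_close_add[OF 1 2]) auto
    ultimately have "L1_close unit_interval e
        (\<lambda>t. \<Sum>y\<in>insert y F. if t \<in> s -` {y} \<inter> {0..1} then y else 0) (dyadic k (\<lambda>l. v' l + w' l))"
      using insert.hyps by simp
    then show ?case
      by blast
  qed
  have fin: "finite (s ` {0..1})"
    using s by (simp add: simple_function_def)
  obtain n v where nv: "L1_close unit_interval e
      (\<lambda>t. \<Sum>y\<in>s ` {0..1}. if t \<in> s -` {y} \<inter> {0..1} then y else 0) (dyadic n v)"
    using partial[OF fin order_refl e] by blast
  have "L1_close unit_interval (1 * e) s (dyadic n v)"
  proof (rule L1_close_lipschitz[OF nv])
    fix t
    assume "t \<in> space unit_interval"
    then have t: "t \<in> {0..1}"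
      by simp
    have "(\<Sum>y\<in>s ` {0..1}. if t \<in> s -` {y} \<inter> {0..1} then y else 0) = (\<Sum>y\<in>s ` {0..1}. if s t = y then y else 0)"
      using t by (intro sum.cong) auto
    also have "\<dots> = s t"
      using t fin by (subst sum.delta') auto
    finally show "norm (s t - dyadic n v t) \<le>
        1 * norm ((\<Sum>y\<in>s ` {0..1}. if t \<in> s -` {y} \<inter> {0..1} then y else 0) - dyadic n v t)"
      by simp
  qed simp
  then show thesis
    using that by simp
qed

lemma L1_close_dyadic:
  fixes u :: "real \<Rightarrow> 'b::real_normed_vector"
  assumes "strongly_measurable unit_interval u" "(\<lambda>x. norm (u x)) \<in> borel_measurable unit_interval"
    and "(\<integral>\<^sup>+x. norm (u x) \<partial>unit_interval) < \<infinity>" and e: "0 < e"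
  obtains n v where "L1_close unit_interval e u (dyadic n v)"
proof -
  have half: "0 < e / 2"
    using e by simp
  obtain s where s: "simple_function unit_interval s" "L1_close unit_interval (e / 2) u s"
    by (rule L1_close_simple_function[OF assms(1-3) half])
  obtain n v where "L1_close unit_interval (e / 2) s (dyadic n v)"
    by (rule L1_close_dyadic_simple_function[OF s(1) half])
  from L1_close_trans[OF s(2) this] half have "L1_close unit_interval e u (dyadic n v)"
    by simp
  then show thesis
    by (rule that)
qed

text \<open>Rounding the time to the dyadic grid makes the approximants simple: they are built from
  finitely many times and a simple function. Joint sequential continuity of \<open>F\<close> gives
  convergence wherever the approximants of \<open>u\<close> converge.\<close>

lemma strongly_measurable_compose:
  assumes u: "strongly_measurable unit_interval u"
    and F: "\<And>a s b v. (\<And>i. a i \<in> {0..1}) \<Longrightarrow> a \<longlonglongrightarrow> s \<Longrightarrow> s \<in> {0..1} \<Longrightarrow> b \<longlonglongrightarrow> v \<Longrightarrow>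
      (\<lambda>i. F (a i) (b i)) \<longlonglongrightarrow> F s v"
  shows "strongly_measurable unit_interval (\<lambda>s. F s (u s))"
proof -
  obtain s where s: "\<And>i. simple_function unit_interval (s i)"
    and lim: "AE t in unit_interval. (\<lambda>i. s i t) \<longlonglongrightarrow> u t"
    using u unfolding strongly_measurable_def by blast
  let ?a = "\<lambda>i t. real (nat \<lfloor>t * 2 ^ i\<rfloor>) / 2 ^ i"
  have "simple_function unit_interval (\<lambda>t. F (?a i t) (s i t))" for i
    by (rule simple_function_compose2[OF simple_function_nat_floor s, where h = "\<lambda>k y. F (real k / 2 ^ i) y"])
  moreover have "AE t in unit_interval. (\<lambda>i. F (?a i t) (s i t)) \<longlonglongrightarrow> F t (u t)"
    using lim AE_space
  proof eventually_elim
    case (elim t)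
    then have t: "t \<in> {0..1}"
      by simp
    show ?case
    proof (rule F[OF _ _ t elim(1)])
      show "(\<lambda>i. ?a i t) \<longlonglongrightarrow> t"
        using t by (intro nat_floor_dyadic_tendsto) simp
      show "?a i t \<in> {0..1}" for i
      proof -
        have "?a i t \<le> 1"
          using t by (intro order_trans[OF real_nat_floor_dyadic_le]) simp
        moreover have "0 \<le> ?a i t"
          by (rule divide_nonneg_nonneg) simp_all
        ultimately show ?thesis
          by (simp only: atLeastAtMost_iff)
      qed
    qed
  qed
  ultimately show ?thesis
    unfolding strongly_measurable_def by (intro exI[of _ "\<lambda>i t. F (?a i t) (s i t)"]) blast
qed

section \<open>Admissibility\<close>

text \<open>For p \<ge> 1 one has |u| \<le> 1 + |u|^p, and [0,1] has measure 1, so \<open>u\<close>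
  is integrable there. Measurability of |u| is recovered from that of |u|^p by taking the power
  1/p.\<close>

lemma Lp_function_unit_interval:
  assumes p: "1 \<le> p" and u: "Lp_function p (lebesgue_on {0..}) u"
  shows "strongly_measurable unit_interval u"
    and "(\<lambda>x. norm (u x)) \<in> borel_measurable unit_interval"
    and "(\<integral>\<^sup>+x. norm (u x) \<partial>unit_interval) < \<infinity>"
proof -
  let ?M = "lebesgue_on {0::real..}"
  have restrict: "unit_interval = restrict_space ?M {0..1}"
  proof -
    have "restrict_space ?M {0..1} = lebesgue_on ({0..} \<inter> {0..1})"
      by (rule restrict_restrict_space) simp_all
    also have "{0::real..} \<inter> {0..1} = {0..1}"
      by auto
    finally show ?thesis ..
  qed
  have sub: "{0..1} \<inter> space ?M \<in> sets ?M"
    by (simp add: sets_restrict_space_iff)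
  obtain s where s: "\<And>i. simple_function ?M (s i)" and lim: "AE x in ?M. (\<lambda>i. s i x) \<longlonglongrightarrow> u x"
    using u unfolding Lp_function_def strongly_measurable_def by blast
  have "simple_function unit_interval (s i)" for i
  proof -
    have "finite (s i ` {0..})" and meas: "s i \<in> ?M \<rightarrow>\<^sub>M count_space UNIV"
      using s[of i] by (simp_all add: simple_function_eq_measurable)
    then have "finite (s i ` {0..1})"
      by (intro finite_subset[of "s i ` {0..1}" "s i ` {0..}"] image_mono) auto
    moreover have "s i \<in> unit_interval \<rightarrow>\<^sub>M count_space UNIV"
      unfolding restrict by (rule measurable_restrict_space1[OF meas])
    ultimately show ?thesis
      by (simp add: simple_function_eq_measurable)
  qed
  moreover have "AE x in unit_interval. (\<lambda>i. s i x) \<longlonglongrightarrow> u x"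
    unfolding restrict AE_restrict_space_iff[OF sub] using lim by eventually_elim simp
  ultimately show "strongly_measurable unit_interval u"
    unfolding strongly_measurable_def by blast
  have int: "integrable ?M (\<lambda>s. norm (u s) powr p)"
    using u by (simp add: Lp_function_def)
  then have meas: "(\<lambda>s. norm (u s) powr p) \<in> borel_measurable ?M"
    by (rule borel_measurable_integrable)
  then have "(\<lambda>s. (norm (u s) powr p) powr (1 / p)) \<in> borel_measurable ?M"
    by measurable
  then have "(\<lambda>s. norm (u s)) \<in> borel_measurable ?M"
    using p by (simp add: powr_powr)
  then show "(\<lambda>s. norm (u s)) \<in> borel_measurable unit_interval"
    unfolding restrict by (rule measurable_restrict_space1)
  have meas': "(\<lambda>s. norm (u s) powr p) \<in> borel_measurable unit_interval"
    unfolding restrict by (rule measurable_restrict_space1[OF meas])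
  have le: "norm (u s) \<le> 1 + norm (u s) powr p" for s
  proof (cases "norm (u s) \<le> 1")
    case False
    then have "norm (u s) powr 1 \<le> norm (u s) powr p"
      using p by (intro powr_mono) auto
    then show ?thesis
      using False by simp
  qed (simp add: add_increasing2)
  have "(\<integral>\<^sup>+s. norm (u s) \<partial>unit_interval) \<le> (\<integral>\<^sup>+s. 1 + ennreal (norm (u s) powr p) \<partial>unit_interval)"
  proof (rule nn_integral_mono)
    show "ennreal (norm (u s)) \<le> 1 + ennreal (norm (u s) powr p)" for s
      using ennreal_leI[OF le[of s]] by (simp add: ennreal_plus)
  qed
  also have "\<dots> = (\<integral>\<^sup>+s. 1 \<partial>unit_interval) + (\<integral>\<^sup>+s. norm (u s) powr p \<partial>unit_interval)"
    using meas' by (intro nn_integral_add) simp_all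
  also have "\<dots> < \<infinity>"
  proof -
    have "(\<integral>\<^sup>+s. norm (u s) powr p \<partial>unit_interval) \<le> (\<integral>\<^sup>+s. norm (u s) powr p \<partial>?M)"
      unfolding restrict nn_integral_restrict_space[OF sub]
      by (rule nn_integral_mono) (simp add: indicator_def)
    also have "\<dots> < \<infinity>"
      using int by (simp add: integrable_iff_bounded)
    finally show ?thesis
      by (simp add: emeasure_unit_interval[unfolded space_lebesgue_on])
  qed
  finally show "(\<integral>\<^sup>+s. norm (u s) \<partial>unit_interval) < \<infinity>" .
qed

section \<open>Convergence of the control integrals\<close>

context positive_extrapolation
begin

lemma S_tendsto:
  assumes a: "a \<longlonglongrightarrow> s" "\<And>i. 0 \<le> a i" "0 \<le> s" and b: "b \<longlonglongrightarrow> y"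
  shows "(\<lambda>i. S (a i) (b i)) \<longlonglongrightarrow> S s y"
proof -
  have "(\<lambda>i. S (a i) y) \<longlonglongrightarrow> S s y"
  proof (rule tendstoI)
    fix e :: real
    assume "0 < e"
    then obtain d where d: "0 < d" "\<And>s t. 0 \<le> s \<Longrightarrow> 0 \<le> t \<Longrightarrow> \<bar>s - t\<bar> < d \<Longrightarrow> norm (S s y - S t y) < e"
      by (rule S_uniformly_continuous[where y = y]) (rule that; blast)
    have "\<forall>\<^sub>F i in sequentially. dist (a i) s < d"
      by (rule tendstoD[OF a(1) d(1)])
    then show "\<forall>\<^sub>F i in sequentially. dist (S (a i) y) (S s y) < e"
      by eventually_elim (simp add: dist_norm d(2) a)
  qed
  moreover have "(\<lambda>i. S (a i) (b i) - S (a i) y) \<longlonglongrightarrow> 0"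
  proof (rule Lim_null_comparison)
    show "\<forall>\<^sub>F i in sequentially. norm (S (a i) (b i) - S (a i) y) \<le> N * norm (b i - y)"
      by (rule always_eventually) (simp add: S_bound S_diff_right[symmetric])
    have "(\<lambda>i. b i - y) \<longlonglongrightarrow> 0"
      using b by (simp only: LIM_zero_iff)
    then show "(\<lambda>i. N * norm (b i - y)) \<longlonglongrightarrow> 0"
      by (rule tendsto_mult_right_zero[OF tendsto_norm_zero])
  qed
  ultimately have "(\<lambda>i. (S (a i) (b i) - S (a i) y) + S (a i) y) \<longlonglongrightarrow> 0 + S s y"
    by (intro tendsto_add)
  then show ?thesis
    by simp
qed

text \<open>The integrand frozen on each cell at its left end. Its integral is the Riemann sum,
  which makes Riemann sums legitimate approximants in
  \<open>has_strong_bochner_integral\<close>.\<close>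

definition riemann_step :: "nat \<Rightarrow> (real \<Rightarrow> 'y) \<Rightarrow> real \<Rightarrow> 'y" where
  "riemann_step m f = dyadic m (\<lambda>k. S (1 - real k / 2 ^ m) (f (real k / 2 ^ m)))"

lemma riemann_step_integral:
  "Bochner_Integration.simple_bochner_integral unit_interval (riemann_step m f) = riemann m f"
  unfolding riemann_step_def simple_bochner_integral_dyadic riemann_def ..

text \<open>A step control takes finitely many values on [0,1], each with a uniformly continuous
  orbit. For m \<ge> n the control is constant on the cells of level m, so only the time in the
  orbit is rounded.\<close>

lemma riemann_step_uniform:
  assumes e: "0 < e"
  shows "\<forall>\<^sub>F m in sequentially. \<forall>s\<in>{0..1}. norm (S (1 - s) (dyadic n v s) - riemann_step m (dyadic n v) s) \<le> e"
proof -
  have unif: "\<forall>\<^sub>F m in sequentially. \<forall>s\<in>{0..1}. norm (S (1 - s) (v l) - S (1 - real (nat \<lfloor>s * 2 ^ m\<rfloor>) / 2 ^ m) (v l)) \<le> e"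
    for l
  proof -
    obtain d where d: "0 < d"
      "\<And>s t. 0 \<le> s \<Longrightarrow> 0 \<le> t \<Longrightarrow> \<bar>s - t\<bar> < d \<Longrightarrow> norm (S s (v l) - S t (v l)) < e"
      by (rule S_uniformly_continuous[OF e, of "v l"]) (rule that; blast)
    have "(\<lambda>m. (1 / 2) ^ m :: real) \<longlonglongrightarrow> 0"
      by (rule LIMSEQ_power_zero) simp
    then have "\<forall>\<^sub>F m in sequentially. (1 / 2) ^ m < d"
      by (rule order_tendstoD(2)[OF _ d(1)])
    then show ?thesis
    proof eventually_elim
      case (elim m)
      show ?case
      proof
        fix s :: real
        assume s: "s \<in> {0..1}"
        let ?a = "real (nat \<lfloor>s * 2 ^ m\<rfloor>) / 2 ^ m"
        have "0 \<le> s * 2 ^ m"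
          using s by simp
        then have "\<bar>s * 2 ^ m - real (nat \<lfloor>s * 2 ^ m\<rfloor>)\<bar> < 1"
          by linarith
        then have "\<bar>s * 2 ^ m - real (nat \<lfloor>s * 2 ^ m\<rfloor>)\<bar> / 2 ^ m < 1 / 2 ^ m"
          by (rule divide_strict_right_mono) simp
        moreover have "s - ?a = (s * 2 ^ m - real (nat \<lfloor>s * 2 ^ m\<rfloor>)) / 2 ^ m"
          by (simp add: diff_divide_distrib)
        ultimately have "\<bar>s - ?a\<bar> < d"
          using elim by (simp add: power_divide)
        then have "\<bar>(1 - s) - (1 - ?a)\<bar> < d"
          by (simp only: abs_minus_commute diff_diff_eq2 add_diff_cancel_left' diff_add_eq diff_diff_add)
        moreover have "0 \<le> 1 - ?a"
          using s by (simp only: diff_ge_0_iff_ge) (rule order_trans[OF real_nat_floor_dyadic_le], simp)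
        moreover have "0 \<le> 1 - s"
          using s by simp
        ultimately show "norm (S (1 - s) (v l) - S (1 - ?a) (v l)) \<le> e"
          by (intro less_imp_le[OF d(2)])
      qed
    qed
  qed
  have "\<forall>\<^sub>F m in sequentially. \<forall>l\<in>{..2 ^ n}. \<forall>s\<in>{0..1}.
      norm (S (1 - s) (v l) - S (1 - real (nat \<lfloor>s * 2 ^ m\<rfloor>) / 2 ^ m) (v l)) \<le> e"
    by (rule eventually_ball_finite[OF finite_atMost ballI[OF unif]])
  with eventually_ge_at_top[of n] show ?thesis
  proof eventually_elim
    case (elim m)
    show ?case
    proof
      fix s :: real
      assume s: "s \<in> {0..1}"
      let ?k = "nat \<lfloor>s * 2 ^ m\<rfloor>"
      have "dyadic n v (real ?k / 2 ^ m) = dyadic n v s"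
        unfolding dyadic_grid[OF elim(1)] using nat_floor_dyadic_refine[OF elim(1), of s] by (simp only: dyadic_def)
      then have "riemann_step m (dyadic n v) s = S (1 - real ?k / 2 ^ m) (v (nat \<lfloor>s * 2 ^ n\<rfloor>))"
        unfolding riemann_step_def dyadic_def[of m] by (simp only: dyadic_def[of n])
      \<comment> \<open>The index 2^n is attained at s = 1, hence the closed index range.\<close>
      moreover have "nat \<lfloor>s * 2 ^ n\<rfloor> \<in> {..2 ^ n}"
        using s by (simp only: atMost_iff atLeastAtMost_iff nat_floor_unit_interval)
      ultimately show "norm (S (1 - s) (dyadic n v s) - riemann_step m (dyadic n v) s) \<le> e"
        using elim(2) s unfolding dyadic_def[of n] by (simp only:)
    qed
  qed
qed

lemma control_integral:
  fixes B :: "'u::banach_lattice \<Rightarrow>\<^sub>L 'y"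
  assumes B: "positive_control j B"
    and u: "strongly_measurable unit_interval u" "(\<lambda>s. norm (u s)) \<in> borel_measurable unit_interval"
      "(\<integral>\<^sup>+s. norm (u s) \<partial>unit_interval) < \<infinity>"
  shows "\<exists>x. has_strong_bochner_integral unit_interval (\<lambda>s. S (1 - s) (B (u s))) (j x)"
proof -
  define \<epsilon> :: "nat \<Rightarrow> real" where "\<epsilon> i = 1 / real (Suc i)" for i
  have \<epsilon>: "0 < \<epsilon> i" for i
    by (simp add: \<epsilon>_def)
  have \<epsilon>_lim: "\<epsilon> \<longlonglongrightarrow> 0"
    unfolding \<epsilon>_def[abs_def] using LIMSEQ_inverse_real_of_nat by (simp only: inverse_eq_divide)
  define C where "C = 2 * (norm K * N / c * norm B)"
  have C: "0 \<le> C"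
    unfolding C_def using N_nonneg c_pos by simp
  have "\<exists>n v. L1_close unit_interval (\<epsilon> i) u (dyadic n v)" for i
    by (rule L1_close_dyadic[OF u \<epsilon>[of i]]) blast
  then obtain n v where nv: "\<And>i. L1_close unit_interval (\<epsilon> i) u (dyadic (n i) (v i))"
    by metis
  have "\<exists>x. (\<lambda>m. riemann m (\<lambda>s. B (dyadic (n i) (v i) s))) \<longlonglongrightarrow> j x" for i
    by (rule riemann_positive_control[OF B, of "n i" "v i"]) blast
  then obtain x where x: "\<And>i. (\<lambda>m. riemann m (\<lambda>s. B (dyadic (n i) (v i) s))) \<longlonglongrightarrow> j (x i)"
    by metis
  have dist_x: "norm (x i - x k) \<le> C * (\<epsilon> i + \<epsilon> k)" for i k
  proof -
    \<comment> \<open>On a common grid the difference of two step controls is one step control, to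
      which the norm estimate applies.\<close>
    define l where "l = max (n i) (n k)"
    obtain a b where ab: "dyadic (n i) (v i) = dyadic l a" "dyadic (n k) (v k) = dyadic l b"
      using dyadic_refine[of "n i" l "v i"] dyadic_refine[of "n k" l "v k"] unfolding l_def by auto
    define w where "w t = a t - b t" for t
    have w: "dyadic l w s = dyadic (n i) (v i) s - dyadic (n k) (v k) s" for s
      unfolding ab by (simp add: dyadic_def w_def)
    obtain z where z: "(\<lambda>m. riemann m (\<lambda>s. B (dyadic l w s))) \<longlonglongrightarrow> j z"
      "norm z \<le> C * ((\<Sum>t<2 ^ l. norm (w t)) / 2 ^ l)"
      unfolding C_def by (rule riemann_positive_control[OF B, of l w])
    have "(\<lambda>m. riemann m (\<lambda>s. B (dyadic l w s))) \<longlonglongrightarrow> j (x i - x k)"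
      unfolding w blinfun.diff_right riemann_diff linear_diff[OF j_linear] by (rule tendsto_diff[OF x x])
    \<comment> \<open>The estimate concerns some \<open>z\<close>; uniqueness of limits and
      injectivity of \<open>j\<close> identify it.\<close>
    from j_inject[OF LIMSEQ_unique[OF this z(1)]]
    have z_eq: "x i - x k = z" .
    have "L1_close unit_interval (\<epsilon> i + \<epsilon> k) (dyadic l w) (\<lambda>s. 0)"
    proof (rule L1_close_combine[OF nv nv])
      show "norm (dyadic l w s - 0) \<le> norm (u s - dyadic (n i) (v i) s) + norm (u s - dyadic (n k) (v k) s)" for s
        using norm_triangle_ineq4[of "u s - dyadic (n k) (v k) s" "u s - dyadic (n i) (v i) s"]
        by (simp add: w add.commute)
    qed (use \<epsilon> in \<open>simp_all add: less_imp_le\<close>)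
    from L1_close_nn_integral[OF this]
    have "ennreal ((\<Sum>t<2 ^ l. norm (w t)) / 2 ^ l) \<le> ennreal (\<epsilon> i + \<epsilon> k)"
      by (simp only: nn_integral_dyadic diff_zero)
    moreover have "0 \<le> \<epsilon> i + \<epsilon> k"
      using \<epsilon>[of i] \<epsilon>[of k] by linarith
    ultimately have "(\<Sum>t<2 ^ l. norm (w t)) / 2 ^ l \<le> \<epsilon> i + \<epsilon> k"
      by (simp only: ennreal_le_iff)
    then show ?thesis
      unfolding z_eq using order_trans[OF z(2) mult_left_mono[OF _ C]] by blast
  qed
  have "Cauchy x"
  proof (rule metric_CauchyI)
    fix e :: real
    assume e: "0 < e"
    have "(\<lambda>i. C * \<epsilon> i) \<longlonglongrightarrow> 0"
      by (rule tendsto_mult_right_zero[OF \<epsilon>_lim])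
    then have "\<forall>\<^sub>F i in sequentially. C * \<epsilon> i < e / 2"
      by (rule order_tendstoD(2)) (use e in simp)
    then obtain i0 where i0: "\<And>i. i0 \<le> i \<Longrightarrow> C * \<epsilon> i < e / 2"
      by (auto simp: eventually_sequentially)
    have "dist (x i) (x k) < e" if "i0 \<le> i" "i0 \<le> k" for i k
      using dist_x[of i k] i0[OF that(1)] i0[OF that(2)] by (simp add: dist_norm distrib_left)
    then show "\<exists>i0. \<forall>i\<ge>i0. \<forall>k\<ge>i0. dist (x i) (x k) < e"
      by blast
  qed
  then obtain y where y: "x \<longlonglongrightarrow> y"
    by (auto simp: Cauchy_convergent_iff convergent_def)
  have step: "\<exists>m. (\<forall>s\<in>{0..1}. norm (S (1 - s) (B (dyadic (n i) (v i) s)) -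
      riemann_step m (\<lambda>s. B (dyadic (n i) (v i) s)) s) \<le> \<epsilon> i) \<and>
      norm (riemann m (\<lambda>s. B (dyadic (n i) (v i) s)) - j (x i)) < \<epsilon> i" for i
  proof -
    have eq: "(\<lambda>s. B (dyadic (n i) (v i) s)) = dyadic (n i) (\<lambda>l. B (v i l))"
      by (simp add: dyadic_def fun_eq_iff)
    have "\<forall>\<^sub>F m in sequentially. \<forall>s\<in>{0..1}. norm (S (1 - s) (B (dyadic (n i) (v i) s)) -
        riemann_step m (\<lambda>s. B (dyadic (n i) (v i) s)) s) \<le> \<epsilon> i"
      using riemann_step_uniform[OF \<epsilon>[of i], of "n i" "\<lambda>l. B (v i l)"] unfolding eq[symmetric]
      by (simp only: eq fun_cong[OF eq])
    moreover have "\<forall>\<^sub>F m in sequentially. norm (riemann m (\<lambda>s. B (dyadic (n i) (v i) s)) - j (x i)) < \<epsilon> i"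
      using tendstoD[OF x \<epsilon>[of i], of i] by (simp only: dist_norm)
    ultimately show ?thesis
      by (intro eventually_happens'[OF sequentially_bot] eventually_conj)
  qed
  then obtain m where m: "\<And>i s. s \<in> {0..1} \<Longrightarrow> norm (S (1 - s) (B (dyadic (n i) (v i) s)) -
      riemann_step (m i) (\<lambda>s. B (dyadic (n i) (v i) s)) s) \<le> \<epsilon> i"
    "\<And>i. norm (riemann (m i) (\<lambda>s. B (dyadic (n i) (v i) s)) - j (x i)) < \<epsilon> i"
    by metis
  define \<sigma> where "\<sigma> i = riemann_step (m i) (\<lambda>s. B (dyadic (n i) (v i) s))" for i
  have "has_strong_bochner_integral unit_interval (\<lambda>s. S (1 - s) (B (u s))) (j y)"
    unfolding has_strong_bochner_integral_def
  proof (intro conjI exI[of _ \<sigma>] allI)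
    show "strongly_measurable unit_interval (\<lambda>s. S (1 - s) (B (u s)))"
    proof (rule strongly_measurable_compose[OF u(1)])
      fix a s b v
      assume *: "\<And>i. a i \<in> {0..1::real}" "a \<longlonglongrightarrow> s" "s \<in> {0..1}" "b \<longlonglongrightarrow> (v::'u)"
      have "(\<lambda>i. B (b i)) \<longlonglongrightarrow> B v"
        by (rule bounded_linear.tendsto[OF blinfun.bounded_linear_right *(4)])
      moreover have "(\<lambda>i. 1 - a i) \<longlonglongrightarrow> 1 - s"
        by (rule tendsto_diff[OF tendsto_const *(2)])
      ultimately show "(\<lambda>i. S (1 - a i) (B (b i))) \<longlonglongrightarrow> S (1 - s) (B v)"
        using *(1,3) by (intro S_tendsto) simp_all
    qed
    show "Bochner_Integration.simple_bochner_integrable unit_interval (\<sigma> i)" for i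
      unfolding \<sigma>_def riemann_step_def by (rule simple_bochner_integrable_dyadic)
    show "(\<lambda>i. \<integral>\<^sup>+s. ennreal (norm (S (1 - s) (B (u s)) - \<sigma> i s)) \<partial>unit_interval) \<longlonglongrightarrow> 0"
    proof (rule tendsto_sandwich[OF always_eventually always_eventually tendsto_const])
      show "\<forall>i. (\<integral>\<^sup>+s. ennreal (norm (S (1 - s) (B (u s)) - \<sigma> i s)) \<partial>unit_interval)
          \<le> ennreal ((N * norm B + 1) * \<epsilon> i)"
      proof
        fix i
        have "L1_close unit_interval (N * norm B * \<epsilon> i) (\<lambda>s. S (1 - s) (B (u s)))
            (\<lambda>s. S (1 - s) (B (dyadic (n i) (v i) s)))"
        proof (rule L1_close_lipschitz[OF nv])
          fix s
          have "norm (S (1 - s) (B (u s)) - S (1 - s) (B (dyadic (n i) (v i) s))) \<le>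
              N * (norm B * norm (u s - dyadic (n i) (v i) s))"
            unfolding S_diff_right[symmetric] blinfun.diff_right[symmetric]
            by (rule order_trans[OF S_bound mult_left_mono[OF norm_blinfun N_nonneg]])
          then show "norm (S (1 - s) (B (u s)) - S (1 - s) (B (dyadic (n i) (v i) s))) \<le>
              N * norm B * norm (u s - dyadic (n i) (v i) s)"
            by (simp only: mult.assoc)
        qed (use N_nonneg in simp)
        moreover have "L1_close unit_interval (\<epsilon> i) (\<lambda>s. S (1 - s) (B (dyadic (n i) (v i) s))) (\<sigma> i)"
          unfolding \<sigma>_def
          by (rule L1_close_uniform) (use emeasure_unit_interval m(1) in \<open>simp_all only: space_lebesgue_on order_refl\<close>)
        ultimately have "L1_close unit_interval (N * norm B * \<epsilon> i + \<epsilon> i) (\<lambda>s. S (1 - s) (B (u s))) (\<sigma> i)"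
          by (rule L1_close_trans) (use N_nonneg \<epsilon>[of i] in simp_all)
        from L1_close_nn_integral[OF this]
        show "(\<integral>\<^sup>+s. ennreal (norm (S (1 - s) (B (u s)) - \<sigma> i s)) \<partial>unit_interval)
            \<le> ennreal ((N * norm B + 1) * \<epsilon> i)"
          by (simp only: distrib_right mult_1)
      qed
      have "(\<lambda>i. ennreal ((N * norm B + 1) * \<epsilon> i)) \<longlonglongrightarrow> ennreal 0"
        by (rule tendsto_ennrealI[OF tendsto_mult_right_zero[OF \<epsilon>_lim]])
      then show "(\<lambda>i. ennreal ((N * norm B + 1) * \<epsilon> i)) \<longlonglongrightarrow> 0"
        by simp
    qed simp
    have "(\<lambda>i. riemann (m i) (\<lambda>s. B (dyadic (n i) (v i) s)) - j (x i)) \<longlonglongrightarrow> 0"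
      by (rule Lim_null_comparison[OF always_eventually \<epsilon>_lim]) (use m(2) in \<open>simp add: less_imp_le\<close>)
    from tendsto_add[OF this j_tendsto[OF y]]
    show "(\<lambda>i. Bochner_Integration.simple_bochner_integral unit_interval (\<sigma> i)) \<longlonglongrightarrow> j y"
      unfolding \<sigma>_def riemann_step_integral by simp
  qed
  then show ?thesis
    by blast
qed

definition rescaled_S :: "real \<Rightarrow> real \<Rightarrow> 'y \<Rightarrow>\<^sub>L 'y" where
  "rescaled_S \<omega> t = L o\<^sub>L rescaled_T \<omega> t o\<^sub>L K"

lemma rescaled_S_apply: "rescaled_S \<omega> t y = exp (\<omega> * t) *\<^sub>R S t y"
  by (simp add: rescaled_S_def rescaled_T_apply S_def blinfun.scaleR_right)

lemma extrapolated_semigroup_rescaled: "extrapolated_semigroup j (rescaled_T \<omega>) (rescaled_S \<omega>)"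
  unfolding extrapolated_semigroup_def C0_semigroup_def
proof (intro conjI allI impI)
  show "rescaled_S \<omega> 0 = id_blinfun"
    by (rule blinfun_eqI) (simp add: rescaled_S_apply S_0)
  show "rescaled_S \<omega> (s + t) = rescaled_S \<omega> s o\<^sub>L rescaled_S \<omega> t" if "0 \<le> s" "0 \<le> t" for s t
    by (rule blinfun_eqI) (simp add: rescaled_S_apply S_add that distrib_left exp_add S_scale_right)
  have "((\<lambda>t. exp (\<omega> * t)) \<longlongrightarrow> exp (\<omega> * 0)) (at_right 0)"
    by (intro tendsto_intros)
  then show "((\<lambda>t. rescaled_S \<omega> t y) \<longlongrightarrow> y) (at_right 0)" for y
    unfolding rescaled_S_apply using tendsto_scaleR[OF _ S_tendsto_id, of "\<lambda>t. exp (\<omega> * t)" 1 y] by simp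
  show "rescaled_S \<omega> t (j x) = j (rescaled_T \<omega> t x)" for t x
    by (simp add: rescaled_S_apply rescaled_T_apply S_j linear_scale[OF j_linear])
qed

text \<open>With \<open>\<tau>\<close> = 1, the rescaling factor exp(\<omega>(1 - s)) is a scalar
  and moves from the semigroup onto the control, which stays integrable since the factor is at most
  exp |\<omega>| on [0,1].\<close>

lemma Lp_admissible_shift:
  fixes B :: "'u::banach_lattice \<Rightarrow>\<^sub>L 'y"
  assumes B: "positive_control j B" and p: "1 \<le> p"
  shows "Lp_admissible p D (\<lambda>x. A x + \<omega> *\<^sub>R x) j B"
  unfolding Lp_admissible_def
proof (intro exI[of _ "rescaled_T \<omega>"] exI[of _ "rescaled_S \<omega>"] exI[of _ 1] conjI allI impI)
  show "generates D (\<lambda>x. A x + \<omega> *\<^sub>R x) (rescaled_T \<omega>)"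
    by (rule rescaled_T_generator)
  show "extrapolated_semigroup j (rescaled_T \<omega>) (rescaled_S \<omega>)"
    by (rule extrapolated_semigroup_rescaled)
  show "0 < (1::real)"
    by simp
  fix u :: "real \<Rightarrow> 'u"
  assume "Lp_function p (lebesgue_on {0..}) u"
  note u = Lp_function_unit_interval[OF p this]
  let ?w = "\<lambda>s. exp (\<omega> * (1 - s)) *\<^sub>R u s"
  have cont: "(\<lambda>s::real. exp (\<omega> * (1 - s))) \<in> borel_measurable unit_interval"
    by (intro measurable_restrict_space1 measurable_completion) simp
  have norm_w: "(\<lambda>s. norm (?w s)) = (\<lambda>s. exp (\<omega> * (1 - s)) * norm (u s))"
    by simp
  have "strongly_measurable unit_interval ?w"
    by (rule strongly_measurable_compose[OF u(1)]) (intro tendsto_intros)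
  moreover have "(\<lambda>s. norm (?w s)) \<in> borel_measurable unit_interval"
    unfolding norm_w by (rule borel_measurable_times[OF cont u(2)])
  moreover have "(\<integral>\<^sup>+s. norm (?w s) \<partial>unit_interval) < \<infinity>"
  proof -
    have "(\<integral>\<^sup>+s. norm (?w s) \<partial>unit_interval) \<le> (\<integral>\<^sup>+s. ennreal (exp \<bar>\<omega>\<bar>) * norm (u s) \<partial>unit_interval)"
    proof (rule nn_integral_mono)
      fix s
      assume "s \<in> space unit_interval"
      then have "\<bar>1 - s\<bar> \<le> 1"
        by auto
      then have "\<bar>\<omega>\<bar> * \<bar>1 - s\<bar> \<le> \<bar>\<omega>\<bar> * 1"
        by (rule mult_left_mono) simp
      then have "\<omega> * (1 - s) \<le> \<bar>\<omega>\<bar>"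
        using abs_ge_self[of "\<omega> * (1 - s)"] by (simp add: abs_mult)
      then have "norm (?w s) \<le> exp \<bar>\<omega>\<bar> * norm (u s)"
        by (simp add: mult_right_mono)
      then show "ennreal (norm (?w s)) \<le> ennreal (exp \<bar>\<omega>\<bar>) * norm (u s)"
        by (simp only: ennreal_leI ennreal_mult[symmetric] exp_ge_zero norm_ge_zero)
    qed
    also have "\<dots> = ennreal (exp \<bar>\<omega>\<bar>) * (\<integral>\<^sup>+s. norm (u s) \<partial>unit_interval)"
      by (rule nn_integral_cmult[OF measurable_compose[OF u(2) measurable_ennreal]])
    also have "\<dots> < \<infinity>"
      using u(3) by (simp add: ennreal_mult_less_top)
    finally show ?thesis .
  qed
  ultimately obtain x where x: "has_strong_bochner_integral unit_interval (\<lambda>s. S (1 - s) (B (?w s))) (j x)"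
    using control_integral[OF B] by blast
  have "(\<lambda>s. rescaled_S \<omega> (1 - s) (B (u s))) = (\<lambda>s. S (1 - s) (B (?w s)))"
    by (simp add: rescaled_S_apply S_scale_right blinfun.scaleR_right fun_eq_iff)
  then show "\<exists>x. has_strong_bochner_integral unit_interval (\<lambda>s. rescaled_S \<omega> (1 - s) (B (u s))) (j x)"
    using x by (intro exI[of _ x]) (simp only:)
qed

end

text \<open>\<open>P\<close> is (m - A)R(l) and the outer map is (l - A)R(m), its inverse. They
  convert between the extrapolation norms formed at l and at m.\<close>

lemma resolvent_change_inverse:
  fixes A :: "'x::real_normed_vector \<Rightarrow> 'x"
  assumes l: "complex_of_real l \<in> resolvent_set D A" and m: "complex_of_real m \<in> resolvent_set D A"
  defines "P \<equiv> \<lambda>z. z + (m - l) *\<^sub>R resolvent D A l z"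
  shows "P z + (l - m) *\<^sub>R resolvent D A m (P z) = z"
proof -
  note lin = bounded_linear.linear[OF resolvent_bounded_linear[OF m]]
  have "resolvent D A m z - resolvent D A l z = (l - m) *\<^sub>R resolvent D A m (resolvent D A l z)"
    using resolvent_identity[OF m l, of z] by (simp add: algebra_simps)
  then have "resolvent D A m (P z) = resolvent D A m z - (resolvent D A m z - resolvent D A l z)"
    unfolding P_def linear_add[OF lin] linear_scale[OF lin]
    by (metis add_uminus_conv_diff minus_diff_eq scaleR_minus_left)
  then have "resolvent D A m (P z) = resolvent D A l z"
    by simp
  then show ?thesis
    by (simp add: P_def algebra_simps)
qed

theorem theorem2p1:
  fixes D :: "'x::banach_lattice set" and A :: "'x \<Rightarrow> 'x"
    and j :: "'x \<Rightarrow> 'y::banach" and B :: "'u::banach_lattice \<Rightarrow>\<^sub>L 'y"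
    and p \<mu>\<^sub>0 c :: real
  assumes "1 \<le> p"
    and "linear_operator D A" and "closure D = UNIV" and "resolvent_positive D A"
    and "spectral_bound D A < ereal \<mu>\<^sub>0" and "0 < c"
    and "\<And>x. 0 \<le> x \<Longrightarrow> c * norm x \<le> norm (resolvent D A \<mu>\<^sub>0 x)"
    and "extrapolation_space D A j"
    and "positive_control j B"
  shows "Lp_admissible p D A j B"
proof -
  obtain \<omega> M c' where
    pb: "power_bounded_resolvent D (\<lambda>x. A x + (- \<omega>) *\<^sub>R x) (\<lambda>l. resolvent D A (l + \<omega>)) M"
    and \<omega>: "complex_of_real \<omega> \<in> resolvent_set D A"
    and pos: "\<And>l x. 0 \<le> l \<Longrightarrow> 0 \<le> x \<Longrightarrow> 0 \<le> resolvent D A (l + \<omega>) x"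
    and c': "0 < c'" "\<And>x. 0 \<le> x \<Longrightarrow> c' * norm x \<le> norm (resolvent D A \<omega> x)"
    by (rule resolvent_positive_shift[OF assms(2-4) resolvent_set_above_spectral_bound[OF assms(5)] assms(6,7)])
      (assumption, (rule that; blast))
  obtain \<mu> where j: "linear j" "closure (range j) = UNIV"
    and \<mu>: "complex_of_real \<mu> \<in> resolvent_set D A" and norm_j: "\<And>x. norm (j x) = norm (resolvent D A \<mu> x)"
    using assms(8) unfolding extrapolation_space_def by blast
  \<comment> \<open>Dense range of the resolvent is what \<open>isometric_extension\<close> requires
    of its second map.\<close>
  have "D \<subseteq> range (resolvent D A \<mu>)"
    using resolvent_left[OF \<mu>] by (metis rangeI subsetI)
  then have dense: "closure (range (resolvent D A \<mu>)) = UNIV"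
    using closure_mono[of D "range (resolvent D A \<mu>)"] assms(3) by blast
  obtain K :: "'y \<Rightarrow>\<^sub>L 'x" and L :: "'x \<Rightarrow>\<^sub>L 'y"
    where K: "\<And>x. K (j x) = resolvent D A \<mu> x" and LK: "\<And>y. L (K y) = y" "\<And>z. K (L z) = z"
    by (rule isometric_extension[OF j bounded_linear.linear[OF resolvent_bounded_linear[OF \<mu>]] dense norm_j])
      (rule that; blast)
  \<comment> \<open>\<open>K\<close> belongs to the point \<open>\<mu>\<close> of the norm, while
    the locale is used at \<open>\<omega>\<close>. Since P R(\<mu>) = R(\<omega>), composing with
    \<open>P\<close> and its inverse \<open>Q\<close> changes the point.\<close>
  define P where "P = Blinfun (\<lambda>z. z + (\<mu> - \<omega>) *\<^sub>R resolvent D A \<omega> z)"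
  define Q where "Q = Blinfun (\<lambda>z. z + (\<omega> - \<mu>) *\<^sub>R resolvent D A \<mu> z)"
  have P: "P z = z + (\<mu> - \<omega>) *\<^sub>R resolvent D A \<omega> z" for z
    unfolding P_def by (subst bounded_linear_Blinfun_apply)
      (intro bounded_linear_add bounded_linear_ident bounded_linear_const_scaleR resolvent_bounded_linear \<omega>, rule refl)
  have Q: "Q z = z + (\<omega> - \<mu>) *\<^sub>R resolvent D A \<mu> z" for z
    unfolding Q_def by (subst bounded_linear_Blinfun_apply)
      (intro bounded_linear_add bounded_linear_ident bounded_linear_const_scaleR resolvent_bounded_linear \<mu>, rule refl)
  have QP: "Q (P z) = z" and PQ: "P (Q z) = z" for z
    unfolding P Q by (rule resolvent_change_inverse[OF \<omega> \<mu>] resolvent_change_inverse[OF \<mu> \<omega>])+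
  interpret power_bounded_resolvent D "\<lambda>x. A x + (- \<omega>) *\<^sub>R x" "\<lambda>l. resolvent D A (l + \<omega>)" M
    by (rule pb)
  interpret positive_extrapolation D "\<lambda>x. A x + (- \<omega>) *\<^sub>R x" "\<lambda>l. resolvent D A (l + \<omega>)" M j
    "P o\<^sub>L K" "L o\<^sub>L Q" c'
  proof (rule positive_extrapolation.intro[OF pb positive_extrapolation_axioms.intro])
    show "(P o\<^sub>L K) (j x) = resolvent D A (0 + \<omega>) x" for x
      using resolvent_identity[OF \<omega> \<mu>, of x] by (simp add: K P)
  qed (use pos c' j(1) in \<open>simp_all add: LK QP PQ\<close>)
  have "Lp_admissible p D (\<lambda>x. (A x + (- \<omega>) *\<^sub>R x) + \<omega> *\<^sub>R x) j B"
    by (rule Lp_admissible_shift[OF assms(9,1)])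
  then show "Lp_admissible p D A j B"
    by simp
qed

end
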